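(* Every tempered Euclidean Gibbs measure $\mu\in\mathcal G_t$ of the quantum lattice system described in the context is supported by the set of Hölder loops $\bigcap_{0\le\alpha<1/2}[C_\beta^\alpha]^{\mathbb Z^d}$. Moreover, for all $Q\ge1$ and $\alpha\in[0,\frac12)$, $$\sup_{\mu\in\mathcal G_t}\ \sup_{k\in\mathbb Z^d}\int_\Omega|\omega_k|^Q_{C^\alpha_\beta}\,d\mu(\omega)<\infty .$$
   Context: Fix $d\in\mathbb N$, $\beta>0$ (inverse temperature), $\mathfrak m>0$ (mass), $a^2>0$, $J>0$. The formal Hamiltonian is $-\frac1{2\mathfrak m}\sum_{k\in\mathbb Z^d}\frac{d^2}{dq_k^2}+\frac{a^2}2\sum_k q_k^2+\sum_k V(q_k)+J\sum_{\langle k,k'\rangle}(q_k-q_{k'})^2$, where $\langle k,k'\rangle$ runs over unordered pairs in $\mathbb Z^d$ with $|k-k'|=1$. The self-interaction $V\in C^2(\mathbb R)$ satisfies: there are constants $P>2$ and $K_V,C_V>0$ such that for all $q\in\mathbb R$ and $l=0,1,2$ $$K_V^{-1}|q|^{P-l}-C_V\le(\mathrm{sgn}\,q)^l\,V^{(l)}(q)\le K_V|q|^{P-l}+C_V .$$ Put $W(q,q'):=J(q-q')^2$. Loop spaces: $S_\beta$ is the circle of length $\beta$ with Lebesgue measure $d\tau$ and circle distance $\rho$; $C_\beta=C^0_\beta$ is the space of continuous functions $S_\beta\to\mathbb R$ with sup-norm; for $0<\alpha<1$, $C^\alpha_\beta$ is the usual Banach space of $\alpha$-Hölder continuous functions with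 norm $|\upsilon|_{C^\alpha_\beta}=\sup_\tau|\upsilon(\tau)|+\sup_{\tau\ne\tau'}|\upsilon(\tau)-\upsilon(\tau')|/\rho(\tau,\tau')^\alpha$ (equal to $+\infty$ off $C^\alpha_\beta$); $L^2_\beta=L^2(S_\beta,d\tau)$. $\gamma_\beta$ is the centered Gaussian measure on $C_\beta$ with correlation (covariance) operator $A_\beta^{-1}$ in $L^2_\beta$, where $A_\beta=-\mathfrak m\,\Delta_\beta+a^2\mathbf 1$ and $\Delta_\beta=d^2/d\tau^2$ is the Laplace operator on $S_\beta$. The configuration space is $\Omega=[C_\beta]^{\mathbb Z^d}\ni\omega=(\omega_k)_{k\in\mathbb Z^d}$ with the product topology and Borel $\sigma$-algebra $\mathcal B(\Omega)$. Tempered configurations: $$\Omega_t=\Big\{\omega\in\Omega:\ \sum_{k}e^{-\delta|k|}|\omega_k|^2_{L^2_\beta}<\infty\ \ \forall\delta\in(0,1)\Big\}.$$ Local specification: $\Lambda\Subset\mathbb Z^d$ means $\Lambda$ is finite and non-empty, $\Lambda^c=\mathbb Z^d\setminus\Lambda$, $\omega_\Lambda=(\omega_k)_{k\in\Lambda}$. For $\Lambda\Subset\mathbb Z^d$, $\xi\in\Omega$, $\Delta\in\mathcal B(\Omega)$, $$\pi_\Lambda(\Delta|\xi)=Z_\Lambda(\xi)^{-1}\int_{[C_\beta]^\Lambda}e^{-\mathcal I_\Lambda(\omega|\xi)}\mathbf 1_\Delta(\omega_\Lambda,\xi_{\Lambda^c})\prod_{k\in\Lambda}d\gamma_\beta(\omega_k),$$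 $$\mathcal I_\Lambda(\omega|\xi)=\int_{S_\beta}\Big[\sum_{k\in\Lambda}V(\omega_k)+\sum_{\langle k,k'\rangle\subset\Lambda}W(\omega_k,\omega_{k'})+\sum_{k\in\Lambda,\,k'\in\Lambda^c,\,|k-k'|=1}W(\omega_k,\xi_{k'})\Big]d\tau,$$ with $Z_\Lambda(\xi)$ the normalization making $\pi_\Lambda(\cdot|\xi)$ a probability measure. A Euclidean Gibbs measure is a probability measure $\mu$ on $(\Omega,\mathcal B(\Omega))$ with $\int_\Omega\mu(d\omega)\pi_\Lambda(\Delta|\omega)=\mu(\Delta)$ for all $\Lambda\Subset\mathbb Z^d$, $\Delta\in\mathcal B(\Omega)$. $\mathcal G_t$ is the set of tempered Euclidean Gibbs measures, i.e. those with $\mu(\Omega_t)=1$. *)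

theory Defs
  imports "HOL-Probability.Probability"
begin

section \<open>The lattice\<close>

text \<open>The lattice $Z^d$ is the type \<open>int ^ 'd\<close> with \<open>'d :: finite\<close>; $|k|$ is the Euclidean norm.\<close>

definition lnorm :: "int ^ 'd \<Rightarrow> real" where
  "lnorm k = norm (\<chi> i. real_of_int (k $ i))"

definition adjacent :: "int ^ 'd \<Rightarrow> int ^ 'd \<Rightarrow> bool" where
  "adjacent k k' \<longleftrightarrow> lnorm (k - k') = 1"


section \<open>Loop spaces\<close>

text \<open>Functions on the circle of length \<open>\<beta>\<close> are represented by \<open>\<beta>\<close>-periodic functions on the
  real line, with fundamental domain \<open>{0..<\<beta>}\<close>.  For a periodic function the norm of
  \<open>real \<Rightarrow>\<^sub>C real\<close> is the sup-norm over the circle.\<close>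

definition circle_periodic :: "real \<Rightarrow> (real \<Rightarrow> real) \<Rightarrow> bool" where
  "circle_periodic \<beta> f \<longleftrightarrow> (\<forall>t. f (t + \<beta>) = f t)"

definition circle_dist :: "real \<Rightarrow> real \<Rightarrow> real \<Rightarrow> real" where
  "circle_dist \<beta> s t = min \<bar>s - t\<bar> (\<beta> - \<bar>s - t\<bar>)"  \<comment> \<open>for \<open>s\<close>, \<open>t\<close> in \<open>{0..<\<beta>}\<close>\<close>

definition loops :: "real \<Rightarrow> (real \<Rightarrow>\<^sub>C real) set" where
  "loops \<beta> = {\<upsilon>. circle_periodic \<beta> (apply_bcontfun \<upsilon>)}"

definition hoelder_norm :: "real \<Rightarrow> real \<Rightarrow> (real \<Rightarrow>\<^sub>C real) \<Rightarrow> ennreal" where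
  "hoelder_norm \<beta> \<alpha> \<upsilon> =
     (if \<alpha> = 0 then ennreal (norm \<upsilon>)
      else ennreal (norm \<upsilon>) +
        (SUP (s, t) \<in> {(s, t). s \<in> {0..<\<beta>} \<and> t \<in> {0..<\<beta>} \<and> s \<noteq> t}.
           ennreal (\<bar>\<upsilon> s - \<upsilon> t\<bar> / circle_dist \<beta> s t powr \<alpha>)))"

definition hoelder_loops :: "real \<Rightarrow> real \<Rightarrow> (real \<Rightarrow>\<^sub>C real) set" where
  "hoelder_loops \<beta> \<alpha> = {\<upsilon> \<in> loops \<beta>. hoelder_norm \<beta> \<alpha> \<upsilon> < \<infinity>}"

text \<open>Real powers of extended nonnegative numbers (for positive exponents).\<close>

definition epowr :: "ennreal \<Rightarrow> real \<Rightarrow> ennreal" where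
  "epowr x Q = (if x = \<infinity> then \<infinity> else ennreal (enn2real x powr Q))"

definition L2_circle :: "real \<Rightarrow> (real \<Rightarrow> real) set" where
  "L2_circle \<beta> = {\<phi>. \<phi> \<in> borel_measurable borel \<and> circle_periodic \<beta> \<phi> \<and>
     set_integrable lborel {0..<\<beta>} (\<lambda>t. (\<phi> t)\<^sup>2)}"

definition L2_inner :: "real \<Rightarrow> (real \<Rightarrow> real) \<Rightarrow> (real \<Rightarrow> real) \<Rightarrow> real" where
  "L2_inner \<beta> \<phi> \<psi> = (LINT t:{0..<\<beta>}|lborel. \<phi> t * \<psi> t)"


section \<open>The Gaussian measure\<close>

text \<open>\<open>circle_laplacian \<beta> u w\<close>: \<open>u\<close> lies in the Sobolev space $H^2$ of the circle, the domain of
  the self-adjoint Laplacian, and $u'' = w$; that is, \<open>u\<close> is continuously differentiable and its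
  derivative \<open>v\<close> is absolutely continuous with derivative \<open>w\<close> in $L^2$.\<close>

definition circle_laplacian :: "real \<Rightarrow> (real \<Rightarrow> real) \<Rightarrow> (real \<Rightarrow> real) \<Rightarrow> bool" where
  "circle_laplacian \<beta> u w \<longleftrightarrow>
     w \<in> L2_circle \<beta> \<and> circle_periodic \<beta> u \<and>
     (\<exists>v. circle_periodic \<beta> v \<and>
        (\<forall>t. (u has_real_derivative v t) (at t)) \<and>
        (\<forall>s t. s \<le> t \<longrightarrow> v t - v s = (LINT x:{s..t}|lborel. w x)))"

text \<open>The graph of the operator $A = -m \Delta + a^2$ in $L^2$; the argument \<open>a2\<close> stands for
  $a^2$.\<close>

definition A_graph ::
    "real \<Rightarrow> real \<Rightarrow> real \<Rightarrow> (real \<Rightarrow> real) \<Rightarrow> (real \<Rightarrow> real) \<Rightarrow> bool" where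
  "A_graph \<beta> m a2 u \<phi> \<longleftrightarrow> \<phi> \<in> L2_circle \<beta> \<and>
     (\<exists>w. circle_laplacian \<beta> u w \<and> (AE t in lborel. \<phi> t = - m * w t + a2 * u t))"

definition centered_normal :: "real measure \<Rightarrow> bool" where
  "centered_normal N \<longleftrightarrow> N = return borel 0 \<or>
     (\<exists>\<sigma>>0. N = density lborel (\<lambda>x. ennreal (normal_density 0 \<sigma> x)))"

text \<open>By the Hahn-Banach theorem, every continuous linear functional on the loop space is the
  restriction of a bounded linear functional on \<open>real \<Rightarrow>\<^sub>C real\<close>.\<close>

definition centered_gaussian :: "real \<Rightarrow> (real \<Rightarrow>\<^sub>C real) measure \<Rightarrow> bool" where
  "centered_gaussian \<beta> \<gamma> \<longleftrightarrow> prob_space \<gamma> \<and>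
     space \<gamma> = loops \<beta> \<and> sets \<gamma> = sets (restrict_space borel (loops \<beta>)) \<and>
     (\<forall>L :: (real \<Rightarrow>\<^sub>C real) \<Rightarrow> real. bounded_linear L \<longrightarrow> centered_normal (distr \<gamma> borel L))"

text \<open>Since \<open>A\<close> is a bijection from its domain onto $L^2$, quantifying over its graph amounts to
  quantifying over all \<open>\<phi>\<close> in $L^2$ with $u = A^{-1} \varphi$.  The measure is uniquely determined
  by this predicate.\<close>

definition loop_gaussian :: "real \<Rightarrow> real \<Rightarrow> real \<Rightarrow> (real \<Rightarrow>\<^sub>C real) measure \<Rightarrow> bool" where
  "loop_gaussian \<beta> m a2 \<gamma> \<longleftrightarrow> centered_gaussian \<beta> \<gamma> \<and>
     (\<forall>u \<phi> \<psi>. A_graph \<beta> m a2 u \<phi> \<longrightarrow> \<psi> \<in> L2_circle \<beta> \<longrightarrow>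
        (LINT \<upsilon>|\<gamma>. L2_inner \<beta> \<phi> \<upsilon> * L2_inner \<beta> \<psi> \<upsilon>) = L2_inner \<beta> u \<psi>)"


section \<open>Configurations\<close>

definition configs :: "real \<Rightarrow> (int ^ 'd \<Rightarrow> real \<Rightarrow>\<^sub>C real) set" where
  "configs \<beta> = {\<omega>. \<forall>k. \<omega> k \<in> loops \<beta>}"

text \<open>\<open>borel\<close> refers to the library's topology on function types, the product topology.\<close>

definition config_borel :: "real \<Rightarrow> (int ^ 'd \<Rightarrow> real \<Rightarrow>\<^sub>C real) measure" where
  "config_borel \<beta> = restrict_space borel (configs \<beta>)"

definition tempered_configs :: "real \<Rightarrow> (int ^ 'd \<Rightarrow> real \<Rightarrow>\<^sub>C real) set" where
  "tempered_configs \<beta> = {\<omega> \<in> configs \<beta>. \<forall>\<delta>\<in>{0<..<1}.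
     (\<lambda>k. exp (- \<delta> * lnorm k) * L2_inner \<beta> (\<omega> k) (\<omega> k)) summable_on UNIV}"


section \<open>Local specification and Gibbs measures\<close>

definition self_interaction :: "(real \<Rightarrow> real) \<Rightarrow> bool" where
  "self_interaction V \<longleftrightarrow>
     (\<forall>q. V differentiable (at q)) \<and> (\<forall>q. deriv V differentiable (at q)) \<and>
     continuous_on UNIV (deriv (deriv V)) \<and>
     (\<exists>P K C. P > 2 \<and> K > 0 \<and> C > 0 \<and>
        (\<forall>q. \<forall>l\<in>{0, 1, 2 :: nat}.
           inverse K * \<bar>q\<bar> powr (P - real l) - C \<le> sgn q ^ l * (deriv ^^ l) V q \<and>
           sgn q ^ l * (deriv ^^ l) V q \<le> K * \<bar>q\<bar> powr (P - real l) + C))"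

definition pair_potential :: "real \<Rightarrow> real \<Rightarrow> real \<Rightarrow> real" where
  "pair_potential J q q' = J * (q - q')\<^sup>2"

text \<open>In the second sum each unordered pair inside \<open>\<Lambda>\<close> occurs as two ordered pairs, hence the
  factor one half.\<close>

definition local_energy ::
    "real \<Rightarrow> (real \<Rightarrow> real) \<Rightarrow> real \<Rightarrow> (int ^ 'd) set \<Rightarrow>
     (int ^ 'd \<Rightarrow> real \<Rightarrow>\<^sub>C real) \<Rightarrow> (int ^ 'd \<Rightarrow> real \<Rightarrow>\<^sub>C real) \<Rightarrow> real" where
  "local_energy \<beta> V J \<Lambda> \<omega> \<xi> = (LINT \<tau>:{0..<\<beta>}|lborel.
     (\<Sum>k\<in>\<Lambda>. V (\<omega> k \<tau>)) +
     (\<Sum>(k, k') \<in> {(k, k'). k \<in> \<Lambda> \<and> k' \<in> \<Lambda> \<and> adjacent k k'}.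
        pair_potential J (\<omega> k \<tau>) (\<omega> k' \<tau>)) / 2 +
     (\<Sum>(k, k') \<in> {(k, k'). k \<in> \<Lambda> \<and> k' \<notin> \<Lambda> \<and> adjacent k k'}.
        pair_potential J (\<omega> k \<tau>) (\<xi> k' \<tau>)))"

definition partition_function ::
    "real \<Rightarrow> (real \<Rightarrow> real) \<Rightarrow> real \<Rightarrow> (real \<Rightarrow>\<^sub>C real) measure \<Rightarrow> (int ^ 'd) set \<Rightarrow>
     (int ^ 'd \<Rightarrow> real \<Rightarrow>\<^sub>C real) \<Rightarrow> ennreal" where
  "partition_function \<beta> V J \<gamma> \<Lambda> \<xi> =
     (\<integral>\<^sup>+\<omega>. ennreal (exp (- local_energy \<beta> V J \<Lambda> \<omega> \<xi>)) \<partial>(\<Pi>\<^sub>M k\<in>\<Lambda>. \<gamma>))"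

definition local_spec ::
    "real \<Rightarrow> (real \<Rightarrow> real) \<Rightarrow> real \<Rightarrow> (real \<Rightarrow>\<^sub>C real) measure \<Rightarrow> (int ^ 'd) set \<Rightarrow>
     (int ^ 'd \<Rightarrow> real \<Rightarrow>\<^sub>C real) set \<Rightarrow> (int ^ 'd \<Rightarrow> real \<Rightarrow>\<^sub>C real) \<Rightarrow> ennreal" where
  "local_spec \<beta> V J \<gamma> \<Lambda> \<Delta> \<xi> =
     (\<integral>\<^sup>+\<omega>. ennreal (exp (- local_energy \<beta> V J \<Lambda> \<omega> \<xi>)) *
        indicator \<Delta> (\<lambda>k. if k \<in> \<Lambda> then \<omega> k else \<xi> k) \<partial>(\<Pi>\<^sub>M k\<in>\<Lambda>. \<gamma>))
     / partition_function \<beta> V J \<gamma> \<Lambda> \<xi>"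

definition gibbs_measures ::
    "real \<Rightarrow> (real \<Rightarrow> real) \<Rightarrow> real \<Rightarrow> (real \<Rightarrow>\<^sub>C real) measure \<Rightarrow>
     (int ^ 'd \<Rightarrow> real \<Rightarrow>\<^sub>C real) measure set" where
  "gibbs_measures \<beta> V J \<gamma> = {\<mu>. prob_space \<mu> \<and>
     space \<mu> = configs \<beta> \<and> sets \<mu> = sets (config_borel \<beta>) \<and>
     (\<forall>\<Lambda> \<Delta>. finite \<Lambda> \<longrightarrow> \<Lambda> \<noteq> {} \<longrightarrow> \<Delta> \<in> sets (config_borel \<beta>) \<longrightarrow>
        (\<integral>\<^sup>+\<omega>. local_spec \<beta> V J \<gamma> \<Lambda> \<Delta> \<omega> \<partial>\<mu>) = emeasure \<mu> \<Delta>)}"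

definition tempered_gibbs_measures ::
    "real \<Rightarrow> (real \<Rightarrow> real) \<Rightarrow> real \<Rightarrow> (real \<Rightarrow>\<^sub>C real) measure \<Rightarrow>
     (int ^ 'd \<Rightarrow> real \<Rightarrow>\<^sub>C real) measure set" where
  "tempered_gibbs_measures \<beta> V J \<gamma> =
     {\<mu> \<in> gibbs_measures \<beta> V J \<gamma>. emeasure \<mu> (tempered_configs \<beta>) = 1}"

end

(* Only the single-site equilibrium equations are used.  Write X_k for the squared L^2-norm of
   omega_k.  Given the neighbouring loops, the density of omega_k with respect to gamma is at most
   C_M exp(J * sum of the neighbouring X_j) * exp(- M X_k) for every M, because V grows faster than
   quadratically and the partition function is bounded below by restricting to loops of bounded
   norm on which the linear coupling to the neighbours is nonnegative (a half-space, which has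
   gamma-measure at least 1/2).

   Hence "X_k > r while the neighbours are at most 4 r" has probability O(exp(- M r)).  If
   X_k > r, either such an atypical site is met along some path of neighbours, at level 4^n r
   after n steps, or there are values above 4^n r at distance at most n for every n.  For large n
   temperedness excludes the latter, so P(X_k > r) = O(exp(- M r)) for every M, uniformly in k and
   in the Gibbs measure.  No a priori integrability is needed.

   A further conditioning step transfers the Gaussian tail of the Hoelder norm, which comes from
   E (v(t) - v(s))^2 <= |t - s| / m by dyadic chaining as in Kolmogorov's continuity theorem. *)

theory Submission
  imports Defs
begin

section \<open>A periodic boundary value problem\<close>

text \<open>The covariance of \<open>\<gamma>\<close> is prescribed only against right-hand sides in
  L2, while an increment v(t) - v(s) is a difference of point evaluations. It is therefore
  approximated by pairings with a difference of two narrow bumps. For such a function phi the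
  equation A u = phi is solved by splitting A into two first-order operators, and the energy
  identity bounds the variance (u, phi) by |t - s| / m uniformly in the width of the bumps; Fatou's
  lemma then reaches the increment itself.

  In the equilibrium equations two rates compete. Neighbours at level S cost a factor exp(B S), with
  B = J D and D the number of unit vectors of the lattice, whereas the rate M is free and is chosen
  after B. Along a path the level grows by 4 per step: this outruns exp(n / 2), the growth that
  temperedness with weight 1/2 permits over n steps, and the decay at these levels pays for the at
  most D^n sites reached. For the Hoelder norm the level 2^n is matched with neighbours at level n,
  so that a Gaussian moment of high order, worth 4^(-q n), absorbs exp(B n).\<close>

lemma antiderivative_ex:
  fixes f :: "real \<Rightarrow> real"
  assumes "continuous_on UNIV f"
  shows "\<exists>G. \<forall>x. (G has_real_derivative f x) (at x)"
proof -
  have "\<exists>F. \<forall>x :: real. (-\<infinity>::ereal) < x \<longrightarrow> x < (\<infinity>::ereal) \<longrightarrow> (F has_vector_derivative f x) (at x)"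
  proof (rule einterval_antiderivative)
    show "isCont f x" for x
      using assms by (simp add: continuous_on_eq_continuous_at)
  qed simp
  then show ?thesis
    by (simp add: has_real_derivative_iff_has_vector_derivative)
qed

lemma periodic_fold:
  assumes "circle_periodic \<beta> f"
  shows "f (t + of_int k * \<beta>) = f t"
proof (induction k rule: int_induct[where k = 0])
  case (step1 k)
  then show ?case using assms unfolding circle_periodic_def
    by (metis (no_types, opaque_lifting) add.assoc distrib_right mult_1 of_int_1 of_int_add)
next
  case (step2 k)
  have "f (t + of_int (k - 1) * \<beta> + \<beta>) = f (t + of_int (k - 1) * \<beta>)"
    using assms unfolding circle_periodic_def by blast
  moreover have "t + of_int (k - 1) * \<beta> + \<beta> = t + of_int k * \<beta>"
    by (simp add: algebra_simps)
  ultimately show ?case using step2 by metis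
qed simp_all


section \<open>Integrals of continuous functions over intervals and periods\<close>

lemma set_integrable_continuous:
  fixes f :: "real \<Rightarrow> real"
  assumes "continuous_on UNIV f"
  shows "set_integrable lborel {a..<b} f"
  by (rule set_integrable_subset[OF borel_integrable_atLeastAtMost'[of a b]])
    (use assms in \<open>auto intro: continuous_on_subset\<close>)

lemma set_integral_half_open:
  fixes f :: "real \<Rightarrow> real"
  assumes "continuous_on UNIV f"
  shows "(LINT x:{a..<b}|lborel. f x) = (LINT x:{a..b}|lborel. f x)"
proof (rule set_integral_cong_set)
  have [measurable]: "f \<in> borel_measurable borel"
    using assms by (rule borel_measurable_continuous_onI)
  show "set_borel_measurable lborel {a..<b} f" "set_borel_measurable lborel {a..b} f"
    unfolding set_borel_measurable_def by measurable
  show "AE x in lborel. (x \<in> {a..b}) = (x \<in> {a..<b})"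
    using AE_lborel_singleton[of b] by eventually_elim auto
qed

lemma set_integral_FTC:
  fixes f :: "real \<Rightarrow> real"
  assumes "\<And>x. (G has_real_derivative f x) (at x)" "continuous_on UNIV f" "a \<le> b"
  shows "(LINT x:{a..<b}|lborel. f x) = G b - G a" "(LINT x:{a..b}|lborel. f x) = G b - G a"
proof -
  show *: "(LINT x:{a..b}|lborel. f x) = G b - G a"
    unfolding set_lebesgue_integral_def
    using assms by (intro integral_FTC_atLeastAtMost)
      (auto intro: continuous_on_subset has_vector_derivative_at_within
        simp: has_real_derivative_iff_has_vector_derivative)
  with set_integral_half_open[OF assms(2)] show "(LINT x:{a..<b}|lborel. f x) = G b - G a"
    by simp
qed


text \<open>For an antiderivative G of F the increment G(x + \<beta>) - G(x) has derivative F(x +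
  \<beta>) - F(x) = 0, so it does not depend on the start of the period.\<close>

lemma set_integral_periodic_shift:
  fixes F :: "real \<Rightarrow> real"
  assumes F: "continuous_on UNIV F" "circle_periodic \<beta> F" and "\<beta> > 0"
  shows "(LINT x:{0..<\<beta>}|lborel. F (x + t)) = (LINT x:{0..<\<beta>}|lborel. F x)"
proof -
  obtain G where G: "\<And>x. (G has_real_derivative F x) (at x)"
    using antiderivative_ex[OF F(1)] by blast
  have Gs: "((\<lambda>x. G (x + c)) has_real_derivative F (x + c)) (at x)" for x c
    using G[of "x + c"] by (simp add: DERIV_shift)
  have "((\<lambda>x. G (x + \<beta>) - G x) has_real_derivative (F (x + \<beta>) - F x)) (at x)" for x
    by (intro derivative_intros Gs G)
  then have "((\<lambda>x. G (x + \<beta>) - G x) has_real_derivative 0) (at x)" for x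
    using F(2) by (simp add: circle_periodic_def)
  from DERIV_isconst_all[OF allI, OF this, of 0 t]
  have *: "G (t + \<beta>) - G t = G \<beta> - G 0" by simp
  have c: "continuous_on UNIV (\<lambda>x. F (x + t))"
    by (intro continuous_on_compose2[OF F(1)] continuous_intros) auto
  have "(LINT x:{0..<\<beta>}|lborel. F (x + t)) = G (\<beta> + t) - G (0 + t)"
    using \<open>\<beta> > 0\<close> by (intro set_integral_FTC[OF Gs c]) auto
  also have "\<dots> = (LINT x:{0..<\<beta>}|lborel. F x)"
    using set_integral_FTC(1)[OF G F(1), of 0 \<beta>] \<open>\<beta> > 0\<close> * by (simp add: add.commute)
  finally show ?thesis .
qed

text \<open>Variation of constants gives a one-parameter family of solutions of v' + \<kappa> v = g.
  Since exp(- \<kappa> \<beta>) differs from 1, one member agrees at 0 and \<beta>, and uniqueness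
  for the homogeneous equation spreads this to all x.\<close>

lemma periodic_first_order_ode:
  fixes g :: "real \<Rightarrow> real"
  assumes g: "continuous_on UNIV g" "circle_periodic \<beta> g" and "\<beta> > 0" "\<kappa> \<noteq> 0"
  obtains v where "circle_periodic \<beta> v" "\<And>x. (v has_real_derivative g x - \<kappa> * v x) (at x)"
proof -
  have "continuous_on UNIV (\<lambda>x. exp (\<kappa> * x) * g x)"
    by (intro continuous_intros g)
  then obtain G where G: "\<And>x. (G has_real_derivative exp (\<kappa> * x) * g x) (at x)"
    using antiderivative_ex by blast
  define v where "v c x = exp (- \<kappa> * x) * (c + G x)" for c x
  have v: "(v c has_real_derivative g x - \<kappa> * v c x) (at x)" for c x
  proof -
    have "((\<lambda>x. exp (- \<kappa> * x)) has_real_derivative - \<kappa> * exp (- \<kappa> * x)) (at x)"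
      by (rule derivative_eq_intros refl)+ simp
    moreover have "((\<lambda>x. c + G x) has_real_derivative exp (\<kappa> * x) * g x) (at x)"
      by (rule derivative_eq_intros G refl)+ simp
    ultimately have "(v c has_real_derivative - \<kappa> * exp (- \<kappa> * x) * (c + G x)
        + exp (\<kappa> * x) * g x * exp (- \<kappa> * x)) (at x)"
      unfolding v_def by (rule DERIV_mult)
    moreover have "exp (\<kappa> * x) * g x * exp (- \<kappa> * x) = g x"
      by (simp add: exp_minus)
    ultimately show ?thesis by (simp only: v_def) (simp add: mult.assoc)
  qed
  have "exp (- \<kappa> * \<beta>) \<noteq> 1"
    using \<open>\<beta> > 0\<close> \<open>\<kappa> \<noteq> 0\<close> by simp
  \<comment> \<open>The solution of \<open>v c \<beta> = v c 0\<close>, which is a linear equation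
    in c.\<close>
  define c where "c = (G 0 - exp (- \<kappa> * \<beta>) * G \<beta>) / (exp (- \<kappa> * \<beta>) - 1)"
  have c: "c * (exp (- \<kappa> * \<beta>) - 1) = G 0 - exp (- \<kappa> * \<beta>) * G \<beta>"
    using \<open>exp (- \<kappa> * \<beta>) \<noteq> 1\<close> by (simp add: c_def)
  have vb: "v c \<beta> = v c 0"
    using c by (simp add: v_def algebra_simps)
  have vs: "((\<lambda>x. v c (x + \<beta>)) has_real_derivative g (x + \<beta>) - \<kappa> * v c (x + \<beta>)) (at x)" for x
    using v[of c "x + \<beta>"] by (simp add: DERIV_shift)
  \<comment> \<open>The difference of v and its shift solves y' = - \<kappa> y; the integrating
    factor turns it into a constant, which is 0 at x = 0.\<close>
  define h where "h x = exp (\<kappa> * x) * (v c (x + \<beta>) - v c x)" for x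
  have "(h has_real_derivative 0) (at x)" for x
  proof -
    have "((\<lambda>x. exp (\<kappa> * x)) has_real_derivative \<kappa> * exp (\<kappa> * x)) (at x)"
      by (rule derivative_eq_intros refl)+ simp
    from DERIV_mult[OF this DERIV_diff[OF vs v]]
    have "(h has_real_derivative \<kappa> * exp (\<kappa> * x) * (v c (x + \<beta>) - v c x)
        + ((g (x + \<beta>) - \<kappa> * v c (x + \<beta>)) - (g x - \<kappa> * v c x)) * exp (\<kappa> * x)) (at x)"
      unfolding h_def .
    moreover have "g (x + \<beta>) = g x"
      using g(2) by (simp add: circle_periodic_def)
    ultimately show ?thesis
      by (simp only:) (simp add: algebra_simps)
  qed
  then have "h x = h 0" for x
    using DERIV_isconst_all by blast
  then have "v c (x + \<beta>) = v c x" for x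
    using vb by (simp add: h_def)
  then show ?thesis
    using v that unfolding circle_periodic_def by blast
qed

lemma continuous_periodic_imp_L2:
  assumes "continuous_on UNIV f" "circle_periodic \<beta> f"
  shows "f \<in> L2_circle \<beta>"
  unfolding L2_circle_def using assms
  by (auto intro!: borel_measurable_continuous_onI set_integrable_continuous continuous_intros)

text \<open>With \<kappa>^2 = a^2 / m the equation reads (d/dx + \<kappa>) (- d/dx + \<kappa>) u =
  \<phi> / m. It splits into y' + \<kappa> y = \<phi> / m followed by u' - \<kappa> u = - y, two
  periodic problems of first order with nonzero coefficient.\<close>

lemma periodic_second_order_ode:
  fixes \<phi> :: "real \<Rightarrow> real"
  assumes \<phi>: "continuous_on UNIV \<phi>" "circle_periodic \<beta> \<phi>" and "\<beta> > 0" "m > 0" "a\<^sup>2 > 0"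
  obtains u v w where "circle_periodic \<beta> u" "circle_periodic \<beta> v" "circle_periodic \<beta> w"
    "\<And>x. (u has_real_derivative v x) (at x)" "\<And>x. (v has_real_derivative w x) (at x)"
    "continuous_on UNIV w" "\<And>x. \<phi> x = - m * w x + a\<^sup>2 * u x"
proof -
  define \<kappa> where "\<kappa> = sqrt (a\<^sup>2 / m)"
  have \<kappa>: "\<kappa> > 0" "\<kappa>\<^sup>2 = a\<^sup>2 / m"
    using \<open>m > 0\<close> \<open>a\<^sup>2 > 0\<close> by (auto simp: \<kappa>_def)
  have "continuous_on UNIV (\<lambda>x. \<phi> x / m)" "circle_periodic \<beta> (\<lambda>x. \<phi> x / m)"
    using \<phi> by (auto intro!: continuous_intros simp: circle_periodic_def \<open>m > 0\<close>[THEN less_imp_neq, symmetric])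
  then obtain y where y: "circle_periodic \<beta> y" "\<And>x. (y has_real_derivative \<phi> x / m - \<kappa> * y x) (at x)"
    using periodic_first_order_ode[of "\<lambda>x. \<phi> x / m" \<beta> \<kappa>] \<open>\<beta> > 0\<close> \<kappa>(1) by auto
  have cy: "continuous_on UNIV y"
    using y(2) by (meson DERIV_isCont continuous_at_imp_continuous_on)
  then have "continuous_on UNIV (\<lambda>x. - y x)" "circle_periodic \<beta> (\<lambda>x. - y x)"
    using y(1) by (auto intro!: continuous_intros simp: circle_periodic_def)
  then obtain u where u: "circle_periodic \<beta> u" "\<And>x. (u has_real_derivative - y x - (- \<kappa>) * u x) (at x)"
    using periodic_first_order_ode[of "\<lambda>x. - y x" \<beta> "- \<kappa>"] \<open>\<beta> > 0\<close> \<kappa>(1) by auto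
  have cu: "continuous_on UNIV u"
    using u(2) by (meson DERIV_isCont continuous_at_imp_continuous_on)
  define v where "v x = \<kappa> * u x - y x" for x
  define w where "w x = \<kappa>\<^sup>2 * u x - \<phi> x / m" for x
  show ?thesis
  proof (rule that)
    show "circle_periodic \<beta> u" by fact
    show "circle_periodic \<beta> v" "circle_periodic \<beta> w"
      using u(1) y(1) \<phi>(2) by (auto simp: circle_periodic_def v_def w_def)
    show uv: "(u has_real_derivative v x) (at x)" for x
      using u(2)[of x] by (simp add: v_def)
    have "(v has_real_derivative \<kappa> * v x - (\<phi> x / m - \<kappa> * y x)) (at x)" for x
      using DERIV_diff[OF DERIV_cmult[OF uv[of x], of \<kappa>] y(2)[of x]] unfolding v_def[abs_def] .
    then show "(v has_real_derivative w x) (at x)" for x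
      by (simp add: v_def w_def algebra_simps power2_eq_square)
    show "continuous_on UNIV w"
      unfolding w_def[abs_def] using \<open>m > 0\<close> by (intro continuous_intros cu \<phi>) auto
    show "\<phi> x = - m * w x + a\<^sup>2 * u x" for x
      using \<open>m > 0\<close> by (simp add: w_def \<kappa>(2) algebra_simps)
  qed
qed

text \<open>Testing $Au = \varphi$ with $u$ gives $m |u'|^2 + a^2 |u|^2 = (u, \varphi)$, and the increments
  of $u$ are controlled by $m |u'|^2$.  So a functional that is dominated by increments of length
  $l$ has variance at most $l / m$.\<close>

lemma periodic_increment_bound:
  fixes u v :: "real \<Rightarrow> real"
  assumes uv: "\<And>x. (u has_real_derivative v x) (at x)" and v: "continuous_on UNIV v" "circle_periodic \<beta> v"
    and "\<beta> > 0" "m > 0" "\<bar>t - s\<bar> \<le> \<beta>"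
  shows "\<bar>u t - u s\<bar> \<le> m / 2 * (LINT x:{0..<\<beta>}|lborel. (v x)\<^sup>2) + \<bar>t - s\<bar> / (2 * m)"
proof -
  have main: "\<bar>u t - u s\<bar> \<le> m / 2 * (LINT x:{0..<\<beta>}|lborel. (v x)\<^sup>2) + (t - s) / (2 * m)"
    if "s \<le> t" "t \<le> s + \<beta>" for s t
  proof -
    have c2: "continuous_on UNIV (\<lambda>x. (v x)\<^sup>2)" by (intro continuous_intros v)
    \<comment> \<open>The window from s to t is enlarged to a full period, which is then moved to
      the fundamental domain; it may straddle a multiple of \<beta>.\<close>
    have "(LINT x:{s..<t}|lborel. (v x)\<^sup>2) \<le> (LINT x:{s..<s+\<beta>}|lborel. (v x)\<^sup>2)"
    proof -
      have "(LINT x:{s..<t}|lborel. (v x)\<^sup>2) \<le> (LINT x:{s..<t}|lborel. (v x)\<^sup>2) + (LINT x:{t..<s+\<beta>}|lborel. (v x)\<^sup>2)"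
        by (simp add: set_lebesgue_integral_def)
      also have "\<dots> = (LINT x:{s..<t} \<union> {t..<s+\<beta>}|lborel. (v x)\<^sup>2)"
        by (intro set_integral_Un[symmetric] set_integrable_continuous c2) auto
      also have "{s..<t} \<union> {t..<s+\<beta>} = {s..<s+\<beta>}" using that by auto
      finally show ?thesis .
    qed
    also have "\<dots> = (LINT x:{0..<\<beta>}|lborel. (v (x + s))\<^sup>2)"
    proof -
      obtain G where G: "\<And>x. (G has_real_derivative (v x)\<^sup>2) (at x)"
        using antiderivative_ex[OF c2] by blast
      have Gs: "((\<lambda>x. G (x + s)) has_real_derivative (v (x + s))\<^sup>2) (at x)" for x
        using G[of "x + s"] by (simp add: DERIV_shift)
      have c: "continuous_on UNIV (\<lambda>x. (v (x + s))\<^sup>2)"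
        by (intro continuous_intros continuous_on_compose2[OF v(1)]) auto
      show ?thesis
        using set_integral_FTC(1)[OF G c2, of s "s + \<beta>"] set_integral_FTC(1)[OF Gs c, of 0 \<beta>] \<open>\<beta> > 0\<close>
        by (simp add: add.commute)
    qed
    also have "\<dots> = (LINT x:{0..<\<beta>}|lborel. (v x)\<^sup>2)"
      using set_integral_periodic_shift[OF c2 _ \<open>\<beta> > 0\<close>, of s] v(2) by (simp add: circle_periodic_def)
    finally have le: "(LINT x:{s..<t}|lborel. (v x)\<^sup>2) \<le> (LINT x:{0..<\<beta>}|lborel. (v x)\<^sup>2)" .
    have "\<bar>u t - u s\<bar> = \<bar>LINT x:{s..<t}|lborel. v x\<bar>"
      using set_integral_FTC(1)[OF uv v(1), of s t] that by simp
    also have "\<dots> \<le> (LINT x:{s..<t}|lborel. \<bar>v x\<bar>)"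
      using set_integral_norm_bound[OF set_integrable_continuous[OF v(1), of s t]] by simp
    also have "\<dots> \<le> (LINT x:{s..<t}|lborel. m / 2 * (v x)\<^sup>2 + 1 / (2 * m))"
    proof (rule set_integral_mono)
      show "set_integrable lborel {s..<t} (\<lambda>x. \<bar>v x\<bar>)"
           "set_integrable lborel {s..<t} (\<lambda>x. m / 2 * (v x)\<^sup>2 + 1 / (2 * m))"
        by (intro set_integrable_continuous continuous_intros v)+
      fix x
      \<comment> \<open>Young's inequality, weighted so that exactly half of the energy term m
        |u'|^2 appears and can be absorbed.\<close>
      have "0 \<le> (m * \<bar>v x\<bar> - 1)\<^sup>2" by simp
      then have "2 * m * \<bar>v x\<bar> \<le> m\<^sup>2 * (v x)\<^sup>2 + 1"
        by (simp add: power2_eq_square algebra_simps flip: abs_mult)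
      then show "\<bar>v x\<bar> \<le> m / 2 * (v x)\<^sup>2 + 1 / (2 * m)"
        using \<open>m > 0\<close> by (simp add: field_simps power2_eq_square)
    qed
    also have "\<dots> = m / 2 * (LINT x:{s..<t}|lborel. (v x)\<^sup>2) + (LINT x:{s..<t}|lborel. 1 / (2 * m))"
      by (subst set_integral_add) (auto intro!: set_integrable_continuous continuous_intros v)
    also have "(LINT x:{s..<t}|lborel. 1 / (2 * m)) = (t - s) / (2 * m)"
      using that by (simp add: set_lebesgue_integral_def)
    also have "m / 2 * (LINT x:{s..<t}|lborel. (v x)\<^sup>2) \<le> m / 2 * (LINT x:{0..<\<beta>}|lborel. (v x)\<^sup>2)"
      using le \<open>m > 0\<close> by simp
    finally show ?thesis by simp
  qed
  show ?thesis
  proof (cases "s \<le> t")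
    case True
    then show ?thesis using main[of s t] assms(6) by simp
  next
    case False
    then show ?thesis using main[of t s] assms(6) by (simp add: abs_minus_commute)
  qed
qed

lemma energy_identity:
  fixes u v w :: "real \<Rightarrow> real"
  assumes per: "circle_periodic \<beta> u" "circle_periodic \<beta> v"
    and uv: "\<And>x. (u has_real_derivative v x) (at x)" and vw: "\<And>x. (v has_real_derivative w x) (at x)"
    and w: "continuous_on UNIV w" and \<phi>: "\<And>x. \<phi> x = - m * w x + a\<^sup>2 * u x" and "\<beta> > 0"
  shows "L2_inner \<beta> u \<phi> = m * (LINT x:{0..<\<beta>}|lborel. (v x)\<^sup>2) + a\<^sup>2 * (LINT x:{0..<\<beta>}|lborel. (u x)\<^sup>2)"
proof -
  have cu: "continuous_on UNIV u" and cv: "continuous_on UNIV v"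
    using uv vw by (meson DERIV_isCont continuous_at_imp_continuous_on)+
  \<comment> \<open>Integration by parts over a period: the boundary values of u v cancel.\<close>
  have "((\<lambda>x. u x * v x) has_real_derivative (v x)\<^sup>2 + u x * w x) (at x)" for x
    by (rule derivative_eq_intros uv vw refl)+ (simp add: power2_eq_square)
  from set_integral_FTC(1)[OF this, of 0 \<beta>]
  have "(LINT x:{0..<\<beta>}|lborel. (v x)\<^sup>2 + u x * w x) = u \<beta> * v \<beta> - u 0 * v 0"
    using \<open>\<beta> > 0\<close> by (simp add: continuous_intros cu cv w)
  moreover have "u \<beta> = u 0" "v \<beta> = v 0"
    using per unfolding circle_periodic_def by (metis add_0)+
  ultimately have 0: "(LINT x:{0..<\<beta>}|lborel. (v x)\<^sup>2) + (LINT x:{0..<\<beta>}|lborel. u x * w x) = 0"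
    by (subst (asm) set_integral_add) (auto intro!: set_integrable_continuous continuous_intros cu cv w)
  have "L2_inner \<beta> u \<phi> = (LINT x:{0..<\<beta>}|lborel. a\<^sup>2 * (u x)\<^sup>2 - m * (u x * w x))"
    unfolding L2_inner_def \<phi> by (simp add: power2_eq_square algebra_simps)
  also have "\<dots> = a\<^sup>2 * (LINT x:{0..<\<beta>}|lborel. (u x)\<^sup>2) - m * (LINT x:{0..<\<beta>}|lborel. u x * w x)"
    by (subst set_integral_diff) (auto intro!: set_integrable_continuous continuous_intros cu cv w)
  also have "(LINT x:{0..<\<beta>}|lborel. u x * w x) = - (LINT x:{0..<\<beta>}|lborel. (v x)\<^sup>2)"
    using 0 by linarith
  finally show ?thesis by simp
qed

text \<open>The hypothesis \<open>incr\<close> expresses that (u, \<phi>) is dominated by increments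
  of u over distance l. It gives E \<le> E / 2 + l / (2 m) for E = (u, \<phi>), because half of m
  |u'|^2 is at most E / 2. The resulting bound depends on \<phi> only through l, hence is uniform
  over mollifications.\<close>

lemma A_graph_ex:
  fixes \<phi> :: "real \<Rightarrow> real"
  assumes \<phi>: "continuous_on UNIV \<phi>" "circle_periodic \<beta> \<phi>" and "\<beta> > 0" "m > 0" "a\<^sup>2 > 0" "l \<le> \<beta>"
    and incr: "\<And>u B. continuous_on UNIV u \<Longrightarrow> circle_periodic \<beta> u \<Longrightarrow>
      (\<And>x y. \<bar>x - y\<bar> = l \<Longrightarrow> \<bar>u x - u y\<bar> \<le> B) \<Longrightarrow> L2_inner \<beta> u \<phi> \<le> B"
  obtains u where "A_graph \<beta> m (a\<^sup>2) u \<phi>" "L2_inner \<beta> u \<phi> \<le> l / m"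
proof -
  obtain u v w where uvw: "circle_periodic \<beta> u" "circle_periodic \<beta> v" "circle_periodic \<beta> w"
    "\<And>x. (u has_real_derivative v x) (at x)" "\<And>x. (v has_real_derivative w x) (at x)"
    "continuous_on UNIV w" "\<And>x. \<phi> x = - m * w x + a\<^sup>2 * u x"
    using periodic_second_order_ode[OF assms(1-5)] by metis
  have cu: "continuous_on UNIV u" and cv: "continuous_on UNIV v"
    using uvw by (meson DERIV_isCont continuous_at_imp_continuous_on)+
  have "L2_inner \<beta> u \<phi> \<le> m / 2 * (LINT x:{0..<\<beta>}|lborel. (v x)\<^sup>2) + l / (2 * m)"
    using \<open>l \<le> \<beta>\<close>
    by (intro incr cu uvw) (use periodic_increment_bound[OF uvw(4) cv uvw(2) \<open>\<beta> > 0\<close> \<open>m > 0\<close>] in auto)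
  moreover have "L2_inner \<beta> u \<phi> = m * (LINT x:{0..<\<beta>}|lborel. (v x)\<^sup>2) + a\<^sup>2 * (LINT x:{0..<\<beta>}|lborel. (u x)\<^sup>2)"
    by (rule energy_identity) fact+
  moreover have "0 \<le> a\<^sup>2 * (LINT x:{0..<\<beta>}|lborel. (u x)\<^sup>2)"
    by (simp add: set_lebesgue_integral_def)
  ultimately have "L2_inner \<beta> u \<phi> \<le> l / m"
    by (simp add: field_simps)
  moreover have "A_graph \<beta> m (a\<^sup>2) u \<phi>"
    unfolding A_graph_def circle_laplacian_def
    using uvw \<phi> set_integral_FTC(2)[OF uvw(5,6)]
    by (intro conjI exI[of _ w] exI[of _ v] continuous_periodic_imp_L2) auto
  ultimately show ?thesis using that by blast
qed

section \<open>Mollified increments and normal moments\<close>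

lemma set_integral_nonneg_pos:
  fixes f :: "real \<Rightarrow> real"
  assumes f: "continuous_on UNIV f" "\<And>x. 0 \<le> f x" and "f 0 > 0" "\<beta> > 0"
  shows "(LINT x:{0..<\<beta>}|lborel. f x) > 0"
proof -
  have "isCont f 0" using f(1) by (simp add: continuous_on_eq_continuous_at)
  then obtain d where d: "d > 0" "\<And>x. \<bar>x\<bar> < d \<Longrightarrow> \<bar>f x - f 0\<bar> < f 0 / 2"
    unfolding continuous_at_eps_delta using \<open>f 0 > 0\<close>
    by (metis diff_zero dist_real_def half_gt_zero)
  define e where "e = min d \<beta>"
  have e: "e > 0" "e \<le> \<beta>" "e \<le> d" using d(1) \<open>\<beta> > 0\<close> by (auto simp: e_def)
  have "0 < e * (f 0 / 2)" using e \<open>f 0 > 0\<close> by simp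
  also have "\<dots> = (LINT x:{0..<e}|lborel. f 0 / 2)"
    using e by (simp add: set_lebesgue_integral_def)
  also have "\<dots> \<le> (LINT x:{0..<e}|lborel. f x)"
  proof (rule set_integral_mono)
    show "set_integrable lborel {0..<e} (\<lambda>x. f 0 / 2)" "set_integrable lborel {0..<e} f"
      by (intro set_integrable_continuous continuous_intros f)+
    show "f 0 / 2 \<le> f x" if "x \<in> {0..<e}" for x
    proof -
      have "\<bar>f x - f 0\<bar> < f 0 / 2" using d(2)[of x] that e by auto
      then show ?thesis by linarith
    qed
  qed
  also have "\<dots> \<le> (LINT x:{0..<e}|lborel. f x) + (LINT x:{e..<\<beta>}|lborel. f x)"
    using f(2) by (simp add: set_lebesgue_integral_def)
  also have "\<dots> = (LINT x:{0..<e} \<union> {e..<\<beta>}|lborel. f x)"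
    by (intro set_integral_Un[symmetric] set_integrable_continuous f) auto
  also have "{0..<e} \<union> {e..<\<beta>} = {0..<\<beta>}" using e by auto
  finally show ?thesis .
qed

text \<open>A truncated cosine is continuous and \<beta>-periodic on the whole line by its very
  form, and its support shrinks to the multiples of \<beta> as n grows.\<close>

definition cos_bump :: "real \<Rightarrow> nat \<Rightarrow> real \<Rightarrow> real" where
  "cos_bump \<beta> n x = max 0 (cos (2 * pi * x / \<beta>) - 1 + 1 / real (Suc n))"

definition cos_bump_mass :: "real \<Rightarrow> nat \<Rightarrow> real" where
  "cos_bump_mass \<beta> n = (LINT x:{0..<\<beta>}|lborel. cos_bump \<beta> n x)"

lemma continuous_cos_bump [continuous_intros]:
  fixes f :: "real \<Rightarrow> real"
  shows "continuous_on S f \<Longrightarrow> continuous_on S (\<lambda>x. cos_bump \<beta> n (f x))"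
proof -
  assume "continuous_on S f"
  then have "continuous_on S (\<lambda>x. cos (2 * pi / \<beta> * f x))"
    by (intro continuous_on_cos continuous_on_mult_left)
  then show ?thesis
    unfolding cos_bump_def by (intro continuous_on_max continuous_on_add continuous_on_diff) auto
qed

lemma cos_bump_nonneg [simp]: "0 \<le> cos_bump \<beta> n x"
  by (simp add: cos_bump_def)

lemma cos_bump_periodic: "\<beta> > 0 \<Longrightarrow> cos_bump \<beta> n (x + \<beta>) = cos_bump \<beta> n x"
  by (simp add: cos_bump_def add_divide_distrib distrib_left)

lemma cos_bump_mass_pos: "\<beta> > 0 \<Longrightarrow> cos_bump_mass \<beta> n > 0"
  unfolding cos_bump_mass_def
  by (rule set_integral_nonneg_pos) (auto intro!: continuous_intros simp: cos_bump_def)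

text \<open>The points of [0, \<beta>] where f is at least e away from f(0) form a compact set that
  avoids 0 and, by periodicity, also \<beta>. The cosine stays below 1 by a fixed gap there, so the
  bump vanishes on it once 1 / (n + 1) is below the gap. Measuring closeness by the values of f
  treats both ends of the period at once.\<close>

lemma cos_bump_concentrates:
  assumes f: "continuous_on UNIV f" "circle_periodic \<beta> f" and "\<beta> > 0" and e: "e > (0::real)"
  shows "\<exists>n0. \<forall>n\<ge>n0. \<forall>x\<in>{0..<\<beta>}. cos_bump \<beta> n x > 0 \<longrightarrow> \<bar>f x - f 0\<bar> < e"
proof -
  define K where "K = {0..\<beta>} \<inter> {x. \<bar>f x - f 0\<bar> \<ge> e}"
  have "closed {x. \<bar>f x - f 0\<bar> \<ge> e}"
    by (intro closed_Collect_le continuous_intros f)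
  then have "compact K" unfolding K_def by (intro compact_Int_closed) auto
  have "f \<beta> = f 0" using f(2) unfolding circle_periodic_def by (metis add_0)
  have cos1: "cos (2 * pi * x / \<beta>) < 1" if "x \<in> K" for x
  proof -
    have "x \<noteq> 0" "x \<noteq> \<beta>" "0 \<le> x" "x \<le> \<beta>"
      using that e \<open>f \<beta> = f 0\<close> by (auto simp: K_def)
    then have "0 < x / \<beta>" "x / \<beta> < 1" using \<open>\<beta> > 0\<close> by auto
    have "cos (2 * pi * x / \<beta>) \<noteq> 1"
    proof
      assume "cos (2 * pi * x / \<beta>) = 1"
      then obtain k :: int where "2 * pi * x / \<beta> = of_int k * 2 * pi"
        unfolding cos_one_2pi_int by blast
      then have "2 * pi * (x / \<beta>) = 2 * pi * of_int k" by (simp add: mult.commute)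
      then have "x / \<beta> = of_int k" by (subst (asm) mult_cancel_left) simp
      then show False using \<open>0 < x / \<beta>\<close> \<open>x / \<beta> < 1\<close> by simp
    qed
    then show ?thesis using cos_le_one[of "2 * pi * x / \<beta>"] by linarith
  qed
  obtain n0 where n0: "\<And>x. x \<in> K \<Longrightarrow> cos (2 * pi * x / \<beta>) \<le> 1 - 1 / real (Suc n0)"
  proof (cases "K = {}")
    case False
    have "continuous_on K (\<lambda>x. cos (2 * pi * x / \<beta>))"
      using \<open>\<beta> > 0\<close> by (intro continuous_intros) auto
    from continuous_attains_sup[OF \<open>compact K\<close> False this] obtain y where
      y: "y \<in> K" "\<And>x. x \<in> K \<Longrightarrow> cos (2 * pi * x / \<beta>) \<le> cos (2 * pi * y / \<beta>)" by blast
    obtain n0 where "1 / real (Suc n0) < 1 - cos (2 * pi * y / \<beta>)"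
      using nat_approx_posE[of "1 - cos (2 * pi * y / \<beta>)"] cos1[OF y(1)] by auto
    then show ?thesis using y(2) that[of n0] by fastforce
  qed (use that in auto)
  have "\<bar>f x - f 0\<bar> < e" if "n \<ge> n0" "x \<in> {0..<\<beta>}" "cos_bump \<beta> n x > 0" for n x
  proof (rule ccontr)
    assume "\<not> \<bar>f x - f 0\<bar> < e"
    then have "x \<in> K" using that by (auto simp: K_def)
    from n0[OF this] have "cos (2 * pi * x / \<beta>) - 1 + 1 / real (Suc n0) \<le> 0" by simp
    moreover have "1 / real (Suc n) \<le> 1 / real (Suc n0)" using that(1) by (simp add: frac_le)
    ultimately show False using that(3) by (simp add: cos_bump_def)
  qed
  then show ?thesis by blast
qed

lemma cos_bump_limit:
  assumes f: "continuous_on UNIV f" "circle_periodic \<beta> f" and "\<beta> > 0"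
  shows "(\<lambda>n. (LINT x:{0..<\<beta>}|lborel. cos_bump \<beta> n x * f x) / cos_bump_mass \<beta> n) \<longlonglongrightarrow> f 0"
proof (rule LIMSEQ_I)
  fix r :: real assume "r > 0"
  then have r2: "r / 2 > 0" by simp
  obtain n0 where n0: "\<And>n x. n \<ge> n0 \<Longrightarrow> x \<in> {0..<\<beta>} \<Longrightarrow> cos_bump \<beta> n x > 0 \<Longrightarrow> \<bar>f x - f 0\<bar> < r / 2"
    using cos_bump_concentrates[OF assms r2] by blast
  show "\<exists>no. \<forall>n\<ge>no. norm ((LINT x:{0..<\<beta>}|lborel. cos_bump \<beta> n x * f x) / cos_bump_mass \<beta> n - f 0) < r"
  proof (intro exI[of _ n0] allI impI)
    fix n assume "n \<ge> n0"
    let ?b = "cos_bump \<beta> n" and ?c = "cos_bump_mass \<beta> n"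
    have "?c > 0" by (rule cos_bump_mass_pos) fact
    have "(LINT x:{0..<\<beta>}|lborel. ?b x * f x) - ?c * f 0 = (LINT x:{0..<\<beta>}|lborel. ?b x * f x - ?b x * f 0)"
      unfolding cos_bump_mass_def
      by (subst set_integral_diff) (auto intro!: set_integrable_continuous continuous_intros f)
    also have "\<bar>\<dots>\<bar> \<le> (LINT x:{0..<\<beta>}|lborel. \<bar>?b x * f x - ?b x * f 0\<bar>)"
    proof -
      have "set_integrable lborel {0..<\<beta>} (\<lambda>x. ?b x * f x - ?b x * f 0)"
        by (intro set_integrable_continuous continuous_intros f)
      from set_integral_norm_bound[OF this] show ?thesis by simp
    qed
    also have "\<dots> \<le> (LINT x:{0..<\<beta>}|lborel. ?b x * (r / 2))"
    proof (rule set_integral_mono)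
      fix x assume x: "x \<in> {0..<\<beta>}"
      have "\<bar>?b x * f x - ?b x * f 0\<bar> = ?b x * \<bar>f x - f 0\<bar>"
        by (simp add: abs_mult flip: right_diff_distrib)
      also have "\<dots> \<le> ?b x * (r / 2)"
        using n0[OF \<open>n \<ge> n0\<close> x] cos_bump_nonneg[of \<beta> n x]
        by (cases "?b x = 0") (auto intro!: mult_left_mono simp: less_le)
      finally show "\<bar>?b x * f x - ?b x * f 0\<bar> \<le> ?b x * (r / 2)" .
    qed (intro set_integrable_continuous continuous_intros f)+
    also have "\<dots> = ?c * (r / 2)" unfolding cos_bump_mass_def by simp
    finally have "\<bar>(LINT x:{0..<\<beta>}|lborel. ?b x * f x) - ?c * f 0\<bar> \<le> ?c * (r / 2)" .
    then have "\<bar>(LINT x:{0..<\<beta>}|lborel. ?b x * f x) / ?c - f 0\<bar> \<le> r / 2"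
      using \<open>?c > 0\<close> by (simp add: abs_le_iff field_simps)
    then show "norm ((LINT x:{0..<\<beta>}|lborel. ?b x * f x) / ?c - f 0) < r"
      using \<open>r > 0\<close> by simp
  qed
qed

text \<open>A continuous approximation of the difference of the point masses at t and s on the
  circle.\<close>

definition increment_mollifier :: "real \<Rightarrow> real \<Rightarrow> real \<Rightarrow> nat \<Rightarrow> real \<Rightarrow> real" where
  "increment_mollifier \<beta> t s n x = (cos_bump \<beta> n (x - t) - cos_bump \<beta> n (x - s)) / cos_bump_mass \<beta> n"

lemma continuous_increment_mollifier: "\<beta> > 0 \<Longrightarrow> continuous_on UNIV (increment_mollifier \<beta> t s n)"
  unfolding increment_mollifier_def[abs_def] using cos_bump_mass_pos[of \<beta> n]
  by (intro continuous_intros) auto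

lemma periodic_increment_mollifier: "\<beta> > 0 \<Longrightarrow> circle_periodic \<beta> (increment_mollifier \<beta> t s n)"
  using cos_bump_periodic[of \<beta> n "x - t" for x t]
  by (simp add: circle_periodic_def increment_mollifier_def diff_add_eq)

text \<open>Periodicity moves the translations from the bumps to f. The pairing becomes one weighted
  average of the increments f(x + t) - f(x + s), from which both the limit and the uniform bound can
  be read off.\<close>

lemma L2_inner_increment_mollifier:
  assumes f: "continuous_on UNIV f" "circle_periodic \<beta> f" and "\<beta> > 0"
  shows "L2_inner \<beta> f (increment_mollifier \<beta> t s n) =
    (LINT x:{0..<\<beta>}|lborel. cos_bump \<beta> n x * (f (x + t) - f (x + s))) / cos_bump_mass \<beta> n"
proof -
  let ?b = "cos_bump \<beta> n" and ?c = "cos_bump_mass \<beta> n"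
  have cs: "continuous_on UNIV (\<lambda>x. f (x + c))" for c
    by (intro continuous_on_compose2[OF f(1)] continuous_intros) auto
  have shift: "(LINT x:{0..<\<beta>}|lborel. ?b (x - t) * f x) = (LINT x:{0..<\<beta>}|lborel. ?b x * f (x + t))" for t
  proof -
    have "continuous_on UNIV (\<lambda>x. ?b (x - t) * f x)" by (intro continuous_intros f)
    moreover have "circle_periodic \<beta> (\<lambda>x. ?b (x - t) * f x)"
      using cos_bump_periodic[OF \<open>\<beta> > 0\<close>, of n "x - t" for x] f(2)
      by (simp add: circle_periodic_def diff_add_eq)
    ultimately show ?thesis
      using set_integral_periodic_shift[OF _ _ \<open>\<beta> > 0\<close>, of "\<lambda>x. ?b (x - t) * f x" t] by simp
  qed
  have "L2_inner \<beta> f (increment_mollifier \<beta> t s n) =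
      (LINT x:{0..<\<beta>}|lborel. (?b (x - t) * f x - ?b (x - s) * f x) / ?c)"
    unfolding L2_inner_def increment_mollifier_def by (simp add: algebra_simps)
  also have "\<dots> = (LINT x:{0..<\<beta>}|lborel. ?b (x - t) * f x - ?b (x - s) * f x) / ?c"
    by (rule set_integral_divide_zero)
  also have "(LINT x:{0..<\<beta>}|lborel. ?b (x - t) * f x - ?b (x - s) * f x) =
      (LINT x:{0..<\<beta>}|lborel. ?b x * f (x + t)) - (LINT x:{0..<\<beta>}|lborel. ?b x * f (x + s))"
    by (subst set_integral_diff) (auto intro!: set_integrable_continuous continuous_intros f simp: shift)
  also have "\<dots> = (LINT x:{0..<\<beta>}|lborel. ?b x * (f (x + t) - f (x + s)))"
    unfolding right_diff_distrib
    by (subst set_integral_diff) (auto intro!: set_integrable_continuous continuous_intros cs)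
  finally show ?thesis .
qed

text \<open>An average with total weight 1 cannot exceed a bound on the averaged increments. The
  hypothesis on f has the shape of \<open>incr\<close> in \<open>A_graph_ex\<close>, with l = |t -
  s|.\<close>

lemma L2_inner_increment_mollifier_le:
  assumes f: "continuous_on UNIV f" "circle_periodic \<beta> f" and "\<beta> > 0"
    and B: "\<And>x y. \<bar>x - y\<bar> = \<bar>t - s\<bar> \<Longrightarrow> \<bar>f x - f y\<bar> \<le> B"
  shows "L2_inner \<beta> f (increment_mollifier \<beta> t s n) \<le> B"
proof -
  have cs: "continuous_on UNIV (\<lambda>x. f (x + c))" for c
    by (intro continuous_on_compose2[OF f(1)] continuous_intros) auto
  have "(LINT x:{0..<\<beta>}|lborel. cos_bump \<beta> n x * (f (x + t) - f (x + s)))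
      \<le> (LINT x:{0..<\<beta>}|lborel. cos_bump \<beta> n x * B)"
  proof (rule set_integral_mono)
    show "cos_bump \<beta> n x * (f (x + t) - f (x + s)) \<le> cos_bump \<beta> n x * B" for x
      using B[of "x + t" "x + s"] by (intro mult_left_mono) auto
  qed (intro set_integrable_continuous continuous_intros cs)+
  also have "\<dots> = cos_bump_mass \<beta> n * B"
    unfolding cos_bump_mass_def by simp
  finally show ?thesis
    using cos_bump_mass_pos[OF \<open>\<beta> > 0\<close>, of n]
    by (simp add: L2_inner_increment_mollifier[OF assms(1-3)] field_simps)
qed

lemma L2_inner_increment_mollifier_limit:
  assumes f: "continuous_on UNIV f" "circle_periodic \<beta> f" and "\<beta> > 0"
  shows "(\<lambda>n. L2_inner \<beta> f (increment_mollifier \<beta> t s n)) \<longlonglongrightarrow> f t - f s"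
proof -
  have "continuous_on UNIV (\<lambda>x. f (x + c))" for c
    by (intro continuous_on_compose2[OF f(1)] continuous_intros) auto
  then have "continuous_on UNIV (\<lambda>x. f (x + t) - f (x + s))"
    by (intro continuous_intros)
  moreover have "circle_periodic \<beta> (\<lambda>x. f (x + t) - f (x + s))"
    using f(2) by (simp add: circle_periodic_def) (metis add.assoc add.commute)
  ultimately show ?thesis
    using cos_bump_limit[OF _ _ \<open>\<beta> > 0\<close>, of "\<lambda>x. f (x + t) - f (x + s)"]
    by (simp add: L2_inner_increment_mollifier[OF assms])
qed

text \<open>The covariance in \<open>loop_gaussian\<close> is a Bochner integral, which would be 0
  by default for a non-integrable function. Square integrability makes it a genuine second
  moment.\<close>

lemma centered_normal_square_integrable:
  assumes "centered_normal N"
  shows "integrable N (\<lambda>x. x\<^sup>2)"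
  using assms unfolding centered_normal_def
proof (elim disjE exE conjE)
  assume "N = return borel 0"
  then show ?thesis by (intro integrableI_bounded) (auto simp: nn_integral_return)
next
  fix \<sigma> :: real assume \<sigma>: "\<sigma> > 0" "N = density lborel (\<lambda>x. ennreal (normal_density 0 \<sigma> x))"
  have "integrable lborel (\<lambda>x. normal_density 0 \<sigma> x *\<^sub>R x\<^sup>2)"
    using normal_moment_even[OF \<sigma>(1), of 0 1] by (auto dest: integrable.intros)
  then show ?thesis
    unfolding \<sigma>(2) by (subst integrable_density) auto
qed

text \<open>Markov's inequality for the moment of order 2 q. The factor (2 q)! / (2^q q!) is that
  moment of the standard normal law, and s may be any upper bound of the variance.\<close>

lemma centered_normal_tail:
  assumes N: "centered_normal N" and var: "(\<integral>\<^sup>+y. ennreal (y\<^sup>2) \<partial>N) \<le> ennreal s"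
    and "0 \<le> s" "x > 0"
  shows "emeasure N {y. \<bar>y\<bar> > x} \<le> ennreal (fact (2 * q) / (2 ^ q * fact q) * s ^ q / x ^ (2 * q))"
  using N unfolding centered_normal_def
proof (elim disjE exE conjE)
  assume "N = return borel 0"
  then show ?thesis using \<open>x > 0\<close> by (simp add: indicator_def)
next
  fix \<sigma> :: real assume \<sigma>: "\<sigma> > 0" and Neq: "N = density lborel (\<lambda>x. ennreal (normal_density 0 \<sigma> x))"
  have mom: "(\<integral>\<^sup>+y. ennreal (y ^ (2 * k)) \<partial>N) = ennreal (fact (2 * k) / (2 ^ k * fact k) * (\<sigma>\<^sup>2) ^ k)" for k
  proof -
    have "(\<integral>\<^sup>+y. ennreal (y ^ (2 * k)) \<partial>N) = (\<integral>\<^sup>+y. ennreal (normal_density 0 \<sigma> y * (y - 0) ^ (2 * k)) \<partial>lborel)"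
      unfolding Neq by (subst nn_integral_density) (auto simp: ennreal_mult')
    also have "\<dots> = ennreal (fact (2 * k) / ((2 / \<sigma>\<^sup>2) ^ k * fact k))"
      using normal_moment_even[OF \<sigma>, of 0 k]
      by (intro nn_integral_eq_integral[THEN trans] arg_cong[where f = ennreal])
        (auto dest: integrable.intros has_bochner_integral_integral_eq simp: power_mult)
    finally show ?thesis by (simp add: power_divide)
  qed
  have "\<sigma>\<^sup>2 \<le> s"
    using var mom[of 1] \<open>0 \<le> s\<close> by (simp add: fact_numeral)
  have "sets N = sets borel" by (simp add: Neq)
  have "emeasure N {y. \<bar>y\<bar> > x} = (\<integral>\<^sup>+y. indicator {y. \<bar>y\<bar> > x} y \<partial>N)"
    by (intro nn_integral_indicator[symmetric]) (simp add: \<open>sets N = sets borel\<close>)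
  also have "\<dots> \<le> (\<integral>\<^sup>+y. ennreal (1 / x ^ (2 * q)) * ennreal (y ^ (2 * q)) \<partial>N)"
  proof (intro nn_integral_mono)
    fix y :: real
    have "x ^ (2 * q) \<le> y ^ (2 * q)" if "\<bar>y\<bar> > x"
      using power_mono[of x "\<bar>y\<bar>" "2 * q"] that \<open>x > 0\<close> by (simp add: power_even_abs)
    then show "indicator {y. \<bar>y\<bar> > x} y \<le> ennreal (1 / x ^ (2 * q)) * ennreal (y ^ (2 * q))"
      using \<open>x > 0\<close> by (auto simp: indicator_def ennreal_mult'[symmetric])
  qed
  also have "\<dots> = ennreal (1 / x ^ (2 * q)) * ennreal (fact (2 * q) / (2 ^ q * fact q) * (\<sigma>\<^sup>2) ^ q)"
    by (subst nn_integral_cmult) (auto simp: mom \<open>sets N = sets borel\<close> cong: measurable_cong_sets)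
  also have "\<dots> = ennreal (fact (2 * q) / (2 ^ q * fact q) * (\<sigma>\<^sup>2) ^ q / x ^ (2 * q))"
    using \<open>x > 0\<close> by (simp flip: ennreal_mult')
  also have "\<dots> \<le> ennreal (fact (2 * q) / (2 ^ q * fact q) * s ^ q / x ^ (2 * q))"
    using \<open>\<sigma>\<^sup>2 \<le> s\<close> \<open>x > 0\<close> by (intro ennreal_leI divide_right_mono mult_left_mono power_mono) auto
  finally show ?thesis .
qed

text \<open>The density is symmetric, so the two closed half-lines have equal mass and together
  cover the line; the point mass at 0 lies in both.\<close>

lemma centered_normal_half:
  assumes "centered_normal N"
  shows "emeasure N {0..} \<ge> 1 / 2"
  using assms unfolding centered_normal_def
proof (elim disjE exE conjE)
  assume "N = return borel 0"
  then show ?thesis by (simp add: divide_le_posI_ennreal)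
next
  fix \<sigma> :: real assume \<sigma>: "\<sigma> > 0" and N: "N = density lborel (\<lambda>x. ennreal (normal_density 0 \<sigma> x))"
  interpret prob_space N unfolding N by (rule prob_space_normal_density) fact
  have "emeasure N {0..} = (\<integral>\<^sup>+x. ennreal (normal_density 0 \<sigma> x) * indicator {0..} x \<partial>lborel)"
    unfolding N by (rule emeasure_density) auto
  also have "\<dots> = (\<integral>\<^sup>+x. ennreal (normal_density 0 \<sigma> (- x)) * indicator {0..} (- x) \<partial>lborel)"
    by (subst nn_integral_real_affine[where c = "-1" and t = 0]) auto
  also have "\<dots> = (\<integral>\<^sup>+x. ennreal (normal_density 0 \<sigma> x) * indicator {..0} x \<partial>lborel)"
    by (intro nn_integral_cong) (auto simp: normal_density_def indicator_def)
  also have "\<dots> = emeasure N {..0}"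
    unfolding N by (rule emeasure_density[symmetric]) auto
  finally have eq: "emeasure N {0..} = emeasure N {..0}" .
  have "1 = emeasure N (space N)" by (simp add: emeasure_space_1)
  also have "\<dots> \<le> emeasure N ({0..} \<union> {..0})"
    by (intro emeasure_mono) (auto simp: N)
  also have "\<dots> \<le> emeasure N {0..} + emeasure N {..0}"
    by (intro emeasure_subadditive) (auto simp: N)
  finally have "1 \<le> 2 * emeasure N {0..}" by (simp add: eq mult_2)
  then show ?thesis by (intro divide_le_posI_ennreal) auto
qed

section \<open>Dyadic chaining\<close>

lemma bounded_linear_eval: "bounded_linear (\<lambda>\<upsilon> :: real \<Rightarrow>\<^sub>C real. \<upsilon> t)"
  by (rule bounded_linear_intro[of _ 1]) (use norm_bounded[where 'b = real, unfolded real_norm_def] in auto)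

lemma continuous_on_eval [continuous_intros]:
  "continuous_on S (\<lambda>\<upsilon> :: real \<Rightarrow>\<^sub>C real. \<upsilon> t)"
  using bounded_linear_eval by (rule linear_continuous_on)

text \<open>Stated on all bounded continuous functions, not only on loops: the partial maps are then
  bounded linear functionals of the kind over which \<open>centered_gaussian\<close>
  quantifies.\<close>

lemma bounded_bilinear_L2_inner:
  assumes "\<beta> > 0"
  shows "bounded_bilinear (\<lambda>(\<upsilon> :: real \<Rightarrow>\<^sub>C real) (\<upsilon>' :: real \<Rightarrow>\<^sub>C real). L2_inner \<beta> \<upsilon> \<upsilon>')"
proof
  fix a a' b b' :: "real \<Rightarrow>\<^sub>C real" and r :: real
  show "L2_inner \<beta> (a + a') b = L2_inner \<beta> a b + L2_inner \<beta> a' b"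
    unfolding L2_inner_def plus_bcontfun.rep_eq distrib_right
    by (intro set_integral_add set_integrable_continuous continuous_intros continuous_on_apply_bcontfun)
  show "L2_inner \<beta> a (b + b') = L2_inner \<beta> a b + L2_inner \<beta> a b'"
    unfolding L2_inner_def plus_bcontfun.rep_eq distrib_left
    by (intro set_integral_add set_integrable_continuous continuous_intros continuous_on_apply_bcontfun)
  show "L2_inner \<beta> (r *\<^sub>R a) b = r *\<^sub>R L2_inner \<beta> a b" "L2_inner \<beta> a (r *\<^sub>R b) = r *\<^sub>R L2_inner \<beta> a b"
    unfolding L2_inner_def by (simp_all add: mult.assoc mult.left_commute)
  show "\<exists>K. \<forall>(a :: real \<Rightarrow>\<^sub>C real) (b :: real \<Rightarrow>\<^sub>C real). norm (L2_inner \<beta> (apply_bcontfun a) (apply_bcontfun b)) \<le> norm a * norm b * K"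
  proof (intro exI[of _ \<beta>] allI)
    fix a b :: "real \<Rightarrow>\<^sub>C real"
    have "norm (L2_inner \<beta> a b) \<le> (LINT t:{0..<\<beta>}|lborel. norm (a t * b t))"
      unfolding L2_inner_def
      by (intro set_integral_norm_bound set_integrable_continuous continuous_intros continuous_on_apply_bcontfun)
    also have "\<dots> \<le> (LINT t:{0..<\<beta>}|lborel. norm a * norm b)"
    proof (rule set_integral_mono)
      show "norm (a t * b t) \<le> norm a * norm b" for t
        using norm_bounded[of a t] norm_bounded[of b t] by (simp add: abs_mult mult_mono)
    qed (intro set_integrable_continuous continuous_intros continuous_on_apply_bcontfun)+
    also have "\<dots> = norm a * norm b * \<beta>"
      using assms by (simp add: set_lebesgue_integral_def)
    finally show "norm (L2_inner \<beta> a b) \<le> norm a * norm b * \<beta>" .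
  qed
qed

lemma borel_measurable_L2_inner:
  assumes "\<beta> > 0"
  shows "(\<lambda>\<upsilon> :: real \<Rightarrow>\<^sub>C real. L2_inner \<beta> \<upsilon> \<upsilon>) \<in> borel_measurable borel"
  by (intro borel_measurable_continuous_onI bounded_bilinear.continuous_on[OF bounded_bilinear_L2_inner[OF assms]]
    continuous_on_id)

text \<open>The supremum runs over uncountably many pairs, but each term is continuous in the loop,
  so the norm is lower semicontinuous: a superlevel set is a union of open sets.\<close>

lemma borel_measurable_hoelder_norm:
  assumes "\<beta> > 0"
  shows "hoelder_norm \<beta> \<alpha> \<in> borel_measurable borel"
proof (cases "\<alpha> = 0")
  case True
  then show ?thesis unfolding hoelder_norm_def[abs_def] by simp
next
  case False
  let ?I = "{(s, t). s \<in> {0..<\<beta>} \<and> t \<in> {0..<\<beta>} \<and> s \<noteq> t}"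
  let ?f = "\<lambda>(s, t) (\<upsilon> :: real \<Rightarrow>\<^sub>C real). ennreal (\<bar>\<upsilon> s - \<upsilon> t\<bar> / circle_dist \<beta> s t powr \<alpha>)"
  have "(0, \<beta> / 2) \<in> ?I" using assms by auto
  then have ne: "?I \<noteq> {}" by blast
  \<comment> \<open>The sup-norm is taken inside the supremum, which requires a nonempty index
    set.\<close>
  have eq: "hoelder_norm \<beta> \<alpha> \<upsilon> = (SUP p\<in>?I. ennreal (norm \<upsilon>) + ?f p \<upsilon>)" for \<upsilon>
    using False ne by (simp add: hoelder_norm_def ennreal_SUP_add_right case_prod_beta)
  show ?thesis
  proof (rule borel_measurableI_greater)
    fix y :: ennreal
    have "open {\<upsilon>. y < ennreal (norm \<upsilon>) + ?f p \<upsilon>}" for p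
      unfolding case_prod_beta divide_inverse
      by (intro open_Collect_less continuous_intros continuous_on_ennreal)
    moreover have "{\<upsilon> \<in> space borel. y < hoelder_norm \<beta> \<alpha> \<upsilon>} = (\<Union>p\<in>?I. {\<upsilon>. y < ennreal (norm \<upsilon>) + ?f p \<upsilon>})"
      unfolding eq by (auto simp: less_SUP_iff)
    ultimately have "open {\<upsilon> \<in> space borel. y < hoelder_norm \<beta> \<alpha> \<upsilon>}"
      by (simp only:) blast
    then show "{\<upsilon> \<in> space borel. y < hoelder_norm \<beta> \<alpha> \<upsilon>} \<in> sets borel" by simp
  qed
qed

text \<open>Both s and t are joined to their grid points at the level n where the mesh is comparable
  with |s - t|; there these grid points coincide or are adjacent. The constant counts one link
  between them and two geometric tails l / (1 - l); the factor (2 / \<beta>)^\<alpha> comes from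
  2^(-n) < 2 |s - t| / \<beta>.\<close>

lemma dyadic_chaining:
  fixes f :: "real \<Rightarrow> real"
  assumes f: "continuous_on UNIV f" and "\<beta> > 0" "\<alpha> > 0" "0 \<le> b"
    and l: "l = 2 powr (- \<alpha>)"
    and incr: "\<And>n (i :: int). \<bar>f (of_int (i + 1) * (\<beta> / 2 ^ n)) - f (of_int i * (\<beta> / 2 ^ n))\<bar> \<le> b * l ^ n"
    and "\<bar>s - t\<bar> \<le> \<beta>"
  shows "\<bar>f s - f t\<bar> \<le> b * (1 + 2 * (l / (1 - l))) * (2 / \<beta>) powr \<alpha> * \<bar>s - t\<bar> powr \<alpha>"
proof (cases "s = t")
  case False
  have l01: "0 < l" "l < 1" using \<open>\<alpha> > 0\<close> powr_less_mono[of "- \<alpha>" 0 "2::real"] by (auto simp: l)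
  define k where "k s n = \<lfloor>s / (\<beta> / 2 ^ n)\<rfloor>" for s :: real and n :: nat
  define p where "p s n = of_int (k s n) * (\<beta> / 2 ^ n)" for s n
  have near: "\<bar>f (of_int i * (\<beta> / 2 ^ n)) - f (of_int j * (\<beta> / 2 ^ n))\<bar> \<le> b * l ^ n" if "\<bar>i - j\<bar> \<le> 1" for i j n
  proof -
    have "i = j \<or> i = j + 1 \<or> j = i + 1" using that by linarith
    then consider "i = j" | "i = j + 1" | "j = i + 1" by blast
    then show ?thesis
    proof cases
      case 1
      then show ?thesis using \<open>0 \<le> b\<close> l01 by simp
    next
      case 2
      then show ?thesis using incr[of j n] by simp
    next
      case 3
      then show ?thesis using incr[of i n] by (simp add: abs_minus_commute)
    qed
  qed
  have pdist: "\<bar>p s n - s\<bar> \<le> \<beta> / 2 ^ n" for s n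
  proof -
    have h: "\<beta> / 2 ^ n > 0" using \<open>\<beta> > 0\<close> by simp
    have "of_int (k s n) \<le> s / (\<beta> / 2 ^ n)" "s / (\<beta> / 2 ^ n) < of_int (k s n) + 1"
      by (auto simp: k_def)
    then have "p s n \<le> s" "s \<le> (of_int (k s n) + 1) * (\<beta> / 2 ^ n)"
      using h unfolding p_def by (simp_all only: pos_le_divide_eq pos_divide_less_eq less_imp_le)
    moreover have "(of_int (k s n) + 1) * (\<beta> / 2 ^ n) = p s n + \<beta> / 2 ^ n"
      by (simp add: p_def distrib_right add_divide_distrib)
    ultimately show ?thesis using h by (simp add: abs_le_iff)
  qed
  have plim: "(\<lambda>j. p s (n + j)) \<longlonglongrightarrow> s" for s n
  proof -
    have "(\<lambda>j. \<beta> * (1 / 2) ^ j) \<longlonglongrightarrow> \<beta> * 0"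
      by (intro tendsto_intros LIMSEQ_power_zero) auto
    then have "(\<lambda>j. \<beta> / 2 ^ j) \<longlonglongrightarrow> 0" by (simp add: power_one_over field_simps)
    then have "(\<lambda>j. p s j - s) \<longlonglongrightarrow> 0"
      by (rule Lim_null_comparison[rotated]) (use pdist in \<open>auto\<close>)
    then have "p s \<longlonglongrightarrow> s" by (simp add: LIM_zero_iff)
    then show ?thesis using LIMSEQ_ignore_initial_segment[of "p s" s n] by (simp add: add.commute)
  qed
  \<comment> \<open>Halving the mesh doubles the index up to an error of one, so consecutive
    approximations of s are neighbours on the finer grid.\<close>
  have step: "\<bar>f (p s (Suc n)) - f (p s n)\<bar> \<le> b * l ^ Suc n" for s n
  proof -
    have "s / (\<beta> / 2 ^ Suc n) = 2 * (s / (\<beta> / 2 ^ n))" by simp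
    then have "\<bar>k s (Suc n) - 2 * k s n\<bar> \<le> 1" unfolding k_def by linarith
    moreover have "p s n = of_int (2 * k s n) * (\<beta> / 2 ^ Suc n)" by (simp add: p_def)
    ultimately show ?thesis using near unfolding p_def by metis
  qed
  have "\<bar>f (p s (n + j)) - f (p s n)\<bar> \<le> b * l ^ n * ((l - l ^ Suc j) / (1 - l))" for s n j
  proof (induction j)
    case (Suc j)
    have "\<bar>f (p s (n + Suc j)) - f (p s n)\<bar> \<le> b * l ^ Suc (n + j) + b * l ^ n * ((l - l ^ Suc j) / (1 - l))"
      using step[of s "n + j"] Suc by simp
    also have "\<dots> = b * l ^ n * (l ^ Suc j + (l - l ^ Suc j) / (1 - l))"
      by (simp add: power_add algebra_simps)
    also have "l ^ Suc j + (l - l ^ Suc j) / (1 - l) = (l - l ^ Suc (Suc j)) / (1 - l)"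
      using l01 by (simp add: field_simps)
    finally show ?case .
  qed simp
  moreover have "b * l ^ n * ((l - l ^ Suc j) / (1 - l)) \<le> b * l ^ n * (l / (1 - l))" for n j
    using l01 \<open>0 \<le> b\<close> by (intro mult_left_mono divide_right_mono) auto
  ultimately have seg: "\<bar>f (p s (n + j)) - f (p s n)\<bar> \<le> b * l ^ n * (l / (1 - l))" for s n j
    using order_trans by blast
  have tail: "\<bar>f s - f (p s n)\<bar> \<le> b * l ^ n * (l / (1 - l))" for s n
  proof (rule LIMSEQ_le_const2)
    have "isCont f s" using f by (simp add: continuous_on_eq_continuous_at)
    then show "(\<lambda>j. \<bar>f (p s (n + j)) - f (p s n)\<bar>) \<longlonglongrightarrow> \<bar>f s - f (p s n)\<bar>"
      by (intro tendsto_intros isCont_tendsto_compose[OF _ plim])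
    show "\<exists>N. \<forall>j\<ge>N. \<bar>f (p s (n + j)) - f (p s n)\<bar> \<le> b * l ^ n * (l / (1 - l))"
      using seg by blast
  qed
  have pos: "\<bar>s - t\<bar> > 0" using False by simp
  obtain n where n: "\<beta> / 2 ^ Suc n < \<bar>s - t\<bar>" "\<bar>s - t\<bar> \<le> \<beta> / 2 ^ n"
  proof -
    have ex: "\<exists>n. \<beta> / 2 ^ n < \<bar>s - t\<bar>"
    proof -
      obtain n where "(1 / 2) ^ n < \<bar>s - t\<bar> / \<beta>"
        using real_arch_pow_inv[of "\<bar>s - t\<bar> / \<beta>" "1/2"] pos \<open>\<beta> > 0\<close> by auto
      then have "\<beta> / 2 ^ n < \<bar>s - t\<bar>" using \<open>\<beta> > 0\<close> by (simp add: power_one_over field_simps)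
      then show ?thesis by blast
    qed
    \<comment> \<open>The first level with mesh below |s - t|; it is not 0 because |s - t| \<le>
      \<beta>, and the level just before it is the one wanted.\<close>
    define N where "N = (LEAST n. \<beta> / 2 ^ n < \<bar>s - t\<bar>)"
    have N: "\<beta> / 2 ^ N < \<bar>s - t\<bar>" unfolding N_def using ex by (rule LeastI_ex)
    then have "N \<noteq> 0" using \<open>\<bar>s - t\<bar> \<le> \<beta>\<close> by (intro notI) simp
    then obtain M where M: "N = Suc M" using not0_implies_Suc by blast
    have "\<not> \<beta> / 2 ^ M < \<bar>s - t\<bar>" using not_less_Least[of M "\<lambda>n. \<beta> / 2 ^ n < \<bar>s - t\<bar>"] M N_def by auto
    then show ?thesis using that[of M] N M by auto
  qed
  have "\<bar>s / (\<beta> / 2 ^ n) - t / (\<beta> / 2 ^ n)\<bar> \<le> 1"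
  proof -
    have "\<bar>s / (\<beta> / 2 ^ n) - t / (\<beta> / 2 ^ n)\<bar> = \<bar>s - t\<bar> / (\<beta> / 2 ^ n)"
      by (simp only: diff_divide_distrib[symmetric] abs_divide) (use \<open>\<beta> > 0\<close> in simp)
    also have "\<dots> \<le> 1" using n(2) \<open>\<beta> > 0\<close> by (subst divide_le_eq_1_pos) auto
    finally show ?thesis .
  qed
  then have "\<bar>k s n - k t n\<bar> \<le> 1" unfolding k_def by linarith
  from near[OF this, of n] have "\<bar>f (p s n) - f (p t n)\<bar> \<le> b * l ^ n" by (simp add: p_def)
  then have "\<bar>f s - f t\<bar> \<le> b * l ^ n + 2 * (b * l ^ n * (l / (1 - l)))"
    using tail[of s n] tail[of t n] by linarith
  also have "\<dots> = b * (1 + 2 * (l / (1 - l))) * l ^ n" by (simp add: algebra_simps)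
  also have "\<dots> \<le> b * (1 + 2 * (l / (1 - l))) * ((2 / \<beta>) powr \<alpha> * \<bar>s - t\<bar> powr \<alpha>)"
  proof (rule mult_left_mono)
    have "l ^ n = (1 / 2 ^ n) powr \<alpha>"
      by (simp add: l powr_powr powr_minus powr_divide mult.commute inverse_eq_divide
          flip: powr_realpow power_one_over)
    also have "\<dots> \<le> (2 / \<beta> * \<bar>s - t\<bar>) powr \<alpha>"
      using n(1) \<open>\<beta> > 0\<close> \<open>\<alpha> > 0\<close> by (intro powr_mono2) (auto simp: field_simps)
    also have "\<dots> = (2 / \<beta>) powr \<alpha> * \<bar>s - t\<bar> powr \<alpha>"
      using \<open>\<beta> > 0\<close> powr_mult[of "2 / \<beta>" "\<bar>s - t\<bar>" \<alpha>] by simp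
    finally show "l ^ n \<le> (2 / \<beta>) powr \<alpha> * \<bar>s - t\<bar> powr \<alpha>" .
    show "0 \<le> b * (1 + 2 * (l / (1 - l)))" using l01 \<open>0 \<le> b\<close> by simp
  qed
  finally show ?thesis by (simp add: mult.assoc)
qed (use assms in simp)

text \<open>Reduces the Hoelder norm to countably many linear functionals, the value at 0 and the
  grid increments of one period, with a constant c that is the same for all loops. A union bound can
  then be applied to them.\<close>

lemma hoelder_norm_le_if_dyadic_increments:
  assumes "\<beta> > 0" "0 < \<alpha>" "\<alpha> < 1/2"
  obtains c where "c > 0"
    "\<And>(\<upsilon> :: real \<Rightarrow>\<^sub>C real) b. \<upsilon> \<in> loops \<beta> \<Longrightarrow> 0 \<le> b \<Longrightarrow> \<bar>\<upsilon> 0\<bar> \<le> b \<Longrightarrow>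
      (\<And>n i. i < 2 ^ n \<Longrightarrow> \<bar>\<upsilon> (real (Suc i) * (\<beta> / 2 ^ n)) - \<upsilon> (real i * (\<beta> / 2 ^ n))\<bar> \<le> b * (2 powr (- \<alpha>)) ^ n) \<Longrightarrow>
      hoelder_norm \<beta> \<alpha> \<upsilon> \<le> ennreal (c * b)"
proof -
  define l where "l = 2 powr (- \<alpha>)"
  have l01: "0 < l" "l < 1" using \<open>0 < \<alpha>\<close> powr_less_mono[of "- \<alpha>" 0 "2::real"] by (auto simp: l_def)
  define C where "C = (1 + 2 * (l / (1 - l))) * (2 / \<beta>) powr \<alpha>"
  have "C > 0" using l01 \<open>\<beta> > 0\<close> by (auto simp: C_def intro!: mult_pos_pos add_pos_nonneg)
  have main: "hoelder_norm \<beta> \<alpha> \<upsilon> \<le> ennreal ((1 + C * \<beta> powr \<alpha> + C) * b)"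
    if \<upsilon>: "\<upsilon> \<in> loops \<beta>" and "0 \<le> b" and \<upsilon>0: "\<bar>\<upsilon> 0\<bar> \<le> b"
      and incr: "\<And>n i. i < 2 ^ n \<Longrightarrow> \<bar>\<upsilon> (real (Suc i) * (\<beta> / 2 ^ n)) - \<upsilon> (real i * (\<beta> / 2 ^ n))\<bar> \<le> b * l ^ n"
    for \<upsilon> :: "real \<Rightarrow>\<^sub>C real" and b
  proof -
    have per: "circle_periodic \<beta> \<upsilon>" using \<upsilon> by (simp add: loops_def)
    \<comment> \<open>Periodicity reduces the grid index modulo 2^n.\<close>
    have incr': "\<bar>\<upsilon> (of_int (i + 1) * (\<beta> / 2 ^ n)) - \<upsilon> (of_int i * (\<beta> / 2 ^ n))\<bar> \<le> b * l ^ n" for n and i :: int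
    proof -
      define j where "j = nat (i mod 2 ^ n)"
      have j: "j < 2 ^ n" by (simp add: j_def nat_less_iff)
      have "of_int i = real j + of_int (i div 2 ^ n) * 2 ^ n"
      proof -
        have "i = int j + (i div 2 ^ n) * 2 ^ n"
          using mod_div_mult_eq[of i "2 ^ n"] by (simp add: j_def)
        then have "(of_int i :: real) = of_int (int j + (i div 2 ^ n) * 2 ^ n)" by presburger
        then show ?thesis by simp
      qed
      then have "of_int i * (\<beta> / 2 ^ n) = real j * (\<beta> / 2 ^ n) + of_int (i div 2 ^ n) * \<beta>"
        "of_int (i + 1) * (\<beta> / 2 ^ n) = real (Suc j) * (\<beta> / 2 ^ n) + of_int (i div 2 ^ n) * \<beta>"
        by (simp_all add: field_simps)
      then show ?thesis using incr[OF j] by (simp only: periodic_fold[OF per])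
    qed
    have hol: "\<bar>\<upsilon> s - \<upsilon> t\<bar> \<le> C * b * \<bar>s - t\<bar> powr \<alpha>" if "\<bar>s - t\<bar> \<le> \<beta>" for s t
      using dyadic_chaining[OF continuous_on_apply_bcontfun \<open>\<beta> > 0\<close> \<open>0 < \<alpha>\<close> \<open>0 \<le> b\<close> l_def incr' that]
      by (simp add: C_def mult_ac)
    have "norm \<upsilon> \<le> b + C * b * \<beta> powr \<alpha>"
    proof (rule norm_bound)
      fix x
      define y where "y = x + of_int (- \<lfloor>x / \<beta>\<rfloor>) * \<beta>"
      have "of_int \<lfloor>x / \<beta>\<rfloor> * \<beta> \<le> x" "x < (of_int \<lfloor>x / \<beta>\<rfloor> + 1) * \<beta>"
        using \<open>\<beta> > 0\<close> by (simp_all flip: pos_le_divide_eq pos_divide_less_eq)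
      then have y: "0 \<le> y" "y \<le> \<beta>" by (auto simp: y_def distrib_right)
      have "\<upsilon> x = \<upsilon> y" unfolding y_def by (rule periodic_fold[OF per, symmetric])
      moreover have "\<bar>\<upsilon> y - \<upsilon> 0\<bar> \<le> C * b * \<bar>y - 0\<bar> powr \<alpha>" using y by (intro hol) auto
      moreover have "C * b * \<bar>y - 0\<bar> powr \<alpha> \<le> C * b * \<beta> powr \<alpha>"
        using y \<open>C > 0\<close> \<open>0 \<le> b\<close> \<open>0 < \<alpha>\<close> by (intro mult_left_mono powr_mono2) auto
      ultimately show "norm (\<upsilon> x) \<le> b + C * b * \<beta> powr \<alpha>" using \<upsilon>0 by simp
    qed
    moreover have "\<bar>\<upsilon> s - \<upsilon> t\<bar> / circle_dist \<beta> s t powr \<alpha> \<le> C * b"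
      if st: "s \<in> {0..<\<beta>}" "t \<in> {0..<\<beta>}" "s \<noteq> t" for s t
    proof -
      have pos: "circle_dist \<beta> s t > 0" using st by (auto simp: circle_dist_def)
      have "\<bar>\<upsilon> s - \<upsilon> t\<bar> \<le> C * b * circle_dist \<beta> s t powr \<alpha>"
      proof (cases "\<bar>s - t\<bar> \<le> \<beta> - \<bar>s - t\<bar>")
        case True
        then show ?thesis using hol[of s t] st by (simp add: circle_dist_def min_def)
      next
        case False
        \<comment> \<open>The shorter arc passes through 0: shifting the smaller of the two points
          by a period makes their distance on the line equal to the circle distance.\<close>
        have "\<upsilon> (s + \<beta>) = \<upsilon> s" "\<upsilon> (t + \<beta>) = \<upsilon> t" using per by (auto simp: circle_periodic_def)
        then show ?thesis
          using hol[of s "t + \<beta>"] hol[of "s + \<beta>" t] st False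
          by (cases "s \<le> t") (auto simp: circle_dist_def min_def abs_if algebra_simps split: if_splits)
      qed
      then show ?thesis using pos by (simp add: divide_le_eq)
    qed
    ultimately have "hoelder_norm \<beta> \<alpha> \<upsilon> \<le> ennreal (b + C * b * \<beta> powr \<alpha>) + ennreal (C * b)"
      unfolding hoelder_norm_def using \<open>0 < \<alpha>\<close>
      by (auto intro!: add_mono SUP_least ennreal_leI)
    also have "\<dots> = ennreal ((1 + C * \<beta> powr \<alpha> + C) * b)"
      using \<open>0 \<le> b\<close> \<open>C > 0\<close> by (subst ennreal_plus[symmetric]) (auto simp: algebra_simps)
    finally show ?thesis .
  qed
  show ?thesis
  proof (rule that)
    show "1 + C * \<beta> powr \<alpha> + C > 0" using \<open>C > 0\<close> by (intro add_pos_pos add_pos_nonneg) auto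
  qed (use main in \<open>simp add: l_def\<close>)
qed

section \<open>Increments and Hoelder tails of the Gaussian loop measure\<close>

lemma loop_gaussianD:
  assumes "loop_gaussian \<beta> m a2 \<gamma>"
  shows "prob_space \<gamma>" "space \<gamma> = loops \<beta>" "sets \<gamma> = sets (restrict_space borel (loops \<beta>))"
    "bounded_linear L \<Longrightarrow> centered_normal (distr \<gamma> borel L)"
  using assms unfolding loop_gaussian_def centered_gaussian_def by auto

lemma loop_gaussian_measurable:
  assumes "loop_gaussian \<beta> m a2 \<gamma>" "f \<in> borel \<rightarrow>\<^sub>M N"
  shows "f \<in> \<gamma> \<rightarrow>\<^sub>M N"
  using measurable_restrict_space1[OF assms(2)] loop_gaussianD(3)[OF assms(1)]
  by (simp cong: measurable_cong_sets)

lemma loop_gaussian_increment_variance: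
  assumes \<gamma>: "loop_gaussian \<beta> m (a\<^sup>2) \<gamma>" and "\<beta> > 0" "m > 0" "a\<^sup>2 > 0" "\<bar>t - s\<bar> \<le> \<beta>"
  shows "(\<integral>\<^sup>+\<upsilon>. ennreal ((\<upsilon> t - \<upsilon> s)\<^sup>2) \<partial>\<gamma>) \<le> ennreal (\<bar>t - s\<bar> / m)"
proof -
  define \<phi> where "\<phi> n = increment_mollifier \<beta> t s n" for n
  have c\<phi>: "continuous_on UNIV (\<phi> n)" "circle_periodic \<beta> (\<phi> n)" for n
    unfolding \<phi>_def by (intro continuous_increment_mollifier periodic_increment_mollifier \<open>\<beta> > 0\<close>)+
  \<comment> \<open>A continuous periodic function is bounded, so it is itself an element of the
    ambient space and the bilinear pairing applies.\<close>
  have bl: "bounded_linear (\<lambda>\<upsilon>. L2_inner \<beta> (\<phi> n) (apply_bcontfun \<upsilon>))" for n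
  proof -
    have "bounded (\<phi> n ` {0..\<beta>})"
      by (intro compact_imp_bounded compact_continuous_image continuous_on_subset[OF c\<phi>(1)]) auto
    then obtain B where B: "\<And>x. x \<in> {0..\<beta>} \<Longrightarrow> \<bar>\<phi> n x\<bar> \<le> B"
      unfolding bounded_iff by (metis image_eqI real_norm_def)
    have "\<bar>\<phi> n x\<bar> \<le> B" for x
    proof -
      define y where "y = x + of_int (- \<lfloor>x / \<beta>\<rfloor>) * \<beta>"
      have "of_int \<lfloor>x / \<beta>\<rfloor> * \<beta> \<le> x" "x < (of_int \<lfloor>x / \<beta>\<rfloor> + 1) * \<beta>"
        using \<open>\<beta> > 0\<close> by (simp_all flip: pos_le_divide_eq pos_divide_less_eq)
      then have "y \<in> {0..\<beta>}" by (auto simp: y_def distrib_right)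
      moreover have "\<phi> n y = \<phi> n x" unfolding y_def by (rule periodic_fold[OF c\<phi>(2)])
      ultimately show ?thesis using B by metis
    qed
    then have "\<phi> n \<in> bcontfun" by (intro bcontfun_normI[OF c\<phi>(1)]) simp
    then obtain g where "\<phi> n = apply_bcontfun g" by (rule bcontfunE)
    then show ?thesis
      using bounded_bilinear.bounded_linear_right[OF bounded_bilinear_L2_inner[OF \<open>\<beta> > 0\<close>]] by simp
  qed
  have meas [measurable]: "(\<lambda>\<upsilon>. L2_inner \<beta> (\<phi> n) (apply_bcontfun \<upsilon>)) \<in> borel_measurable \<gamma>" for n
    by (intro loop_gaussian_measurable[OF \<gamma>] borel_measurable_continuous_onI linear_continuous_on bl)
  have var: "(\<integral>\<^sup>+\<upsilon>. ennreal ((L2_inner \<beta> (\<phi> n) \<upsilon>)\<^sup>2) \<partial>\<gamma>) \<le> ennreal (\<bar>t - s\<bar> / m)" for n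
  proof -
    have "L2_inner \<beta> u (\<phi> n) \<le> B"
      if "continuous_on UNIV u" "circle_periodic \<beta> u" "\<And>x y. \<bar>x - y\<bar> = \<bar>t - s\<bar> \<Longrightarrow> \<bar>u x - u y\<bar> \<le> B" for u B
      unfolding \<phi>_def using that by (intro L2_inner_increment_mollifier_le \<open>\<beta> > 0\<close>)
    then obtain u where u: "A_graph \<beta> m (a\<^sup>2) u (\<phi> n)" "L2_inner \<beta> u (\<phi> n) \<le> \<bar>t - s\<bar> / m"
      using A_graph_ex[OF c\<phi>[of n] assms(2-5)] by metis
    \<comment> \<open>Integrability comes first, so that the prescribed covariance, taken with both
      arguments equal to \<open>\<phi> n\<close>, is the actual variance.\<close>
    have "integrable (distr \<gamma> borel (\<lambda>\<upsilon>. L2_inner \<beta> (\<phi> n) (apply_bcontfun \<upsilon>))) (\<lambda>x. x\<^sup>2)"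
      by (intro centered_normal_square_integrable loop_gaussianD(4)[OF \<gamma>] bl)
    then have "integrable \<gamma> (\<lambda>\<upsilon>. (L2_inner \<beta> (\<phi> n) \<upsilon>)\<^sup>2)"
      by (subst (asm) integrable_distr_eq) auto
    then have "(\<integral>\<^sup>+\<upsilon>. ennreal ((L2_inner \<beta> (\<phi> n) \<upsilon>)\<^sup>2) \<partial>\<gamma>) = ennreal (LINT \<upsilon>|\<gamma>. (L2_inner \<beta> (\<phi> n) \<upsilon>)\<^sup>2)"
      by (rule nn_integral_eq_integral) simp
    also have "(LINT \<upsilon>|\<gamma>. (L2_inner \<beta> (\<phi> n) \<upsilon>)\<^sup>2) = L2_inner \<beta> u (\<phi> n)"
      using \<gamma> u(1) continuous_periodic_imp_L2[OF c\<phi>[of n]]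
      unfolding loop_gaussian_def power2_eq_square by blast
    also have "ennreal \<dots> \<le> ennreal (\<bar>t - s\<bar> / m)" using u(2) by (rule ennreal_leI)
    finally show ?thesis .
  qed
  \<comment> \<open>The squared pairings converge pointwise on loops, so the integrand is a limit
    inferior and Fatou's lemma keeps the uniform bound.\<close>
  have "(\<integral>\<^sup>+\<upsilon>. ennreal ((\<upsilon> t - \<upsilon> s)\<^sup>2) \<partial>\<gamma>) = (\<integral>\<^sup>+\<upsilon>. liminf (\<lambda>n. ennreal ((L2_inner \<beta> (\<phi> n) \<upsilon>)\<^sup>2)) \<partial>\<gamma>)"
  proof (rule nn_integral_cong)
    fix \<upsilon> assume "\<upsilon> \<in> space \<gamma>"
    then have per: "circle_periodic \<beta> \<upsilon>" by (simp add: loop_gaussianD(2)[OF \<gamma>] loops_def)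
    have "L2_inner \<beta> (\<phi> n) \<upsilon> = L2_inner \<beta> \<upsilon> (\<phi> n)" for n
      by (simp add: L2_inner_def mult.commute)
    then have "(\<lambda>n. L2_inner \<beta> (\<phi> n) \<upsilon>) \<longlonglongrightarrow> \<upsilon> t - \<upsilon> s"
      using L2_inner_increment_mollifier_limit[OF _ per \<open>\<beta> > 0\<close>] by (simp add: \<phi>_def)
    then have "(\<lambda>n. ennreal ((L2_inner \<beta> (\<phi> n) \<upsilon>)\<^sup>2)) \<longlonglongrightarrow> ennreal ((\<upsilon> t - \<upsilon> s)\<^sup>2)"
      by (intro tendsto_ennrealI tendsto_intros)
    then show "ennreal ((\<upsilon> t - \<upsilon> s)\<^sup>2) = liminf (\<lambda>n. ennreal ((L2_inner \<beta> (\<phi> n) \<upsilon>)\<^sup>2))"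
      by (rule lim_imp_Liminf[OF sequentially_bot, symmetric])
  qed
  also have "\<dots> \<le> liminf (\<lambda>n. \<integral>\<^sup>+\<upsilon>. ennreal ((L2_inner \<beta> (\<phi> n) \<upsilon>)\<^sup>2) \<partial>\<gamma>)"
    by (rule nn_integral_liminf) measurable
  also have "\<dots> \<le> liminf (\<lambda>n. ennreal (\<bar>t - s\<bar> / m))"
    by (intro Liminf_mono always_eventually allI var)
  also have "\<dots> = ennreal (\<bar>t - s\<bar> / m)" by (simp add: Liminf_const)
  finally show ?thesis .
qed

lemma loop_gaussian_functional_tail:
  fixes L :: "(real \<Rightarrow>\<^sub>C real) \<Rightarrow> real"
  assumes \<gamma>: "loop_gaussian \<beta> m a2 \<gamma>" and L: "bounded_linear L"
    and var: "(\<integral>\<^sup>+\<upsilon>. ennreal ((L \<upsilon>)\<^sup>2) \<partial>\<gamma>) \<le> ennreal v" and "0 \<le> v" "x > 0"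
  shows "emeasure \<gamma> {\<upsilon> \<in> space \<gamma>. \<bar>L \<upsilon>\<bar> > x} \<le> ennreal (fact (2 * q) / (2 ^ q * fact q) * v ^ q / x ^ (2 * q))"
proof -
  have [measurable]: "L \<in> borel_measurable \<gamma>"
    by (intro loop_gaussian_measurable[OF \<gamma>] borel_measurable_continuous_onI linear_continuous_on L)
  have "emeasure \<gamma> {\<upsilon> \<in> space \<gamma>. \<bar>L \<upsilon>\<bar> > x} = emeasure (distr \<gamma> borel L) {y. \<bar>y\<bar> > x}"
    by (subst emeasure_distr) (auto intro!: arg_cong[where f = "emeasure \<gamma>"])
  also have "\<dots> \<le> ennreal (fact (2 * q) / (2 ^ q * fact q) * v ^ q / x ^ (2 * q))"
    using var by (intro centered_normal_tail loop_gaussianD(4)[OF \<gamma>] L assms) (simp add: nn_integral_distr)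
  finally show ?thesis .
qed

text \<open>At level n there are 2^n increments of variance at most \<beta> / (m 2^n), compared with
  thresholds b 2^(- \<alpha> n). The moment of order 2 q bounds their joint contribution by a
  constant times 2^(n (1 - q (1 - 2 \<alpha>))), which is summable exactly by the condition on q.
  The threshold enters as b^(- 2 q), hence the rate 4^(- q N) for b proportional to 2^N.\<close>

lemma loop_gaussian_hoelder_tail:
  assumes \<gamma>: "loop_gaussian \<beta> m (a\<^sup>2) \<gamma>" and "\<beta> > 0" "m > 0" "a\<^sup>2 > 0" "0 < \<alpha>" "\<alpha> < 1/2"
    and q: "real q * (1 - 2 * \<alpha>) > 1"
  shows "\<exists>C\<ge>0. \<forall>N. emeasure \<gamma> {\<upsilon> \<in> space \<gamma>. hoelder_norm \<beta> \<alpha> \<upsilon> > 2 ^ N} \<le> ennreal (C / 4 ^ (q * N))"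
proof -
  obtain c where "c > 0" and c: "\<And>(\<upsilon> :: real \<Rightarrow>\<^sub>C real) b. \<upsilon> \<in> loops \<beta> \<Longrightarrow> 0 \<le> b \<Longrightarrow> \<bar>\<upsilon> 0\<bar> \<le> b \<Longrightarrow>
      (\<And>n i. i < 2 ^ n \<Longrightarrow> \<bar>\<upsilon> (real (Suc i) * (\<beta> / 2 ^ n)) - \<upsilon> (real i * (\<beta> / 2 ^ n))\<bar> \<le> b * (2 powr (- \<alpha>)) ^ n) \<Longrightarrow>
      hoelder_norm \<beta> \<alpha> \<upsilon> \<le> ennreal (c * b)"
    using hoelder_norm_le_if_dyadic_increments[OF \<open>\<beta> > 0\<close> \<open>0 < \<alpha>\<close> \<open>\<alpha> < 1/2\<close>] by metis
  define l where "l = 2 powr (- \<alpha>)"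
  have "l > 0" by (simp add: l_def)
  define G where "G = (fact (2 * q) / (2 ^ q * fact q) :: real)"
  have "G > 0" by (simp add: G_def)
  \<comment> \<open>The ratio of the level sums; the leading 2 is the growth of the number of
    increments.\<close>
  define r where "r = 2 * ((1 / 2) ^ q / l ^ (2 * q))"
  have r: "0 < r" "r < 1"
  proof -
    show "0 < r" using \<open>l > 0\<close> by (simp add: r_def)
    have "l ^ (2 * q) = 2 powr (- (2 * \<alpha> * q))"
      unfolding l_def by (subst powr_realpow[symmetric]) (auto simp: powr_powr mult_ac)
    moreover have "(1 / 2) ^ q = 2 powr (- real q)"
      by (simp add: powr_minus powr_realpow power_one_over inverse_eq_divide)
    ultimately have "r = 2 powr 1 * 2 powr (- real q) / 2 powr (- (2 * \<alpha> * q))"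
      by (simp add: r_def)
    also have "\<dots> = 2 powr (1 + (- real q) - (- (2 * \<alpha> * q)))"
      by (simp only: powr_diff powr_add)
    also have "\<dots> < 2 powr 0"
      using q by (intro powr_less_mono) (auto simp: algebra_simps)
    finally show "r < 1" by simp
  qed
  define v0 where "v0 = (LINT \<upsilon>|\<gamma>. (\<upsilon> 0)\<^sup>2)"
  have "0 \<le> v0" by (simp add: v0_def)
  have ev [measurable]: "(\<lambda>\<upsilon>. apply_bcontfun \<upsilon> t) \<in> borel_measurable \<gamma>" for t
    by (intro loop_gaussian_measurable[OF \<gamma>] borel_measurable_continuous_onI continuous_on_eval)
  have v0: "(\<integral>\<^sup>+\<upsilon>. ennreal ((\<upsilon> 0)\<^sup>2) \<partial>\<gamma>) = ennreal v0"
  proof -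
    have "integrable (distr \<gamma> borel (\<lambda>\<upsilon>. \<upsilon> 0)) (\<lambda>x. x\<^sup>2)"
      by (intro centered_normal_square_integrable loop_gaussianD(4)[OF \<gamma>] bounded_linear_eval)
    then have "integrable \<gamma> (\<lambda>\<upsilon>. (\<upsilon> 0)\<^sup>2)"
      by (subst (asm) integrable_distr_eq) auto
    then show ?thesis unfolding v0_def by (rule nn_integral_eq_integral) simp
  qed
  define K where "K b = G * (\<beta> / m) ^ q / b ^ (2 * q)" for b
  have tail: "emeasure \<gamma> {\<upsilon> \<in> space \<gamma>. hoelder_norm \<beta> \<alpha> \<upsilon> > ennreal (c * b)}
      \<le> ennreal (G * v0 ^ q / b ^ (2 * q) + K b / (1 - r))" if "b > 0" for b
  proof -
    define E0 where "E0 = {\<upsilon> \<in> space \<gamma>. \<bar>\<upsilon> 0\<bar> > b}"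
    define E where "E n i = {\<upsilon> \<in> space \<gamma>. \<bar>\<upsilon> (real (Suc i) * (\<beta> / 2 ^ n)) - \<upsilon> (real i * (\<beta> / 2 ^ n))\<bar> > b * l ^ n}" for n i
    have [measurable]: "E0 \<in> sets \<gamma>" "E n i \<in> sets \<gamma>" for n i
      unfolding E0_def E_def by measurable
    have "K b \<ge> 0" using \<open>G > 0\<close> \<open>\<beta> > 0\<close> \<open>m > 0\<close> by (simp add: K_def)
    have E0: "emeasure \<gamma> E0 \<le> ennreal (G * v0 ^ q / b ^ (2 * q))"
      unfolding E0_def G_def using v0 \<open>0 \<le> v0\<close> \<open>b > 0\<close>
      by (intro loop_gaussian_functional_tail[OF \<gamma> bounded_linear_eval]) auto
    have E: "emeasure \<gamma> (E n i) \<le> ennreal (K b * (r / 2) ^ n)" for n i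
    proof -
      let ?t = "real (Suc i) * (\<beta> / 2 ^ n)" and ?s = "real i * (\<beta> / 2 ^ n)"
      have d: "\<bar>?t - ?s\<bar> = \<beta> / 2 ^ n" using \<open>\<beta> > 0\<close> by (simp add: field_simps)
      have "\<beta> / 2 ^ n \<le> \<beta>" using \<open>\<beta> > 0\<close> by (simp add: divide_le_eq)
      then have var: "(\<integral>\<^sup>+\<upsilon>. ennreal ((\<upsilon> ?t - \<upsilon> ?s)\<^sup>2) \<partial>\<gamma>) \<le> ennreal (\<beta> / 2 ^ n / m)"
        using loop_gaussian_increment_variance[OF \<gamma> assms(2-4), of ?t ?s] unfolding d by simp
      have "emeasure \<gamma> (E n i) \<le> ennreal (G * (\<beta> / 2 ^ n / m) ^ q / (b * l ^ n) ^ (2 * q))"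
        unfolding E_def G_def using \<open>\<beta> > 0\<close> \<open>m > 0\<close> \<open>b > 0\<close> \<open>l > 0\<close>
        by (intro loop_gaussian_functional_tail[OF \<gamma> bounded_linear_sub[OF bounded_linear_eval bounded_linear_eval] var]) auto
      also have "G * (\<beta> / 2 ^ n / m) ^ q / (b * l ^ n) ^ (2 * q) = K b * (r / 2) ^ n"
      proof -
        have e0: "\<beta> / 2 ^ n / m = \<beta> / m * (1 / 2) ^ n" by (simp add: power_one_over)
        have e1: "(\<beta> / 2 ^ n / m) ^ q = (\<beta> / m) ^ q * ((1 / 2) ^ q) ^ n"
          unfolding e0 power_mult_distrib power_mult[symmetric] mult.commute[of n q] ..
        have e2: "(b * l ^ n) ^ (2 * q) = b ^ (2 * q) * (l ^ (2 * q)) ^ n"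
          by (simp add: power_mult_distrib power_mult[symmetric] mult.assoc mult.left_commute mult.commute[of n])
        have e3: "(r / 2) ^ n = ((1 / 2) ^ q) ^ n / (l ^ (2 * q)) ^ n"
          unfolding power_divide[symmetric] r_def by simp
        show ?thesis
          using times_divide_times_eq[of "G * (\<beta> / m) ^ q" "b ^ (2 * q)" "((1 / 2) ^ q) ^ n" "(l ^ (2 * q)) ^ n"]
          by (subst e1, subst e2, subst e3) (simp only: K_def mult.assoc)
      qed
      finally show ?thesis .
    qed
    have U: "emeasure \<gamma> (\<Union>i<2 ^ n. E n i) \<le> ennreal (K b * r ^ n)" for n
    proof -
      have "emeasure \<gamma> (\<Union>i<2 ^ n. E n i) \<le> (\<Sum>i<2 ^ n. emeasure \<gamma> (E n i))"
        by (rule emeasure_subadditive_finite) auto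
      also have "\<dots> \<le> (\<Sum>i<(2::nat) ^ n. ennreal (K b * (r / 2) ^ n))" by (intro sum_mono E)
      also have "\<dots> = ennreal (2 ^ n * (K b * (r / 2) ^ n))"
        using \<open>K b \<ge> 0\<close> r(1) by (simp add: ennreal_mult ennreal_of_nat_eq_real_of_nat flip: ennreal_power)
      also have "2 ^ n * (K b * (r / 2) ^ n) = K b * r ^ n"
        by (simp add: power_divide)
      finally show ?thesis .
    qed
    \<comment> \<open>Contrapositive of the deterministic chaining bound: a large norm needs a large
      value at 0 or a large increment at some level.\<close>
    have "{\<upsilon> \<in> space \<gamma>. hoelder_norm \<beta> \<alpha> \<upsilon> > ennreal (c * b)} \<subseteq> E0 \<union> (\<Union>n. \<Union>i<2 ^ n. E n i)"
    proof
      fix \<upsilon> assume \<upsilon>: "\<upsilon> \<in> {\<upsilon> \<in> space \<gamma>. hoelder_norm \<beta> \<alpha> \<upsilon> > ennreal (c * b)}"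
      show "\<upsilon> \<in> E0 \<union> (\<Union>n. \<Union>i<2 ^ n. E n i)"
      proof (rule ccontr)
        assume "\<upsilon> \<notin> E0 \<union> (\<Union>n. \<Union>i<2 ^ n. E n i)"
        then have "hoelder_norm \<beta> \<alpha> \<upsilon> \<le> ennreal (c * b)"
          using \<upsilon> \<open>b > 0\<close> by (intro c) (auto simp: E0_def E_def not_less l_def loop_gaussianD(2)[OF \<gamma>])
        with \<upsilon> show False by auto
      qed
    qed
    then have "emeasure \<gamma> {\<upsilon> \<in> space \<gamma>. hoelder_norm \<beta> \<alpha> \<upsilon> > ennreal (c * b)}
        \<le> emeasure \<gamma> (E0 \<union> (\<Union>n. \<Union>i<2 ^ n. E n i))"
      by (rule emeasure_mono) auto
    also have "\<dots> \<le> emeasure \<gamma> E0 + emeasure \<gamma> (\<Union>n. \<Union>i<2 ^ n. E n i)"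
      by (rule emeasure_subadditive) auto
    also have "emeasure \<gamma> (\<Union>n. \<Union>i<2 ^ n. E n i) \<le> (\<Sum>n. emeasure \<gamma> (\<Union>i<2 ^ n. E n i))"
      by (rule emeasure_subadditive_countably) auto
    also have "\<dots> \<le> (\<Sum>n. ennreal (K b * r ^ n))"
      by (intro suminf_le U) auto
    also have "\<dots> = ennreal (K b / (1 - r))"
      using \<open>K b \<ge> 0\<close> r sums_mult[OF geometric_sums[of r], of "K b"]
      by (intro suminf_ennreal_eq) auto
    finally show ?thesis
      using E0 \<open>K b \<ge> 0\<close> r(2) \<open>G > 0\<close> \<open>0 \<le> v0\<close> \<open>b > 0\<close>
      by (subst ennreal_plus) (auto intro: order_trans add_right_mono)
  qed
  define C where "C = (G * v0 ^ q + G * (\<beta> / m) ^ q / (1 - r)) * c ^ (2 * q)"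
  have "C \<ge> 0"
    using \<open>G > 0\<close> \<open>0 \<le> v0\<close> \<open>\<beta> > 0\<close> \<open>m > 0\<close> \<open>c > 0\<close> r by (simp add: C_def)
  moreover have "emeasure \<gamma> {\<upsilon> \<in> space \<gamma>. hoelder_norm \<beta> \<alpha> \<upsilon> > 2 ^ N} \<le> ennreal (C / 4 ^ (q * N))" for N
  proof -
    \<comment> \<open>Undoes the constant c, so that the threshold for the norm is exactly
      2^N.\<close>
    define b where "b = 2 ^ N / c"
    have "b > 0" using \<open>c > 0\<close> by (simp add: b_def)
    have "ennreal (c * b) = 2 ^ N"
      using \<open>c > 0\<close> by (simp add: b_def flip: ennreal_power)
    moreover have "G * v0 ^ q / b ^ (2 * q) + K b / (1 - r) = C / 4 ^ (q * N)"
    proof -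
      have "b ^ (2 * q) = 4 ^ (q * N) / c ^ (2 * q)"
      proof -
        have "(2::real) ^ (N * (2 * q)) = (2 ^ 2) ^ (q * N)"
          unfolding power_mult[symmetric] by (simp add: mult_ac)
        then show ?thesis by (simp add: b_def power_divide power_mult[symmetric])
      qed
      then have "y / b ^ (2 * q) = y * c ^ (2 * q) / 4 ^ (q * N)" for y by simp
      then show ?thesis
        unfolding K_def C_def by (simp only:) (simp add: distrib_right add_divide_distrib)
    qed
    ultimately show ?thesis using tail[OF \<open>b > 0\<close>] by simp
  qed
  ultimately show ?thesis by blast
qed

section \<open>Single-site conditional measures\<close>

lemma adjacent_irrefl [simp]: "\<not> adjacent k k"
  by (simp add: adjacent_def lnorm_def zero_vec_def[symmetric])

lemma finite_unit_lattice: "finite {j :: int ^ 'd::finite. lnorm j = 1}"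
proof (rule finite_imageD)
  show "inj_on vec_nth {j :: int ^ 'd. lnorm j = 1}"
    by (auto simp: inj_on_def vec_nth_inject)
  have "j $ i \<in> {-1..1}" if "lnorm j = 1" for j :: "int ^ 'd" and i
    using component_le_norm_cart[of "\<chi> i. real_of_int (j $ i)" i] that by (auto simp: lnorm_def)
  then have "vec_nth ` {j :: int ^ 'd. lnorm j = 1} \<subseteq> (UNIV \<rightarrow>\<^sub>E {-1..1})"
    by auto
  then show "finite (vec_nth ` {j :: int ^ 'd. lnorm j = 1})"
    by (rule finite_subset) (auto intro: finite_PiE)
qed

lemma adjacent_eq_image: "{k'. adjacent k k'} = (\<lambda>j. k - j) ` {j. lnorm j = 1}"
  by (auto simp: adjacent_def image_def intro!: exI[of _ "k - _"])

lemma finite_adjacent: "finite {k' :: int ^ 'd::finite. adjacent k k'}"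
  unfolding adjacent_eq_image by (intro finite_imageI finite_unit_lattice)

lemma card_adjacent_le: "card {k' :: int ^ 'd::finite. adjacent k k'} \<le> card {j :: int ^ 'd. lnorm j = 1}"
  unfolding adjacent_eq_image by (intro card_image_le finite_unit_lattice)

section \<open>Single-site energy and partition function\<close>

lemma self_interaction_continuous:
  assumes "self_interaction V"
  shows "continuous_on UNIV V"
  using assms unfolding self_interaction_def
  by (simp add: continuous_on_eq_continuous_at differentiable_imp_continuous_within)

text \<open>Beyond the radius R with R^(P - 2) = K N the power |q|^P / K dominates N q^2; inside,
  the constant N R^2 makes up for it.\<close>

lemma self_interaction_superquadratic:
  assumes "self_interaction V"
  shows "\<exists>C\<ge>0. \<forall>q. V q \<ge> M * q\<^sup>2 - C"
proof -
  obtain P K C where P: "P > 2" "K > 0" "C > 0"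
    and bnd: "\<forall>q. \<forall>l\<in>{0, 1, 2 :: nat}. inverse K * \<bar>q\<bar> powr (P - real l) - C \<le> sgn q ^ l * (deriv ^^ l) V q"
    using assms unfolding self_interaction_def by blast
  have lower: "inverse K * \<bar>q\<bar> powr P - C \<le> V q" for q
    using bnd[rule_format, of 0 q] by simp
  \<comment> \<open>A positive substitute for M, so that R is defined and positive whatever the sign
    of M.\<close>
  define N where "N = max M 1"
  have "N > 0" "M \<le> N" by (auto simp: N_def)
  define R where "R = (K * N) powr (1 / (P - 2))"
  have "R > 0" using \<open>K > 0\<close> \<open>N > 0\<close> by (simp add: R_def)
  have "V q \<ge> M * q\<^sup>2 - (N * R\<^sup>2 + C)" for q
  proof -
    have "inverse K * \<bar>q\<bar> powr P \<ge> N * q\<^sup>2 - N * R\<^sup>2"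
    proof (cases "\<bar>q\<bar> \<le> R")
      case True
      then have "q\<^sup>2 \<le> R\<^sup>2" by (simp add: abs_le_square_iff[symmetric] \<open>R > 0\<close> less_imp_le)
      then have "N * q\<^sup>2 \<le> N * R\<^sup>2" using \<open>N > 0\<close> by simp
      moreover have "0 \<le> inverse K * \<bar>q\<bar> powr P" using \<open>K > 0\<close> by simp
      ultimately show ?thesis by linarith
    next
      case False
      then have "R \<le> \<bar>q\<bar>" "\<bar>q\<bar> > 0" using \<open>R > 0\<close> by auto
      have "K * N = R powr (P - 2)" using P \<open>N > 0\<close> by (simp add: R_def powr_powr)
      also have "\<dots> \<le> \<bar>q\<bar> powr (P - 2)"
        using \<open>R \<le> \<bar>q\<bar>\<close> \<open>R > 0\<close> P by (intro powr_mono2) auto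
      finally have "K * N * \<bar>q\<bar> powr 2 \<le> \<bar>q\<bar> powr (P - 2) * \<bar>q\<bar> powr 2"
        by (intro mult_right_mono) auto
      moreover have "\<bar>q\<bar> powr 2 = q\<^sup>2" using \<open>\<bar>q\<bar> > 0\<close> by simp
      moreover have "\<bar>q\<bar> powr (P - 2) * \<bar>q\<bar> powr 2 = \<bar>q\<bar> powr P"
        by (simp only: powr_add[symmetric]) simp
      ultimately have "K * N * q\<^sup>2 \<le> \<bar>q\<bar> powr P" by simp
      then have "N * q\<^sup>2 \<le> inverse K * \<bar>q\<bar> powr P"
        using \<open>K > 0\<close> by (simp add: field_simps)
      then show ?thesis using \<open>N > 0\<close> by (smt (verit) mult_nonneg_nonneg zero_le_power2)
    qed
    moreover have "M * q\<^sup>2 \<le> N * q\<^sup>2" using \<open>M \<le> N\<close> by (intro mult_right_mono) auto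
    ultimately show ?thesis using lower[of q] by linarith
  qed
  moreover have "N * R\<^sup>2 + C \<ge> 0" using \<open>N > 0\<close> P by simp
  ultimately show ?thesis by blast
qed

lemma L2_inner_self_nonneg: "0 \<le> L2_inner \<beta> f f"
  by (simp add: L2_inner_def set_lebesgue_integral_def)

lemma L2_inner_diff_self:
  fixes \<upsilon> \<upsilon>' :: "real \<Rightarrow>\<^sub>C real"
  assumes "\<beta> > 0"
  shows "L2_inner \<beta> (\<upsilon> - \<upsilon>') (\<upsilon> - \<upsilon>') = L2_inner \<beta> \<upsilon> \<upsilon> - 2 * L2_inner \<beta> \<upsilon> \<upsilon>' + L2_inner \<beta> \<upsilon>' \<upsilon>'"
proof -
  note bb = bounded_bilinear_L2_inner[OF assms]
  have "L2_inner \<beta> \<upsilon>' \<upsilon> = L2_inner \<beta> \<upsilon> \<upsilon>'" by (simp add: L2_inner_def mult.commute)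
  then show ?thesis
    unfolding bounded_bilinear.diff_left[OF bb] bounded_bilinear.diff_right[OF bb] by simp
qed

lemma L2_inner_self_le:
  fixes \<upsilon> :: "real \<Rightarrow>\<^sub>C real"
  assumes "\<beta> > 0" "norm \<upsilon> \<le> r"
  shows "L2_inner \<beta> \<upsilon> \<upsilon> \<le> \<beta> * r\<^sup>2"
proof -
  have "L2_inner \<beta> \<upsilon> \<upsilon> \<le> (LINT t:{0..<\<beta>}|lborel. r\<^sup>2)"
    unfolding L2_inner_def
  proof (rule set_integral_mono)
    show "\<upsilon> t * \<upsilon> t \<le> r\<^sup>2" for t
      using norm_bounded[of \<upsilon> t] assms(2) abs_le_square_iff[of "\<upsilon> t" r] by (simp add: power2_eq_square)
  qed (intro set_integrable_continuous continuous_intros continuous_on_apply_bcontfun)+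
  then show ?thesis using assms(1) by (simp add: set_lebesgue_integral_def)
qed

lemma local_energy_single_site:
  fixes \<omega> \<xi> :: "int ^ 'd::finite \<Rightarrow> real \<Rightarrow>\<^sub>C real"
  assumes "\<beta> > 0" and V: "continuous_on UNIV V"
  shows "local_energy \<beta> V J {k} \<omega> \<xi> = (LINT \<tau>:{0..<\<beta>}|lborel. V (\<omega> k \<tau>)) +
    J * (\<Sum>k' | adjacent k k'. L2_inner \<beta> (\<omega> k - \<xi> k') (\<omega> k - \<xi> k'))"
proof -
  have e: "{(k1, k2). k1 \<in> {k} \<and> k2 \<in> {k} \<and> adjacent k1 k2} = {}" by auto
  have p: "{(k1, k2). k1 \<in> {k} \<and> k2 \<notin> {k} \<and> adjacent k1 k2} = Pair k ` {k'. adjacent k k'}" by auto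
  have VC: "continuous_on UNIV (\<lambda>\<tau>. V (\<omega> k \<tau>))"
    by (intro continuous_on_compose2[OF V] continuous_on_apply_bcontfun) auto
  have "local_energy \<beta> V J {k} \<omega> \<xi> = (LINT \<tau>:{0..<\<beta>}|lborel. V (\<omega> k \<tau>) +
      (\<Sum>k' | adjacent k k'. J * (\<omega> k \<tau> - \<xi> k' \<tau>)\<^sup>2))"
    unfolding local_energy_def e p
    by (subst sum.reindex) (auto simp: inj_on_def pair_potential_def)
  also have "\<dots> = (LINT \<tau>:{0..<\<beta>}|lborel. V (\<omega> k \<tau>)) +
      (LINT \<tau>:{0..<\<beta>}|lborel. \<Sum>k' | adjacent k k'. J * (\<omega> k \<tau> - \<xi> k' \<tau>)\<^sup>2)"
    by (intro set_integral_add set_integrable_continuous continuous_intros VC continuous_on_apply_bcontfun)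
  also have "(LINT \<tau>:{0..<\<beta>}|lborel. \<Sum>k' | adjacent k k'. J * (\<omega> k \<tau> - \<xi> k' \<tau>)\<^sup>2) =
      (\<Sum>k' | adjacent k k'. LINT \<tau>:{0..<\<beta>}|lborel. J * (\<omega> k \<tau> - \<xi> k' \<tau>)\<^sup>2)"
    unfolding set_lebesgue_integral_def scaleR_sum_right
    by (intro Bochner_Integration.integral_sum set_integrable_continuous[unfolded set_integrable_def]
      continuous_intros continuous_on_apply_bcontfun)
  also have "\<dots> = J * (\<Sum>k' | adjacent k k'. L2_inner \<beta> (\<omega> k - \<xi> k') (\<omega> k - \<xi> k'))"
    by (simp add: sum_distrib_left L2_inner_def power2_eq_square)
  finally show ?thesis .
qed

text \<open>The coupling to the neighbours is a nonnegative sum of squares and is dropped, which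
  makes the bound independent of \<xi>.\<close>

lemma local_energy_single_site_lower:
  fixes \<omega> \<xi> :: "int ^ 'd::finite \<Rightarrow> real \<Rightarrow>\<^sub>C real"
  assumes "\<beta> > 0" "J > 0" and V: "continuous_on UNIV V" and C: "\<And>q. V q \<ge> M * q\<^sup>2 - C"
  shows "local_energy \<beta> V J {k} \<omega> \<xi> \<ge> M * L2_inner \<beta> (\<omega> k) (\<omega> k) - \<beta> * C"
proof -
  have "M * L2_inner \<beta> (\<omega> k) (\<omega> k) - \<beta> * C = (LINT \<tau>:{0..<\<beta>}|lborel. M * (\<omega> k \<tau>)\<^sup>2 - C)"
    using \<open>\<beta> > 0\<close>
    by (subst set_integral_diff) (auto intro!: set_integrable_continuous continuous_intros
        simp: L2_inner_def power2_eq_square set_lebesgue_integral_def)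
  also have "\<dots> \<le> (LINT \<tau>:{0..<\<beta>}|lborel. V (\<omega> k \<tau>))"
    using C by (intro set_integral_mono set_integrable_continuous continuous_intros
        continuous_on_compose2[OF V] continuous_on_apply_bcontfun) auto
  also have "\<dots> \<le> local_energy \<beta> V J {k} \<omega> \<xi>"
    unfolding local_energy_single_site[OF assms(1) V]
    using \<open>J > 0\<close> by (simp add: sum_nonneg L2_inner_self_nonneg)
  finally show ?thesis .
qed

text \<open>The constant c has to serve all sites and all boundary conditions. The half-space
  depends on \<xi> through the linear coupling, but its mass is at least 1/2 for every \<xi>; the
  ball depends on neither k nor \<xi>. The quadratic terms in \<xi> remain in the exponent.\<close>

lemma partition_function_lower:
  assumes \<gamma>: "loop_gaussian \<beta> m (a\<^sup>2) \<gamma>" and "\<beta> > 0" "J > 0" and V: "continuous_on UNIV V"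
  obtains c where "c > 0"
    "\<And>k (\<xi> :: int ^ 'd::finite \<Rightarrow> real \<Rightarrow>\<^sub>C real). partition_function \<beta> V J \<gamma> {k} \<xi> \<ge>
      ennreal (c * exp (- J * (\<Sum>k' | adjacent k k'. L2_inner \<beta> (\<xi> k') (\<xi> k'))))"
proof -
  interpret G: prob_space \<gamma> by (rule loop_gaussianD(1)[OF \<gamma>])
  interpret PG: product_sigma_finite "\<lambda>_ :: int ^ 'd. \<gamma>" ..
  have [measurable]: "norm \<in> borel_measurable \<gamma>"
    by (intro loop_gaussian_measurable[OF \<gamma>]) measurable
  \<comment> \<open>The ball misses at most 1/4, so its intersection with any half-space of mass 1/2
    still has mass 1/4.\<close>
  obtain r :: nat where r: "measure \<gamma> {\<upsilon> \<in> space \<gamma>. norm \<upsilon> > real r} \<le> 1 / 4"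
  proof -
    have "(\<lambda>n. measure \<gamma> {\<upsilon> \<in> space \<gamma>. norm \<upsilon> > real n}) \<longlonglongrightarrow> measure \<gamma> (\<Inter>n. {\<upsilon> \<in> space \<gamma>. norm \<upsilon> > real n})"
      by (rule G.finite_Lim_measure_decseq) (auto simp: decseq_def)
    moreover have "(\<Inter>n. {\<upsilon> \<in> space \<gamma>. norm \<upsilon> > real n}) = {}"
      by (metis (mono_tags, lifting) INT_E UNIV_I equals0I less_asym mem_Collect_eq reals_Archimedean2)
    ultimately have "(\<lambda>n. measure \<gamma> {\<upsilon> \<in> space \<gamma>. norm \<upsilon> > real n}) \<longlonglongrightarrow> 0" by simp
    from order_tendstoD(2)[OF this, of "1/4"] show ?thesis
      using that by (auto simp: eventually_sequentially intro: less_imp_le)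
  qed
  have "bounded (V ` {- real r..real r})"
    by (intro compact_imp_bounded compact_continuous_image continuous_on_subset[OF V]) auto
  then obtain B where B: "\<And>q. \<bar>q\<bar> \<le> real r \<Longrightarrow> V q \<le> B"
    unfolding bounded_iff by (fastforce simp: abs_le_iff)
  define D where "D = card {j :: int ^ 'd. lnorm j = 1}"
  define b where "b = \<beta> * B + J * (real D * (\<beta> * (real r)\<^sup>2))"
  have main: "partition_function \<beta> V J \<gamma> {k} \<xi> \<ge>
      ennreal (exp (- b) / 4 * exp (- J * (\<Sum>k' | adjacent k k'. L2_inner \<beta> (\<xi> k') (\<xi> k'))))"
    for k :: "int ^ 'd" and \<xi>
  proof -
    define L where "L \<upsilon> = (\<Sum>k' | adjacent k k'. L2_inner \<beta> (apply_bcontfun \<upsilon>) (\<xi> k'))" for \<upsilon>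
    define X where "X = (\<Sum>k' | adjacent k k'. L2_inner \<beta> (\<xi> k') (\<xi> k'))"
    have L: "bounded_linear L"
      unfolding L_def[abs_def]
      by (intro bounded_linear_sum bounded_bilinear.bounded_linear_left[OF bounded_bilinear_L2_inner[OF \<open>\<beta> > 0\<close>]])
    then have [measurable]: "L \<in> borel_measurable \<gamma>"
      by (intro loop_gaussian_measurable[OF \<gamma>] borel_measurable_continuous_onI linear_continuous_on)
    define T where "T = {\<upsilon> \<in> space \<gamma>. 0 \<le> L \<upsilon> \<and> norm \<upsilon> \<le> real r}"
    have [measurable]: "T \<in> sets \<gamma>" unfolding T_def by measurable
    have half: "(1 / 2 :: ennreal) = ennreal (1 / 2)"
      by (subst ennreal_divide_numeral[symmetric]) auto
    have "1 / 2 \<le> emeasure (distr \<gamma> borel L) {0..}"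
      by (intro centered_normal_half loop_gaussianD(4)[OF \<gamma>] L)
    also have "\<dots> = emeasure \<gamma> {\<upsilon> \<in> space \<gamma>. 0 \<le> L \<upsilon>}"
      by (subst emeasure_distr) (auto intro!: arg_cong[where f = "emeasure \<gamma>"])
    finally have "ennreal (1 / 2) \<le> ennreal (measure \<gamma> {\<upsilon> \<in> space \<gamma>. 0 \<le> L \<upsilon>})"
      by (simp only: G.emeasure_eq_measure half)
    then have "1 / 2 \<le> measure \<gamma> {\<upsilon> \<in> space \<gamma>. 0 \<le> L \<upsilon>}"
      by (subst (asm) ennreal_le_iff) auto
    also have "\<dots> \<le> measure \<gamma> (T \<union> {\<upsilon> \<in> space \<gamma>. norm \<upsilon> > real r})"
      by (intro G.finite_measure_mono) (auto simp: T_def)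
    also have "\<dots> \<le> measure \<gamma> T + measure \<gamma> {\<upsilon> \<in> space \<gamma>. norm \<upsilon> > real r}"
      by (intro measure_Un_le) auto
    finally have T: "measure \<gamma> T \<ge> 1 / 4" using r by simp
    have energy: "local_energy \<beta> V J {k} \<omega> \<xi> \<le> b + J * X" if "\<omega> k \<in> T" for \<omega>
    proof -
      have nr: "norm (\<omega> k) \<le> real r" and "0 \<le> L (\<omega> k)" using that by (auto simp: T_def)
      have "(LINT \<tau>:{0..<\<beta>}|lborel. V (\<omega> k \<tau>)) \<le> (LINT \<tau>:{0..<\<beta>}|lborel. B)"
      proof (rule set_integral_mono)
        show "V (\<omega> k \<tau>) \<le> B" for \<tau>
          using norm_bounded[of "\<omega> k" \<tau>] nr by (intro B) simp
      qed (intro set_integrable_continuous continuous_intros continuous_on_compose2[OF V]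
          continuous_on_apply_bcontfun subset_UNIV)+
      also have "\<dots> = \<beta> * B" using \<open>\<beta> > 0\<close> by (simp add: set_lebesgue_integral_def)
      finally have 1: "(LINT \<tau>:{0..<\<beta>}|lborel. V (\<omega> k \<tau>)) \<le> \<beta> * B" .
      \<comment> \<open>Expanding the squares isolates the cross term - 2 L, which is nonpositive on
        T.\<close>
      have "(\<Sum>k' | adjacent k k'. L2_inner \<beta> (\<omega> k - \<xi> k') (\<omega> k - \<xi> k')) =
          real (card {k'. adjacent k k'}) * L2_inner \<beta> (\<omega> k) (\<omega> k) - 2 * L (\<omega> k) + X"
        unfolding L2_inner_diff_self[OF \<open>\<beta> > 0\<close>]
        by (simp add: sum.distrib sum_subtractf L_def X_def sum_distrib_left)
      also have "\<dots> \<le> real D * (\<beta> * (real r)\<^sup>2) + X"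
        using \<open>0 \<le> L (\<omega> k)\<close> L2_inner_self_le[OF \<open>\<beta> > 0\<close> nr] card_adjacent_le[of k]
          mult_mono[of "real (card {k'. adjacent k k'})" "real D" "L2_inner \<beta> (\<omega> k) (\<omega> k)" "\<beta> * (real r)\<^sup>2"]
        by (simp add: D_def L2_inner_self_nonneg)
      finally have "J * (\<Sum>k' | adjacent k k'. L2_inner \<beta> (\<omega> k - \<xi> k') (\<omega> k - \<xi> k')) \<le> J * (real D * (\<beta> * (real r)\<^sup>2) + X)"
        using \<open>J > 0\<close> by simp
      with 1 show ?thesis
        unfolding local_energy_single_site[OF \<open>\<beta> > 0\<close> V] b_def by (simp add: distrib_left)
    qed
    have "ennreal (exp (- b) / 4 * exp (- J * X)) \<le> ennreal (exp (- (b + J * X)) * measure \<gamma> T)"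
      using T by (intro ennreal_leI) (simp add: exp_add exp_diff field_simps exp_minus)
    also have "\<dots> = ennreal (exp (- (b + J * X))) * emeasure \<gamma> T"
      by (simp add: ennreal_mult G.emeasure_eq_measure)
    also have "\<dots> = (\<integral>\<^sup>+\<upsilon>. ennreal (exp (- (b + J * X))) * indicator T \<upsilon> \<partial>\<gamma>)"
      by (rule nn_integral_cmult_indicator[symmetric]) simp
    also have "\<dots> = (\<integral>\<^sup>+\<omega>. ennreal (exp (- (b + J * X))) * indicator T (\<omega> k) \<partial>(\<Pi>\<^sub>M k\<in>{k}. \<gamma>))"
      by (rule PG.product_nn_integral_singleton[symmetric]) simp
    also have "\<dots> \<le> partition_function \<beta> V J \<gamma> {k} \<xi>"
      unfolding partition_function_def
      by (intro nn_integral_mono) (auto simp: indicator_def intro!: ennreal_leI dest!: energy)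
    finally show ?thesis by (simp add: X_def)
  qed
  show ?thesis
    by (rule that[OF _ main]) simp
qed

section \<open>The equilibrium equations at a single site\<close>

lemma config_borel_coordinate:
  assumes "f \<in> borel \<rightarrow>\<^sub>M N"
  shows "(\<lambda>\<omega>. f (\<omega> k)) \<in> config_borel \<beta> \<rightarrow>\<^sub>M N"
  unfolding config_borel_def
  by (intro measurable_restrict_space1 measurable_compose[OF _ assms] measurable_product_coordinates)

lemma gibbs_measuresD:
  assumes "\<mu> \<in> gibbs_measures \<beta> V J \<gamma>"
  shows "prob_space \<mu>" "space \<mu> = configs \<beta>" "sets \<mu> = sets (config_borel \<beta>)"
    "\<Delta> \<in> sets (config_borel \<beta>) \<Longrightarrow> emeasure \<mu> \<Delta> = (\<integral>\<^sup>+\<omega>. local_spec \<beta> V J \<gamma> {k} \<Delta> \<omega> \<partial>\<mu>)"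
  using assms unfolding gibbs_measures_def by auto

lemma gibbs_measurable:
  assumes "\<mu> \<in> gibbs_measures \<beta> V J \<gamma>" "f \<in> borel \<rightarrow>\<^sub>M N"
  shows "(\<lambda>\<omega>. f (\<omega> k)) \<in> \<mu> \<rightarrow>\<^sub>M N"
  using config_borel_coordinate[OF assms(2)] gibbs_measuresD(3)[OF assms(1)]
  by (simp cong: measurable_cong_sets)

text \<open>The indicator of \<Delta> is majorised by that of T, which sees only the loop at k. The
  majorant is then an integral over a product with one factor, that is, over \<gamma>.\<close>

lemma local_spec_single_site_le:
  fixes \<xi> :: "int ^ 'd::finite \<Rightarrow> real \<Rightarrow>\<^sub>C real"
  assumes \<gamma>: "loop_gaussian \<beta> m (a\<^sup>2) \<gamma>" and "\<beta> > 0" "J > 0" and V: "continuous_on UNIV V"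
    and C: "\<And>q. V q \<ge> M * q\<^sup>2 - C"
    and Z: "partition_function \<beta> V J \<gamma> {k} \<xi> \<ge> ennreal z" "z > 0"
    and T: "T \<in> sets borel" "\<And>\<omega>. \<omega> \<in> \<Delta> \<Longrightarrow> \<omega> k \<in> T"
  shows "local_spec \<beta> V J \<gamma> {k} \<Delta> \<xi> \<le>
    ennreal (exp (\<beta> * C) / z) * (\<integral>\<^sup>+\<upsilon>. ennreal (exp (- M * L2_inner \<beta> (apply_bcontfun \<upsilon>) (apply_bcontfun \<upsilon>))) * indicator T \<upsilon> \<partial>\<gamma>)"
proof -
  interpret G: prob_space \<gamma> by (rule loop_gaussianD(1)[OF \<gamma>])
  interpret PG: product_sigma_finite "\<lambda>_ :: int ^ 'd. \<gamma>" ..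
  note [measurable] = borel_measurable_L2_inner[OF \<open>\<beta> > 0\<close>] T(1)
  define I where "I = (\<integral>\<^sup>+\<upsilon>. ennreal (exp (- M * L2_inner \<beta> (apply_bcontfun \<upsilon>) (apply_bcontfun \<upsilon>))) * indicator T \<upsilon> \<partial>\<gamma>)"
  have meas: "(\<lambda>\<upsilon>. ennreal (exp (- M * L2_inner \<beta> (apply_bcontfun \<upsilon>) (apply_bcontfun \<upsilon>))) * indicator T \<upsilon>) \<in> borel_measurable \<gamma>"
    by (intro loop_gaussian_measurable[OF \<gamma>]) measurable
  have "(\<integral>\<^sup>+\<omega>. ennreal (exp (- local_energy \<beta> V J {k} \<omega> \<xi>)) *
        indicator \<Delta> (\<lambda>j. if j \<in> {k} then \<omega> j else \<xi> j) \<partial>(\<Pi>\<^sub>M j\<in>{k}. \<gamma>))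
    \<le> (\<integral>\<^sup>+\<omega>. ennreal (exp (\<beta> * C)) * (ennreal (exp (- M * L2_inner \<beta> (apply_bcontfun (\<omega> k)) (apply_bcontfun (\<omega> k)))) * indicator T (\<omega> k)) \<partial>(\<Pi>\<^sub>M j\<in>{k}. \<gamma>))"
  proof (rule nn_integral_mono)
    fix \<omega> :: "int ^ 'd \<Rightarrow> real \<Rightarrow>\<^sub>C real"
    have "exp (- local_energy \<beta> V J {k} \<omega> \<xi>) \<le> exp (\<beta> * C) * exp (- M * L2_inner \<beta> (\<omega> k) (\<omega> k))"
      using local_energy_single_site_lower[OF assms(2,3) V C, where k = k and \<omega> = \<omega> and \<xi> = \<xi>]
      by (simp flip: exp_add)
    then have "ennreal (exp (- local_energy \<beta> V J {k} \<omega> \<xi>)) \<le>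
        ennreal (exp (\<beta> * C)) * ennreal (exp (- M * L2_inner \<beta> (\<omega> k) (\<omega> k)))"
      by (simp flip: ennreal_mult')
    moreover have "indicator \<Delta> (\<lambda>j. if j \<in> {k} then \<omega> j else \<xi> j) \<le> (indicator T (\<omega> k) :: ennreal)"
      using T(2)[of "\<lambda>j. if j \<in> {k} then \<omega> j else \<xi> j"] by (auto simp: indicator_def)
    ultimately show "ennreal (exp (- local_energy \<beta> V J {k} \<omega> \<xi>)) * indicator \<Delta> (\<lambda>j. if j \<in> {k} then \<omega> j else \<xi> j)
      \<le> ennreal (exp (\<beta> * C)) * (ennreal (exp (- M * L2_inner \<beta> (\<omega> k) (\<omega> k))) * indicator T (\<omega> k))"
      unfolding mult.assoc[symmetric] by (intro mult_mono) auto
  qed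
  also have "\<dots> = (\<integral>\<^sup>+\<upsilon>. ennreal (exp (\<beta> * C)) * (ennreal (exp (- M * L2_inner \<beta> (apply_bcontfun \<upsilon>) (apply_bcontfun \<upsilon>))) * indicator T \<upsilon>) \<partial>\<gamma>)"
    by (rule PG.product_nn_integral_singleton) (intro borel_measurable_times_ennreal borel_measurable_const meas)
  also have "\<dots> = ennreal (exp (\<beta> * C)) * I"
    unfolding I_def by (rule nn_integral_cmult[OF meas])
  also have "\<dots> = ennreal (exp (\<beta> * C) / z) * I * ennreal z"
    using \<open>z > 0\<close> by (simp add: mult.assoc mult.commute[of I] flip: ennreal_mult')
      (simp add: mult.assoc[symmetric] flip: ennreal_mult')
  also have "\<dots> \<le> ennreal (exp (\<beta> * C) / z) * I * partition_function \<beta> V J \<gamma> {k} \<xi>"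
    using Z(1) by (intro mult_left_mono) auto
  finally show ?thesis
    unfolding local_spec_def I_def[symmetric]
    using Z by (intro divide_le_posI_ennreal) (auto simp: mult.commute intro: less_le_trans[of 0 "ennreal z"])
qed

text \<open>The order of the constants is the point: B is fixed before M, and only C depends on M,
  so that M may later be chosen large against B. The event restricts the neighbours, so the
  partition function is bounded below uniformly over the boundary conditions that
  contribute.\<close>

lemma gibbs_single_site_estimate:
  fixes V :: "real \<Rightarrow> real"
  assumes \<gamma>: "loop_gaussian \<beta> m (a\<^sup>2) \<gamma>" and "\<beta> > 0" "J > 0" and V: "self_interaction V"
  obtains B and C :: "real \<Rightarrow> real" where "B \<ge> 0" "\<And>M. C M \<ge> 0"
    "\<And>M S T k (\<mu> :: (int ^ 'd::finite \<Rightarrow> real \<Rightarrow>\<^sub>C real) measure).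
      \<mu> \<in> gibbs_measures \<beta> V J \<gamma> \<Longrightarrow> T \<in> sets borel \<Longrightarrow>
      emeasure \<mu> {\<omega> \<in> space \<mu>. \<omega> k \<in> T \<and> (\<forall>k'. adjacent k k' \<longrightarrow> L2_inner \<beta> (\<omega> k') (\<omega> k') \<le> S)} \<le>
      ennreal (C M * exp (B * S)) * (\<integral>\<^sup>+\<upsilon>. ennreal (exp (- M * L2_inner \<beta> (apply_bcontfun \<upsilon>) (apply_bcontfun \<upsilon>))) * indicator T \<upsilon> \<partial>\<gamma>)"
proof -
  note Vc = self_interaction_continuous[OF V]
  obtain c where c: "c > 0"
    "\<And>k (\<xi> :: int ^ 'd \<Rightarrow> real \<Rightarrow>\<^sub>C real). partition_function \<beta> V J \<gamma> {k} \<xi> \<ge>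
      ennreal (c * exp (- J * (\<Sum>k' | adjacent k k'. L2_inner \<beta> (\<xi> k') (\<xi> k'))))"
    using partition_function_lower[OF \<gamma> \<open>\<beta> > 0\<close> \<open>J > 0\<close> Vc] by metis
  have "\<forall>M. \<exists>C. \<forall>q. V q \<ge> M * q\<^sup>2 - C"
    using self_interaction_superquadratic[OF V] by blast
  then obtain C where C: "\<And>M q. V q \<ge> M * q\<^sup>2 - C M" by metis
  define D where "D = card {j :: int ^ 'd. lnorm j = 1}"
  have main: "emeasure \<mu> {\<omega> \<in> space \<mu>. \<omega> k \<in> T \<and> (\<forall>k'. adjacent k k' \<longrightarrow> L2_inner \<beta> (\<omega> k') (\<omega> k') \<le> S)} \<le>
      ennreal (exp (\<beta> * C M) / c * exp (J * D * S)) *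
      (\<integral>\<^sup>+\<upsilon>. ennreal (exp (- M * L2_inner \<beta> (apply_bcontfun \<upsilon>) (apply_bcontfun \<upsilon>))) * indicator T \<upsilon> \<partial>\<gamma>)"
    (is "emeasure \<mu> ?\<Delta> \<le> ?R")
    if \<mu>: "\<mu> \<in> gibbs_measures \<beta> V J \<gamma>" and T: "T \<in> sets borel" for M S T k and \<mu> :: "(int ^ 'd \<Rightarrow> real \<Rightarrow>\<^sub>C real) measure"
  proof -
    interpret prob_space \<mu> by (rule gibbs_measuresD(1)[OF \<mu>])
    have "(\<lambda>\<omega>. \<omega> k) -` T \<inter> space \<mu> \<in> sets \<mu>"
      using measurable_sets[OF gibbs_measurable[OF \<mu> measurable_ident] T] by simp
    moreover have "(\<lambda>\<omega>. \<omega> k) -` T \<inter> space \<mu> = {\<omega> \<in> space \<mu>. \<omega> k \<in> T}" by auto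
    moreover have "{\<omega> \<in> space \<mu>. \<forall>k'\<in>{k'. adjacent k k'}. L2_inner \<beta> (\<omega> k') (\<omega> k') \<le> S} \<in> sets \<mu>"
      by (intro sets.sets_Collect_finite_All finite_adjacent borel_measurable_le borel_measurable_const
        gibbs_measurable[OF \<mu> borel_measurable_L2_inner[OF \<open>\<beta> > 0\<close>]])
    ultimately have "{\<omega> \<in> space \<mu>. \<omega> k \<in> T} \<inter> {\<omega> \<in> space \<mu>. \<forall>k'\<in>{k'. adjacent k k'}. L2_inner \<beta> (\<omega> k') (\<omega> k') \<le> S} \<in> sets \<mu>"
      by (intro sets.Int) auto
    moreover have "{\<omega> \<in> space \<mu>. \<omega> k \<in> T} \<inter> {\<omega> \<in> space \<mu>. \<forall>k'\<in>{k'. adjacent k k'}. L2_inner \<beta> (\<omega> k') (\<omega> k') \<le> S} = ?\<Delta>"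
      by auto
    ultimately have "?\<Delta> \<in> sets (config_borel \<beta>)"
      using gibbs_measuresD(3)[OF \<mu>] by simp
    then have "emeasure \<mu> ?\<Delta> = (\<integral>\<^sup>+\<xi>. local_spec \<beta> V J \<gamma> {k} ?\<Delta> \<xi> \<partial>\<mu>)"
      by (rule gibbs_measuresD(4)[OF \<mu>])
    also have "\<dots> \<le> (\<integral>\<^sup>+\<xi>. ?R \<partial>\<mu>)"
    proof (rule nn_integral_mono)
      fix \<xi>
      show "local_spec \<beta> V J \<gamma> {k} ?\<Delta> \<xi> \<le> ?R"
      proof (cases "\<forall>k'. adjacent k k' \<longrightarrow> L2_inner \<beta> (\<xi> k') (\<xi> k') \<le> S")
        case True
        define X where "X = (\<Sum>k' | adjacent k k'. L2_inner \<beta> (\<xi> k') (\<xi> k'))"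
        \<comment> \<open>S is an arbitrary real; replacing the number of neighbours by D requires S
          \<ge> 0, which the presence of one neighbour forces.\<close>
        have "X \<le> D * S"
        proof (cases "{k'. adjacent k k'} = {}")
          case ne: False
          then obtain k' where "adjacent k k'" by blast
          then have "0 \<le> S" using True L2_inner_self_nonneg[of \<beta> "\<xi> k'"] by force
          have "X \<le> of_nat (card {k'. adjacent k k'}) * S"
            unfolding X_def using True by (intro sum_bounded_above) auto
          also have "\<dots> \<le> D * S"
            unfolding D_def using card_adjacent_le[of k] \<open>0 \<le> S\<close> by (intro mult_right_mono) auto
          finally show ?thesis .
        next
          case True
          then have "D = 0" using adjacent_eq_image[of k] by (simp add: D_def)
          then show ?thesis using True by (simp add: X_def)
        qed
        then have X: "exp (- J * X) \<ge> exp (- (J * D * S))"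
          using \<open>J > 0\<close> by (simp add: mult.assoc)
        have "ennreal (c * exp (- (J * D * S))) \<le> partition_function \<beta> V J \<gamma> {k} \<xi>"
          using c(2)[where k = k and \<xi> = \<xi>] X c(1) unfolding X_def[symmetric]
          by (meson ennreal_leI mult_left_mono less_imp_le order_trans)
        from local_spec_single_site_le[OF \<gamma> assms(2,3) Vc C this _ T, of ?\<Delta> M]
        have "local_spec \<beta> V J \<gamma> {k} ?\<Delta> \<xi> \<le> ennreal (exp (\<beta> * C M) / (c * exp (- (J * D * S)))) *
          (\<integral>\<^sup>+\<upsilon>. ennreal (exp (- M * L2_inner \<beta> (apply_bcontfun \<upsilon>) (apply_bcontfun \<upsilon>))) * indicator T \<upsilon> \<partial>\<gamma>)"
          using c(1) by auto
        then show ?thesis by (simp add: exp_minus divide_simps)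
      next
        case False
        then obtain k' where k': "adjacent k k'" "\<not> L2_inner \<beta> (\<xi> k') (\<xi> k') \<le> S" by blast
        \<comment> \<open>Resampling the loop at k leaves the neighbour k' at its value in \<xi>, so
          the event fails for every new loop at k.\<close>
        then have "k' \<noteq> k" by auto
        then have "(\<lambda>j. if j \<in> {k} then \<omega> j else \<xi> j) \<notin> ?\<Delta>" for \<omega>
          using k' by auto
        then have z: "indicator ?\<Delta> (\<lambda>j. if j \<in> {k} then \<omega> j else \<xi> j) = (0 :: ennreal)" for \<omega>
          by (rule indicator_simps(2))
        have "local_spec \<beta> V J \<gamma> {k} ?\<Delta> \<xi> = 0"
          unfolding local_spec_def z by simp
        then show ?thesis by simp
      qed
    qed
    also have "\<dots> = ?R" by (simp add: emeasure_space_1)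
    finally show ?thesis .
  qed
  show ?thesis
    by (rule that[OF _ _ main]) (use \<open>J > 0\<close> c(1) in auto)
qed

section \<open>Tail bounds for tempered Gibbs measures\<close>

text \<open>A single term of a summable nonnegative family is at most its sum. The weight \<delta> =
  1/2 is chosen because exp(1/2) \<le> 2, which stays below the factor 4 of the path
  argument.\<close>

lemma tempered_L2_bound:
  assumes "\<omega> \<in> tempered_configs \<beta>"
  obtains K where "\<And>k. L2_inner \<beta> (\<omega> k) (\<omega> k) \<le> K * exp (lnorm k / 2)"
proof -
  let ?g = "\<lambda>k. exp (- (1 / 2) * lnorm k) * L2_inner \<beta> (\<omega> k) (\<omega> k)"
  have g: "?g summable_on UNIV"
    using assms unfolding tempered_configs_def by (auto dest: bspec[of _ _ "1/2"])
  have "L2_inner \<beta> (\<omega> k) (\<omega> k) \<le> infsum ?g UNIV * exp (lnorm k / 2)" for k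
  proof -
    have "sum ?g {k} \<le> infsum ?g UNIV"
      by (rule finite_sum_le_infsum[OF g]) (auto simp: L2_inner_self_nonneg)
    then have "?g k * exp (lnorm k / 2) \<le> infsum ?g UNIV * exp (lnorm k / 2)"
      by (intro mult_right_mono) auto
    moreover have "?g k * exp (lnorm k / 2) = L2_inner \<beta> (\<omega> k) (\<omega> k)"
      by (simp add: exp_minus)
    ultimately show ?thesis by (simp only:)
  qed
  then show ?thesis using that by blast
qed

text \<open>End points of nearest-neighbour walks of exactly n steps, with returns allowed; this
  gives the recursion for the cardinality directly.\<close>

fun reach :: "nat \<Rightarrow> int ^ 'd \<Rightarrow> (int ^ 'd) set" where
  "reach 0 k = {k}"
| "reach (Suc n) k = (\<Union>j\<in>reach n k. {j'. adjacent j j'})"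

lemma finite_reach: "finite (reach n (k :: int ^ 'd::finite))"
  by (induction n) (auto intro: finite_adjacent)

lemma card_reach_le: "card (reach n (k :: int ^ 'd::finite)) \<le> card {j :: int ^ 'd. lnorm j = 1} ^ n"
proof (induction n)
  case (Suc n)
  have "card (reach (Suc n) k) \<le> (\<Sum>j\<in>reach n k. card {j'. adjacent j j'})"
    unfolding reach.simps by (rule card_UN_le) (rule finite_reach)
  also have "\<dots> \<le> card (reach n k) * card {j :: int ^ 'd. lnorm j = 1}"
    by (rule sum_bounded_above[where 'a = nat, simplified]) (rule card_adjacent_le)
  also have "\<dots> \<le> card {j :: int ^ 'd. lnorm j = 1} ^ Suc n"
    using Suc by simp
  finally show ?case .
qed simp

lemma lnorm_reach: "j \<in> reach n k \<Longrightarrow> lnorm j \<le> lnorm k + real n"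
proof (induction n arbitrary: j)
  case (Suc n)
  then obtain i where i: "i \<in> reach n k" "adjacent i j" by auto
  let ?r = "\<lambda>k :: int ^ 'a. (\<chi> l. real_of_int (k $ l)) :: real ^ 'a"
  have "?r (i - j) = ?r i - ?r j" by (simp add: vec_eq_iff)
  then have "lnorm (i - j) = norm (?r j - ?r i)" by (simp add: lnorm_def norm_minus_commute)
  then have "norm (?r j - ?r i) = 1" using i(2) by (simp add: adjacent_def)
  then have "lnorm j \<le> lnorm i + 1"
    using norm_triangle_ineq2[of "?r j" "?r i"] by (simp add: lnorm_def)
  then show ?case using Suc.IH[OF i(1)] by simp
qed simp

text \<open>A value above $4^n r$ at a site reached in $n$ steps either forces a value above $4^{n+1} r$ at
  one of its neighbours, or it is an atypical value given its neighbours.  Temperedness rules out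
  that the first alternative occurs for ever.\<close>

lemma gibbs_L2_tail:
  fixes V :: "real \<Rightarrow> real"
  assumes \<gamma>: "loop_gaussian \<beta> m (a\<^sup>2) \<gamma>" and "\<beta> > 0" "J > 0" and V: "self_interaction V"
  shows "\<exists>C\<ge>0. \<forall>(\<mu> :: (int ^ 'd::finite \<Rightarrow> real \<Rightarrow>\<^sub>C real) measure)\<in>tempered_gibbs_measures \<beta> V J \<gamma>.
    \<forall>k. \<forall>r\<ge>1. measure \<mu> {\<omega> \<in> space \<mu>. L2_inner \<beta> (apply_bcontfun (\<omega> k)) (apply_bcontfun (\<omega> k)) > r} \<le> C * exp (- M * r)"
proof -
  obtain B and C :: "real \<Rightarrow> real" where "B \<ge> 0" and C: "\<And>M. C M \<ge> 0" and est:
    "\<And>M S T k (\<mu> :: (int ^ 'd::finite \<Rightarrow> real \<Rightarrow>\<^sub>C real) measure).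
      \<mu> \<in> gibbs_measures \<beta> V J \<gamma> \<Longrightarrow> T \<in> sets borel \<Longrightarrow>
      emeasure \<mu> {\<omega> \<in> space \<mu>. \<omega> k \<in> T \<and> (\<forall>k'. adjacent k k' \<longrightarrow> L2_inner \<beta> (\<omega> k') (\<omega> k') \<le> S)} \<le>
      ennreal (C M * exp (B * S)) * (\<integral>\<^sup>+\<upsilon>. ennreal (exp (- M * L2_inner \<beta> (apply_bcontfun \<upsilon>) (apply_bcontfun \<upsilon>))) * indicator T \<upsilon> \<partial>\<gamma>)"
    by (rule gibbs_single_site_estimate[OF assms]) (rule that)
  interpret G: prob_space \<gamma> by (rule loop_gaussianD(1)[OF \<gamma>])
  define D where "D = card {j :: int ^ 'd. lnorm j = 1}"
  \<comment> \<open>M1 \<ge> M yields the required rate, and the logarithm makes x = D exp(- M1) at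
    most 1/2, so the growing number of sites is summable.\<close>
  define M1 where "M1 = max 0 (max M (ln (2 * real D + 1)))"
  have M1: "M1 \<ge> 0" "M1 \<ge> M" "M1 \<ge> ln (2 * real D + 1)" by (auto simp: M1_def)
  define x where "x = real D * exp (- M1)"
  have x: "0 \<le> x" "x \<le> 1 / 2"
  proof -
    show "0 \<le> x" by (simp add: x_def)
    have "2 * real D + 1 = exp (ln (2 * real D + 1))" by (rule exp_ln[symmetric]) linarith
    also have "\<dots> \<le> exp M1" using M1(3) by (simp only: exp_le_cancel_iff)
    finally have "2 * real D \<le> exp M1" by simp
    then show "x \<le> 1 / 2" by (simp add: x_def exp_minus field_simps)
  qed
  \<comment> \<open>Neighbours up to 4 s cost exp(4 B s); the rate M2 leaves exp(- M1 s) after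
    paying for this.\<close>
  define M2 where "M2 = M1 + 4 * B"
  have "M2 \<ge> 0" using M1 \<open>B \<ge> 0\<close> by (simp add: M2_def)
  have main: "measure \<mu> {\<omega> \<in> space \<mu>. L2_inner \<beta> (apply_bcontfun (\<omega> k)) (apply_bcontfun (\<omega> k)) > r} \<le> 2 * C M2 * exp (- M * r)"
    if \<mu>: "\<mu> \<in> tempered_gibbs_measures \<beta> V J \<gamma>" and "r \<ge> 1"
    for \<mu> :: "(int ^ 'd \<Rightarrow> real \<Rightarrow>\<^sub>C real) measure" and k r
  proof -
    have \<mu>g: "\<mu> \<in> gibbs_measures \<beta> V J \<gamma>" and \<mu>t: "emeasure \<mu> (tempered_configs \<beta>) = 1"
      using \<mu> by (auto simp: tempered_gibbs_measures_def)
    interpret prob_space \<mu> by (rule gibbs_measuresD(1)[OF \<mu>g])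
    define X where "X j \<omega> = L2_inner \<beta> (apply_bcontfun (\<omega> j)) (apply_bcontfun (\<omega> j))" for j :: "int ^ 'd" and \<omega>
    have X [measurable]: "X j \<in> borel_measurable \<mu>" for j
      unfolding X_def[abs_def] by (intro gibbs_measurable[OF \<mu>g] borel_measurable_L2_inner \<open>\<beta> > 0\<close>)
    define A where "A n = {\<omega> \<in> space \<mu>. \<exists>j\<in>reach n k. X j \<omega> > 4 ^ n * r}" for n
    define E where "E s j = {\<omega> \<in> space \<mu>. X j \<omega> > s \<and> (\<forall>j'\<in>{j'. adjacent j j'}. X j' \<omega> \<le> 4 * s)}" for s j
    have mA [measurable]: "A n \<in> sets \<mu>" for n
      unfolding A_def by (intro sets.sets_Collect_finite_Ex finite_reach) measurable
    have mE [measurable]: "E s j \<in> sets \<mu>" for s j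
      unfolding E_def
      by (intro sets.sets_Collect_conj sets.sets_Collect_finite_All finite_adjacent) measurable
    have E: "measure \<mu> (E s j) \<le> C M2 * exp (- M1 * s)" for s j
    proof -
      let ?T = "{\<upsilon>. L2_inner \<beta> (apply_bcontfun \<upsilon>) (apply_bcontfun \<upsilon>) > s}"
      have T: "?T \<in> sets borel"
        using borel_measurable_L2_inner[OF \<open>\<beta> > 0\<close>] by measurable
      have "(\<integral>\<^sup>+\<upsilon>. ennreal (exp (- M2 * L2_inner \<beta> (apply_bcontfun \<upsilon>) (apply_bcontfun \<upsilon>))) * indicator ?T \<upsilon> \<partial>\<gamma>)
        \<le> (\<integral>\<^sup>+\<upsilon>. ennreal (exp (- M2 * s)) \<partial>\<gamma>)"
        using \<open>M2 \<ge> 0\<close> by (intro nn_integral_mono)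
          (auto simp: indicator_def intro!: ennreal_leI mult_left_mono)
      also have "\<dots> = ennreal (exp (- M2 * s))" by (simp add: G.emeasure_space_1)
      finally have le: "(\<integral>\<^sup>+\<upsilon>. ennreal (exp (- M2 * L2_inner \<beta> (apply_bcontfun \<upsilon>) (apply_bcontfun \<upsilon>))) * indicator ?T \<upsilon> \<partial>\<gamma>)
        \<le> ennreal (exp (- M2 * s))" .
      have "ennreal (measure \<mu> (E s j)) = emeasure \<mu> {\<omega> \<in> space \<mu>. \<omega> j \<in> ?T \<and> (\<forall>k'. adjacent j k' \<longrightarrow> L2_inner \<beta> (\<omega> k') (\<omega> k') \<le> 4 * s)}"
        by (simp add: E_def X_def emeasure_eq_measure)
      also have "\<dots> \<le> ennreal (C M2 * exp (B * (4 * s))) * ennreal (exp (- M2 * s))"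
        by (rule order_trans[OF est[OF \<mu>g T] mult_left_mono[OF le]]) simp
      also have "\<dots> = ennreal (C M2 * exp (B * (4 * s)) * exp (- M2 * s))"
        by (rule ennreal_mult''[symmetric]) simp
      also have "C M2 * exp (B * (4 * s)) * exp (- M2 * s) = C M2 * exp (- M1 * s)"
        unfolding mult.assoc exp_add[symmetric] by (simp add: M2_def algebra_simps)
      finally show ?thesis using C by (subst (asm) ennreal_le_iff) auto
    qed
    have step: "measure \<mu> (A n) \<le> C M2 * exp (- M1 * r) * x ^ n + measure \<mu> (A (Suc n))" for n
    proof -
      have "A n \<subseteq> (\<Union>j\<in>reach n k. E (4 ^ n * r) j) \<union> A (Suc n)"
      proof
        fix \<omega> assume "\<omega> \<in> A n"
        then obtain j where j: "\<omega> \<in> space \<mu>" "j \<in> reach n k" "X j \<omega> > 4 ^ n * r" by (auto simp: A_def)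
        show "\<omega> \<in> (\<Union>j\<in>reach n k. E (4 ^ n * r) j) \<union> A (Suc n)"
        proof (cases "\<omega> \<in> E (4 ^ n * r) j")
          case False
          then obtain j' where "adjacent j j'" "X j' \<omega> > 4 * (4 ^ n * r)"
            using j by (auto simp: E_def not_le)
          then have "j' \<in> reach (Suc n) k" "X j' \<omega> > 4 ^ Suc n * r" using j by auto
          then show ?thesis using j(1) unfolding A_def by blast
        qed (use j in blast)
      qed
      then have "measure \<mu> (A n) \<le> measure \<mu> ((\<Union>j\<in>reach n k. E (4 ^ n * r) j) \<union> A (Suc n))"
        by (intro finite_measure_mono sets.Un sets.finite_UN finite_reach mA mE)
      also have "\<dots> \<le> measure \<mu> (\<Union>j\<in>reach n k. E (4 ^ n * r) j) + measure \<mu> (A (Suc n))"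
        by (intro measure_Un_le sets.finite_UN finite_reach mA mE)
      also have "measure \<mu> (\<Union>j\<in>reach n k. E (4 ^ n * r) j) \<le> (\<Sum>j\<in>reach n k. measure \<mu> (E (4 ^ n * r) j))"
        by (intro measure_UNION_le finite_reach mE)
      also have "\<dots> \<le> (\<Sum>j\<in>reach n k. C M2 * (exp (- M1 * r) * exp (- M1) ^ n))"
      proof (rule sum_mono)
        fix j
        \<comment> \<open>Bernoulli's inequality splits the decay at level 4^n r into one factor for
          r and one for each step.\<close>
        have "4 ^ n * r \<ge> r + real n"
        proof -
          have "1 + real n * 3 \<le> (1 + 3) ^ n" by (rule Bernoulli_inequality) simp
          then have "(1 + real n * 3) * r \<le> 4 ^ n * r" using \<open>r \<ge> 1\<close> by (intro mult_right_mono) auto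
          moreover have "real n * 1 \<le> real n * (3 * r)" using \<open>r \<ge> 1\<close> by (intro mult_left_mono) auto
          ultimately show ?thesis by (simp add: algebra_simps)
        qed
        then have "exp (- M1 * (4 ^ n * r)) \<le> exp (- M1 * (r + real n))"
          using M1(1) by (simp add: mult_left_mono)
        also have "\<dots> = exp (- M1 * r) * exp (- M1) ^ n"
          unfolding exp_of_nat_mult[symmetric] exp_add[symmetric] by (simp add: algebra_simps)
        finally show "measure \<mu> (E (4 ^ n * r) j) \<le> C M2 * (exp (- M1 * r) * exp (- M1) ^ n)"
          using E[of "4 ^ n * r" j] C[of M2] by (meson mult_left_mono order_trans)
      qed
      also have "\<dots> = real (card (reach n k)) * (C M2 * (exp (- M1 * r) * exp (- M1) ^ n))" by simp
      also have "\<dots> \<le> real D ^ n * (C M2 * (exp (- M1 * r) * exp (- M1) ^ n))"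
        using card_reach_le[of n k] C[of M2] unfolding D_def
        by (intro mult_right_mono) (auto simp flip: of_nat_power)
      also have "\<dots> = C M2 * exp (- M1 * r) * x ^ n" by (simp add: x_def power_mult_distrib)
      finally show ?thesis by simp
    qed
    \<comment> \<open>The bracket 2 - 2 (1/2)^n is the n-th partial sum of the geometric series with
      ratio 1/2.\<close>
    have iter: "measure \<mu> (A 0) \<le> C M2 * exp (- M1 * r) * (2 - 2 * (1 / 2) ^ n) + measure \<mu> (A n)" for n
    proof (induction n)
      case (Suc n)
      have "C M2 * exp (- M1 * r) * x ^ n \<le> C M2 * exp (- M1 * r) * (1 / 2) ^ n"
        using C[of M2] x by (intro mult_left_mono power_mono) auto
      then show ?case using Suc step[of n] by (simp add: algebra_simps)
    qed simp
    have "(\<lambda>n. measure \<mu> (A n)) \<longlonglongrightarrow> 0"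
    proof -
      \<comment> \<open>A non-measurable set would get measure 0 by default, so the value 1 already
        gives measurability.\<close>
      have "tempered_configs \<beta> \<in> sets \<mu>" using \<mu>t by (metis emeasure_notin_sets zero_neq_one)
      then have "AE \<omega> in \<mu>. \<omega> \<in> tempered_configs \<beta>"
        using \<mu>t by (simp add: AE_in_set_eq_1 emeasure_eq_measure)
      then have "AE \<omega> in \<mu>. (\<lambda>n. indicator (A n) \<omega> :: real) \<longlonglongrightarrow> 0"
      proof eventually_elim
        case (elim \<omega>)
        then obtain K where K: "\<And>j. X j \<omega> \<le> K * exp (lnorm j / 2)"
          unfolding X_def using tempered_L2_bound by blast
        \<comment> \<open>From N on, 4^n \<le> 4^n r < X_j \<le> |K| exp(|k| / 2) 2^n < 2^N 2^n
          \<le> 4^n would be contradictory: each tempered configuration leaves the sets A n for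
          good.\<close>
        obtain N where N: "\<bar>K\<bar> * exp (lnorm k / 2) < 2 ^ N"
          using real_arch_pow[of 2 "\<bar>K\<bar> * exp (lnorm k / 2)"] by auto
        have "\<omega> \<notin> A n" if "n \<ge> N" for n
        proof
          assume "\<omega> \<in> A n"
          then obtain j where j: "j \<in> reach n k" "4 ^ n * r < X j \<omega>" by (auto simp: A_def)
          have "(2::real) ^ n * 2 ^ n = 4 ^ n" by (simp flip: power_mult_distrib)
          also have "(4::real) ^ n \<le> 4 ^ n * r" using \<open>r \<ge> 1\<close> by simp
          also have "\<dots> < X j \<omega>" by fact
          also have "\<dots> \<le> \<bar>K\<bar> * exp (lnorm j / 2)"
            using K[of j] by (rule order_trans) (intro mult_right_mono, auto)
          also have "\<dots> \<le> \<bar>K\<bar> * exp (lnorm k / 2 + real n * (1 / 2))"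
            using lnorm_reach[OF j(1)] by (intro mult_left_mono) auto
          also have "\<dots> = \<bar>K\<bar> * exp (lnorm k / 2) * exp (1 / 2) ^ n"
            by (simp only: exp_add exp_of_nat_mult mult.assoc)
          also have "\<dots> \<le> \<bar>K\<bar> * exp (lnorm k / 2) * 2 ^ n"
            by (intro mult_left_mono power_mono exp_half_le2) auto
          also have "\<dots> \<le> 2 ^ N * 2 ^ n" using N by (intro mult_right_mono) auto
          also have "\<dots> \<le> 2 ^ n * 2 ^ n" using that by (intro mult_right_mono power_increasing) auto
          finally show False by simp
        qed
        then have "\<forall>\<^sub>F n in sequentially. indicator (A n) \<omega> = (0 :: real)"
          unfolding eventually_sequentially by (auto intro!: exI[of _ N] simp: indicator_def)
        then show ?case by (rule tendsto_eventually)
      qed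
      then have "(\<lambda>n. LINT \<omega>|\<mu>. indicator (A n) \<omega> :: real) \<longlonglongrightarrow> (LINT \<omega>|\<mu>. 0)"
        by (intro integral_dominated_convergence[where w = "\<lambda>_. 1"]) (auto simp: indicator_def)
      then show ?thesis by simp
    qed
    then have "(\<lambda>n. C M2 * exp (- M1 * r) * 2 + measure \<mu> (A n)) \<longlonglongrightarrow> C M2 * exp (- M1 * r) * 2 + 0"
      by (intro tendsto_intros)
    moreover have "measure \<mu> (A 0) \<le> C M2 * exp (- M1 * r) * 2 + measure \<mu> (A n)" for n
    proof -
      have "C M2 * exp (- M1 * r) * (2 - 2 * (1 / 2) ^ n) \<le> C M2 * exp (- M1 * r) * 2"
        using C[of M2] by (intro mult_left_mono) auto
      then show ?thesis using iter[of n] by linarith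
    qed
    ultimately have "measure \<mu> (A 0) \<le> C M2 * exp (- M1 * r) * 2"
      by (intro LIMSEQ_le_const) auto
    also have "\<dots> \<le> C M2 * exp (- M * r) * 2"
      using C[of M2] M1(2) \<open>r \<ge> 1\<close> by (intro mult_right_mono mult_left_mono) auto
    finally show ?thesis by (simp add: A_def X_def mult_ac)
  qed
  show ?thesis using main C by (intro exI[of _ "2 * C M2"]) auto
qed

text \<open>Either some neighbour exceeds n in squared L2-norm, which has probability O(exp(- M n))
  by the L2 tail, or all stay below n and the single-site estimate applies at the price exp(B n).
  The superquadratic weight has done its work in the L2 tail; here the estimate is used with weight
  exponent 0.\<close>

lemma gibbs_hoelder_tail:
  fixes V :: "real \<Rightarrow> real"
  assumes \<gamma>: "loop_gaussian \<beta> m (a\<^sup>2) \<gamma>" and "\<beta> > 0" "m > 0" "a\<^sup>2 > 0" "J > 0"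
    and V: "self_interaction V" and "0 < \<alpha>" "\<alpha> < 1/2" "0 \<le> M"
  shows "\<exists>C\<ge>0. \<forall>(\<mu> :: (int ^ 'd::finite \<Rightarrow> real \<Rightarrow>\<^sub>C real) measure)\<in>tempered_gibbs_measures \<beta> V J \<gamma>.
    \<forall>k n. emeasure \<mu> {\<omega> \<in> space \<mu>. hoelder_norm \<beta> \<alpha> (\<omega> k) > 2 ^ n} \<le> ennreal (C * exp (- M * real n))"
proof -
  obtain B and C :: "real \<Rightarrow> real" where "B \<ge> 0" and C: "\<And>M. C M \<ge> 0" and est:
    "\<And>M S T k (\<mu> :: (int ^ 'd::finite \<Rightarrow> real \<Rightarrow>\<^sub>C real) measure).
      \<mu> \<in> gibbs_measures \<beta> V J \<gamma> \<Longrightarrow> T \<in> sets borel \<Longrightarrow>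
      emeasure \<mu> {\<omega> \<in> space \<mu>. \<omega> k \<in> T \<and> (\<forall>k'. adjacent k k' \<longrightarrow> L2_inner \<beta> (\<omega> k') (\<omega> k') \<le> S)} \<le>
      ennreal (C M * exp (B * S)) * (\<integral>\<^sup>+\<upsilon>. ennreal (exp (- M * L2_inner \<beta> (apply_bcontfun \<upsilon>) (apply_bcontfun \<upsilon>))) * indicator T \<upsilon> \<partial>\<gamma>)"
    by (rule gibbs_single_site_estimate[OF \<gamma> \<open>\<beta> > 0\<close> \<open>J > 0\<close> V]) (rule that)
  obtain C1 where "C1 \<ge> 0" and C1: "\<And>(\<mu> :: (int ^ 'd::finite \<Rightarrow> real \<Rightarrow>\<^sub>C real) measure) k r.
      \<mu> \<in> tempered_gibbs_measures \<beta> V J \<gamma> \<Longrightarrow> r \<ge> 1 \<Longrightarrow>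
      measure \<mu> {\<omega> \<in> space \<mu>. L2_inner \<beta> (apply_bcontfun (\<omega> k)) (apply_bcontfun (\<omega> k)) > r} \<le> C1 * exp (- M * r)"
    using gibbs_L2_tail[OF \<gamma> \<open>\<beta> > 0\<close> \<open>J > 0\<close> V, of M] by blast
  \<comment> \<open>The first bound makes 4^(- q n) \<le> exp(- (B + M) n), the second is the
    summability condition of the chaining.\<close>
  obtain q :: nat where q: "real q > max (B + M) (1 / (1 - 2 * \<alpha>))"
    using reals_Archimedean2 by blast
  then have "real q * (1 - 2 * \<alpha>) > 1" using \<open>\<alpha> < 1/2\<close> by (simp add: field_simps)
  then obtain C2 where "C2 \<ge> 0" and C2: "\<And>N. emeasure \<gamma> {\<upsilon> \<in> space \<gamma>. hoelder_norm \<beta> \<alpha> \<upsilon> > 2 ^ N} \<le> ennreal (C2 / 4 ^ (q * N))"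
    using loop_gaussian_hoelder_tail[OF \<gamma> assms(2-4) \<open>0 < \<alpha>\<close> \<open>\<alpha> < 1/2\<close>] by metis
  define D where "D = card {j :: int ^ 'd. lnorm j = 1}"
  define K where "K = max 1 (C 0 * C2 + real D * C1)"
  have main: "emeasure \<mu> {\<omega> \<in> space \<mu>. hoelder_norm \<beta> \<alpha> (\<omega> k) > 2 ^ n} \<le> ennreal (K * exp (- M * real n))"
    if \<mu>: "\<mu> \<in> tempered_gibbs_measures \<beta> V J \<gamma>" for \<mu> :: "(int ^ 'd \<Rightarrow> real \<Rightarrow>\<^sub>C real) measure" and k n
  proof -
    have \<mu>g: "\<mu> \<in> gibbs_measures \<beta> V J \<gamma>" using \<mu> by (auto simp: tempered_gibbs_measures_def)
    interpret prob_space \<mu> by (rule gibbs_measuresD(1)[OF \<mu>g])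
    show ?thesis
    proof (cases "n = 0")
      \<comment> \<open>The L2 tail is available for levels r \<ge> 1 only; for n = 0 the trivial
        bound 1 suffices since K \<ge> 1.\<close>
      case True
      have "emeasure \<mu> {\<omega> \<in> space \<mu>. hoelder_norm \<beta> \<alpha> (\<omega> k) > 2 ^ n} \<le> ennreal 1"
        using emeasure_le_1 by simp
      also have "\<dots> \<le> ennreal (K * exp (- M * real n))"
        using True by (intro ennreal_leI) (simp add: K_def)
      finally show ?thesis .
    next
      case False
      let ?T = "{\<upsilon>. hoelder_norm \<beta> \<alpha> \<upsilon> > 2 ^ n}"
      have T: "?T \<in> sets borel"
        using borel_measurable_hoelder_norm[OF \<open>\<beta> > 0\<close>, of \<alpha>] by measurable
      have "?T \<inter> space \<gamma> \<in> sets \<gamma>"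
        using T loop_gaussianD(2,3)[OF \<gamma>] by (auto simp: sets_restrict_space)
      have "{\<upsilon> \<in> space \<gamma>. hoelder_norm \<beta> \<alpha> \<upsilon> > 2 ^ n} = ?T \<inter> space \<gamma>" by auto
      define X where "X j \<omega> = L2_inner \<beta> (apply_bcontfun (\<omega> j)) (apply_bcontfun (\<omega> j))" for j :: "int ^ 'd" and \<omega>
      have X [measurable]: "X j \<in> borel_measurable \<mu>" for j
        unfolding X_def[abs_def] by (intro gibbs_measurable[OF \<mu>g] borel_measurable_L2_inner \<open>\<beta> > 0\<close>)
      have H [measurable]: "(\<lambda>\<omega>. hoelder_norm \<beta> \<alpha> (\<omega> k)) \<in> borel_measurable \<mu>"
        by (intro gibbs_measurable[OF \<mu>g] borel_measurable_hoelder_norm \<open>\<beta> > 0\<close>)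
      define E where "E = {\<omega> \<in> space \<mu>. hoelder_norm \<beta> \<alpha> (\<omega> k) > 2 ^ n \<and> (\<forall>j\<in>{j. adjacent k j}. X j \<omega> \<le> real n)}"
      define F where "F j = {\<omega> \<in> space \<mu>. X j \<omega> > real n}" for j
      have mE: "E \<in> sets \<mu>" unfolding E_def
        by (intro sets.sets_Collect_conj sets.sets_Collect_finite_All finite_adjacent) measurable
      have mF: "F j \<in> sets \<mu>" for j unfolding F_def by measurable
      have "(\<integral>\<^sup>+\<upsilon>. indicator ?T \<upsilon> \<partial>\<gamma>) = (\<integral>\<^sup>+\<upsilon>. indicator (?T \<inter> space \<gamma>) \<upsilon> \<partial>\<gamma>)"
        by (intro nn_integral_cong) (simp add: indicator_def)
      also have "\<dots> = emeasure \<gamma> {\<upsilon> \<in> space \<gamma>. hoelder_norm \<beta> \<alpha> \<upsilon> > 2 ^ n}"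
        unfolding \<open>{\<upsilon> \<in> space \<gamma>. hoelder_norm \<beta> \<alpha> \<upsilon> > 2 ^ n} = ?T \<inter> space \<gamma>\<close>
        by (rule nn_integral_indicator) fact
      also have "\<dots> \<le> ennreal (C2 * exp (- (B + M) * real n))"
      proof (rule order_trans[OF C2 ennreal_leI])
        have "exp ((B + M) * real n) \<le> exp (real q * real n)"
          using q by (simp add: mult_right_mono)
        also have "\<dots> = exp 1 ^ (q * n)" using exp_of_nat_mult[of "q * n" "1 :: real"] by simp
        also have "\<dots> \<le> (4::real) ^ (q * n)"
          by (intro power_mono order_trans[OF exp_le]) auto
        finally have "1 / 4 ^ (q * n) \<le> exp (- ((B + M) * real n))"
          by (simp add: exp_minus divide_simps)
        from mult_left_mono[OF this \<open>C2 \<ge> 0\<close>]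
        show "C2 / 4 ^ (q * n) \<le> C2 * exp (- (B + M) * real n)"
          by (simp only: mult_minus_left times_divide_eq_right mult_1_right)
      qed
      finally have g: "(\<integral>\<^sup>+\<upsilon>. indicator ?T \<upsilon> \<partial>\<gamma>) \<le> ennreal (C2 * exp (- (B + M) * real n))" .
      have "emeasure \<mu> E = emeasure \<mu> {\<omega> \<in> space \<mu>. \<omega> k \<in> ?T \<and> (\<forall>j. adjacent k j \<longrightarrow> L2_inner \<beta> (\<omega> j) (\<omega> j) \<le> real n)}"
        by (simp add: E_def X_def)
      also have "\<dots> \<le> ennreal (C 0 * exp (B * real n)) * (\<integral>\<^sup>+\<upsilon>. indicator ?T \<upsilon> \<partial>\<gamma>)"
        using est[OF \<mu>g T, of k "real n" 0] by simp
      also have "\<dots> \<le> ennreal (C 0 * exp (B * real n)) * ennreal (C2 * exp (- (B + M) * real n))"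
        by (rule mult_left_mono[OF g]) simp
      also have "\<dots> = ennreal (C 0 * exp (B * real n) * (C2 * exp (- (B + M) * real n)))"
        using C[of 0] \<open>C2 \<ge> 0\<close> by (intro ennreal_mult[symmetric]) auto
      also have "C 0 * exp (B * real n) * (C2 * exp (- (B + M) * real n)) =
          C 0 * C2 * (exp (B * real n) * exp (- (B + M) * real n))" by (simp only: mult_ac)
      also have "exp (B * real n) * exp (- (B + M) * real n) = exp (- M * real n)"
        unfolding exp_add[symmetric] by (simp add: algebra_simps)
      finally have "measure \<mu> E \<le> C 0 * C2 * exp (- M * real n)"
        using C[of 0] \<open>C2 \<ge> 0\<close> by (simp add: emeasure_eq_measure)
      moreover have "measure \<mu> (\<Union>j\<in>{j. adjacent k j}. F j) \<le> real D * C1 * exp (- M * real n)"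
      proof -
        have "measure \<mu> (\<Union>j\<in>{j. adjacent k j}. F j) \<le> (\<Sum>j | adjacent k j. measure \<mu> (F j))"
          by (intro measure_UNION_le finite_adjacent mF)
        also have "\<dots> \<le> (\<Sum>j | adjacent k j. C1 * exp (- M * real n))"
          unfolding F_def X_def using False by (intro sum_mono C1[OF \<mu>]) auto
        also have "\<dots> = real (card {j. adjacent k j}) * (C1 * exp (- M * real n))" by simp
        also have "\<dots> \<le> real D * (C1 * exp (- M * real n))"
          unfolding D_def using card_adjacent_le[of k] \<open>C1 \<ge> 0\<close> by (intro mult_right_mono) auto
        finally show ?thesis by simp
      qed
      moreover have "measure \<mu> {\<omega> \<in> space \<mu>. hoelder_norm \<beta> \<alpha> (\<omega> k) > 2 ^ n}
          \<le> measure \<mu> (E \<union> (\<Union>j\<in>{j. adjacent k j}. F j))"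
        by (intro finite_measure_mono sets.Un sets.finite_UN finite_adjacent mE mF)
          (auto simp: E_def F_def not_le)
      moreover have "\<dots> \<le> measure \<mu> E + measure \<mu> (\<Union>j\<in>{j. adjacent k j}. F j)"
        by (intro measure_Un_le sets.finite_UN finite_adjacent mE mF)
      ultimately have "measure \<mu> {\<omega> \<in> space \<mu>. hoelder_norm \<beta> \<alpha> (\<omega> k) > 2 ^ n}
          \<le> (C 0 * C2 + real D * C1) * exp (- M * real n)"
        by (simp add: distrib_right)
      also have "\<dots> \<le> K * exp (- M * real n)"
        by (intro mult_right_mono) (auto simp: K_def)
      finally show ?thesis by (simp add: emeasure_eq_measure ennreal_leI)
    qed
  qed
  have "K \<ge> 0" by (simp add: K_def)
  then show ?thesis using main by blast
qed

section \<open>From tails to moments and to the support\<close>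

lemma epowr_mono: "x \<le> y \<Longrightarrow> 0 \<le> Q \<Longrightarrow> epowr x Q \<le> epowr y Q"
  unfolding epowr_def
  by (auto simp: top_unique less_top intro!: ennreal_leI powr_mono2 enn2real_mono)

text \<open>For 2^n < x \<le> 2^(n + 1) the n-th term alone is at least x^Q, and the summand 1
  covers x \<le> 1. At x = \<infinity> all indicators are 1 and the series diverges.\<close>

lemma epowr_le_dyadic_layers:
  assumes "0 \<le> Q"
  shows "epowr x Q \<le> 1 + (\<Sum>n. ennreal (2 powr (real (Suc n) * Q)) * indicator {2 ^ n<..} x)"
proof (cases "x = \<infinity>")
  case True
  let ?f = "\<lambda>n. ennreal (2 powr (real (Suc n) * Q)) * indicator {2 ^ n<..} x"
  have f1: "1 \<le> ?f n" for n
  proof -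
    have "(2::real) powr 0 \<le> 2 powr (real (Suc n) * Q)"
      using assms by (intro powr_mono) auto
    then have "ennreal 1 \<le> ennreal (2 powr (real (Suc n) * Q))" by (intro ennreal_leI) simp
    moreover have "(2::ennreal) ^ n < x"
      unfolding True ennreal_numeral[symmetric] by (subst ennreal_power) auto
    ultimately show ?thesis by simp
  qed
  have "suminf ?f = \<infinity>"
  proof (rule ccontr)
    assume "suminf ?f \<noteq> \<infinity>"
    then obtain N where "suminf ?f < of_nat N"
      using ennreal_Ex_less_of_nat by (auto simp: less_top)
    then have N: "suminf ?f \<le> of_nat N" by (rule less_imp_le)
    have "of_nat (Suc N) = (\<Sum>n<Suc N. (1::ennreal))" by simp
    also have "\<dots> \<le> sum ?f {..<Suc N}" by (intro sum_mono f1)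
    also have "\<dots> \<le> suminf ?f" by (rule sum_le_suminf) auto
    also note N
    finally show False by (simp only: of_nat_le_iff)
  qed
  then show ?thesis by simp
next
  case False
  let ?f = "\<lambda>n. ennreal (2 powr (real (Suc n) * Q)) * indicator {2 ^ n<..} x"
  obtain r where r: "0 \<le> r" "x = ennreal r" using False by (cases x) auto
  have ex: "epowr x Q = ennreal (r powr Q)" using r by (simp add: epowr_def)
  show ?thesis
  proof (cases "r \<le> 1")
    case True
    have "r powr Q \<le> 1 powr Q" using r True assms by (intro powr_mono2) auto
    then have "epowr x Q \<le> 1" by (simp add: ex)
    then show ?thesis by (rule order_trans) simp
  next
    case False
    have exN: "\<exists>N. r \<le> 2 ^ N" using real_arch_pow[of 2 r] by (auto intro: less_imp_le)
    define N where "N = (LEAST N. r \<le> 2 ^ N)"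
    have N: "r \<le> 2 ^ N" unfolding N_def using exN by (rule LeastI_ex)
    then have "N \<noteq> 0" using False by (intro notI) simp
    then obtain n where n: "N = Suc n" using not0_implies_Suc by blast
    have "\<not> r \<le> 2 ^ n" using not_less_Least[of n "\<lambda>N. r \<le> 2 ^ N"] n N_def by auto
    then have "ennreal (2 ^ n) < x" using False unfolding r(2) by (intro ennreal_lessI) auto
    then have ind: "indicator {2 ^ n<..} x = (1 :: ennreal)"
      by (simp flip: ennreal_power)
    have "r powr Q \<le> (2 ^ Suc n) powr Q" using N n r assms by (intro powr_mono2) auto
    also have "\<dots> = 2 powr (real (Suc n) * Q)" by (subst powr_realpow[symmetric]) (simp_all only: powr_powr zero_less_numeral)
    finally have "epowr x Q \<le> ?f n" unfolding ex ind by (simp add: ennreal_leI)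
    also have "\<dots> = sum ?f {n}"
      by (simp only: sum.insert finite.emptyI empty_iff not_False_eq_True sum.empty add_0_right)
    also have "\<dots> \<le> suminf ?f" by (rule sum_le_suminf) auto
    also have "\<dots> \<le> 1 + suminf ?f" by simp
    finally show ?thesis .
  qed
qed

lemma gibbs_hoelder_moment:
  fixes V :: "real \<Rightarrow> real"
  assumes \<gamma>: "loop_gaussian \<beta> m (a\<^sup>2) \<gamma>" and "\<beta> > 0" "m > 0" "a\<^sup>2 > 0" "J > 0"
    and V: "self_interaction V" and "0 < \<alpha>" "\<alpha> < 1/2" and Q: "Q > 0"
  shows "\<exists>K. \<forall>(\<mu> :: (int ^ 'd::finite \<Rightarrow> real \<Rightarrow>\<^sub>C real) measure)\<in>tempered_gibbs_measures \<beta> V J \<gamma>.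
    \<forall>k. (\<integral>\<^sup>+\<omega>. epowr (hoelder_norm \<beta> \<alpha> (\<omega> k)) Q \<partial>\<mu>) \<le> ennreal K"
proof -
  obtain C where "C \<ge> 0" and C: "\<And>(\<mu> :: (int ^ 'd::finite \<Rightarrow> real \<Rightarrow>\<^sub>C real) measure) k n.
      \<mu> \<in> tempered_gibbs_measures \<beta> V J \<gamma> \<Longrightarrow>
      emeasure \<mu> {\<omega> \<in> space \<mu>. hoelder_norm \<beta> \<alpha> (\<omega> k) > 2 ^ n} \<le> ennreal (C * exp (- Q * real n))"
    using gibbs_hoelder_tail[OF assms(1-8), of Q] Q by (auto simp: less_imp_le)
  \<comment> \<open>The tail is used with rate M = Q, so the layers decay like y^n with y = (2 /
    e)^Q < 1.\<close>
  define y where "y = 2 powr Q * exp (- Q)"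
  have y: "0 < y" "y < 1"
  proof -
    show "0 < y" by (simp add: y_def)
    have "y = exp (Q * ln 2 - Q)" by (simp add: y_def powr_def exp_diff exp_minus divide_inverse mult.commute)
    also have "\<dots> < exp 0"
      using Q ln_2_less_1 mult_strict_left_mono[of "ln 2" 1 Q] by (simp only: exp_less_cancel_iff) simp
    finally show "y < 1" by simp
  qed
  define K where "K = 1 + C * 2 powr Q / (1 - y)"
  have "(\<integral>\<^sup>+\<omega>. epowr (hoelder_norm \<beta> \<alpha> (\<omega> k)) Q \<partial>\<mu>) \<le> ennreal K"
    if \<mu>: "\<mu> \<in> tempered_gibbs_measures \<beta> V J \<gamma>" for \<mu> :: "(int ^ 'd \<Rightarrow> real \<Rightarrow>\<^sub>C real) measure" and k
  proof -
    have \<mu>g: "\<mu> \<in> gibbs_measures \<beta> V J \<gamma>" using \<mu> by (auto simp: tempered_gibbs_measures_def)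
    interpret prob_space \<mu> by (rule gibbs_measuresD(1)[OF \<mu>g])
    have H [measurable]: "(\<lambda>\<omega>. hoelder_norm \<beta> \<alpha> (\<omega> k)) \<in> borel_measurable \<mu>"
      by (intro gibbs_measurable[OF \<mu>g] borel_measurable_hoelder_norm \<open>\<beta> > 0\<close>)
    let ?S = "\<lambda>n. {\<omega> \<in> space \<mu>. hoelder_norm \<beta> \<alpha> (\<omega> k) > 2 ^ n}"
    have "(\<integral>\<^sup>+\<omega>. epowr (hoelder_norm \<beta> \<alpha> (\<omega> k)) Q \<partial>\<mu>)
        \<le> (\<integral>\<^sup>+\<omega>. 1 + (\<Sum>n. ennreal (2 powr (real (Suc n) * Q)) * indicator (?S n) \<omega>) \<partial>\<mu>)"
    proof (rule nn_integral_mono)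
      fix \<omega> assume "\<omega> \<in> space \<mu>"
      then have "indicator {2 ^ n<..} (hoelder_norm \<beta> \<alpha> (\<omega> k)) = (indicator (?S n) \<omega> :: ennreal)" for n
        by (simp add: indicator_def)
      then show "epowr (hoelder_norm \<beta> \<alpha> (\<omega> k)) Q \<le> 1 + (\<Sum>n. ennreal (2 powr (real (Suc n) * Q)) * indicator (?S n) \<omega>)"
        using epowr_le_dyadic_layers[of Q "hoelder_norm \<beta> \<alpha> (\<omega> k)"] Q by simp
    qed
    also have "\<dots> = 1 + (\<integral>\<^sup>+\<omega>. (\<Sum>n. ennreal (2 powr (real (Suc n) * Q)) * indicator (?S n) \<omega>) \<partial>\<mu>)"
      by (subst nn_integral_add) (auto simp: emeasure_space_1)
    also have "(\<integral>\<^sup>+\<omega>. (\<Sum>n. ennreal (2 powr (real (Suc n) * Q)) * indicator (?S n) \<omega>) \<partial>\<mu>) =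
        (\<Sum>n. \<integral>\<^sup>+\<omega>. ennreal (2 powr (real (Suc n) * Q)) * indicator (?S n) \<omega> \<partial>\<mu>)"
      by (rule nn_integral_suminf) measurable
    also have "\<dots> = (\<Sum>n. ennreal (2 powr (real (Suc n) * Q)) * emeasure \<mu> (?S n))"
      by (intro suminf_cong nn_integral_cmult_indicator) measurable
    also have "\<dots> \<le> (\<Sum>n. ennreal (C * 2 powr Q * y ^ n))"
    proof (intro suminf_le summableI)
      fix n
      have "ennreal (2 powr (real (Suc n) * Q)) * emeasure \<mu> (?S n)
          \<le> ennreal (2 powr (real (Suc n) * Q)) * ennreal (C * exp (- Q * real n))"
        by (rule mult_left_mono[OF C[OF \<mu>]]) simp
      also have "\<dots> = ennreal (2 powr (real (Suc n) * Q) * (C * exp (- Q * real n)))"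
        using \<open>C \<ge> 0\<close> by (intro ennreal_mult[symmetric]) auto
      also have "2 powr (real (Suc n) * Q) * (C * exp (- Q * real n)) = C * 2 powr Q * y ^ n"
      proof -
        have "2 powr (real (Suc n) * Q) = 2 powr Q * 2 powr (Q * real n)"
          by (simp only: powr_add[symmetric]) (simp add: algebra_simps)
        also have "2 powr (Q * real n) = (2 powr Q) ^ n"
          by (simp only: powr_powr[symmetric]) (simp add: powr_realpow)
        finally have "2 powr (real (Suc n) * Q) = 2 powr Q * (2 powr Q) ^ n" .
        moreover have "exp (- Q * real n) = exp (- Q) ^ n"
          using exp_of_nat_mult[of n "- Q"] by (simp add: mult.commute)
        ultimately show ?thesis by (simp add: y_def power_mult_distrib)
      qed
      finally show "ennreal (2 powr (real (Suc n) * Q)) * emeasure \<mu> (?S n) \<le> ennreal (C * 2 powr Q * y ^ n)" .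
    qed
    also have "\<dots> = ennreal (C * 2 powr Q / (1 - y))"
      using \<open>C \<ge> 0\<close> y sums_mult[OF geometric_sums[of y], of "C * 2 powr Q"]
      by (intro suminf_ennreal_eq) auto
    also have "1 + ennreal (C * 2 powr Q / (1 - y)) = ennreal K"
      using \<open>C \<ge> 0\<close> y unfolding K_def by (subst ennreal_plus) auto
    finally show ?thesis by (simp add: add_left_mono)
  qed
  then show ?thesis by blast
qed

text \<open>Circle distances are at most \<beta>, so lowering the exponent multiplies the Hoelder
  quotient by at most \<beta>^(\<alpha>' - \<alpha>).\<close>

lemma hoelder_norm_finite_antimono:
  assumes "hoelder_norm \<beta> \<alpha>' \<upsilon> < \<infinity>" "0 \<le> \<alpha>" "\<alpha> \<le> \<alpha>'" "\<beta> > 0"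
  shows "hoelder_norm \<beta> \<alpha> \<upsilon> < \<infinity>"
proof (cases "\<alpha> = 0")
  case True
  then show ?thesis by (simp add: hoelder_norm_def)
next
  case False
  let ?I = "{(s, t). s \<in> {0..<\<beta>} \<and> t \<in> {0..<\<beta>} \<and> s \<noteq> t}"
  let ?q = "\<lambda>\<alpha>. SUP (s, t) \<in> ?I. ennreal (\<bar>\<upsilon> s - \<upsilon> t\<bar> / circle_dist \<beta> s t powr \<alpha>)"
  have "\<alpha> > 0" "\<alpha>' \<noteq> 0" using False assms by auto
  have "?q \<alpha>' < \<infinity>"
    using assms(1) \<open>\<alpha>' \<noteq> 0\<close> unfolding hoelder_norm_def by (simp add: ennreal_add_less_top)
  have "?q \<alpha> \<le> ennreal (\<beta> powr (\<alpha>' - \<alpha>)) * ?q \<alpha>'"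
  proof (rule SUP_least, clarify)
    fix s t assume st: "s \<in> {0..<\<beta>}" "t \<in> {0..<\<beta>}" "s \<noteq> t"
    have d: "0 < circle_dist \<beta> s t" "circle_dist \<beta> s t \<le> \<beta>"
      using st by (auto simp: circle_dist_def)
    have "\<bar>\<upsilon> s - \<upsilon> t\<bar> / circle_dist \<beta> s t powr \<alpha> =
        circle_dist \<beta> s t powr (\<alpha>' - \<alpha>) * (\<bar>\<upsilon> s - \<upsilon> t\<bar> / circle_dist \<beta> s t powr \<alpha>')"
      using d by (simp add: powr_diff)
    also have "\<dots> \<le> \<beta> powr (\<alpha>' - \<alpha>) * (\<bar>\<upsilon> s - \<upsilon> t\<bar> / circle_dist \<beta> s t powr \<alpha>')"
      using d assms by (intro mult_right_mono powr_mono2) auto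
    finally have "ennreal (\<bar>\<upsilon> s - \<upsilon> t\<bar> / circle_dist \<beta> s t powr \<alpha>) \<le>
        ennreal (\<beta> powr (\<alpha>' - \<alpha>)) * ennreal (\<bar>\<upsilon> s - \<upsilon> t\<bar> / circle_dist \<beta> s t powr \<alpha>')"
      by (subst ennreal_mult[symmetric]) (auto intro: ennreal_leI)
    also have "\<dots> \<le> ennreal (\<beta> powr (\<alpha>' - \<alpha>)) * ?q \<alpha>'"
      using st by (intro mult_left_mono SUP_upper2[of "(s, t)"]) auto
    finally show "ennreal (\<bar>\<upsilon> s - \<upsilon> t\<bar> / circle_dist \<beta> s t powr \<alpha>) \<le> ennreal (\<beta> powr (\<alpha>' - \<alpha>)) * ?q \<alpha>'" .
  qed
  also have "\<dots> < \<infinity>" using \<open>?q \<alpha>' < \<infinity>\<close> by (simp add: ennreal_mult_less_top)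
  finally show ?thesis using False unfolding hoelder_norm_def by simp
qed

text \<open>The intersection over uncountably many exponents equals one over a sequence tending to
  1/2, which makes it measurable and lets almost sure statements be combined over all n and
  k.\<close>

lemma gibbs_hoelder_support:
  fixes V :: "real \<Rightarrow> real"
  assumes \<gamma>: "loop_gaussian \<beta> m (a\<^sup>2) \<gamma>" and "\<beta> > 0" "m > 0" "a\<^sup>2 > 0" "J > 0"
    and V: "self_interaction V"
    and \<mu>: "(\<mu> :: (int ^ 'd::finite \<Rightarrow> real \<Rightarrow>\<^sub>C real) measure) \<in> tempered_gibbs_measures \<beta> V J \<gamma>"
  shows "emeasure \<mu> (\<Inter>\<alpha>\<in>{0..<1/2}. {\<omega>. \<forall>k. \<omega> k \<in> hoelder_loops \<beta> \<alpha>}) = 1"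
proof -
  have \<mu>g: "\<mu> \<in> gibbs_measures \<beta> V J \<gamma>" using \<mu> by (auto simp: tempered_gibbs_measures_def)
  interpret prob_space \<mu> by (rule gibbs_measuresD(1)[OF \<mu>g])
  have sp: "space \<mu> = configs \<beta>" by (rule gibbs_measuresD(2)[OF \<mu>g])
  \<comment> \<open>The shift by 3 keeps every exponent strictly between 0 and 1/2.\<close>
  define e where "e n = 1 / 2 - 1 / (real n + 3)" for n :: nat
  have e: "0 < e n" "e n < 1 / 2" for n by (auto simp: e_def field_simps)
  have H [measurable]: "(\<lambda>\<omega>. hoelder_norm \<beta> \<alpha> (\<omega> k)) \<in> borel_measurable \<mu>" for \<alpha> k
    by (intro gibbs_measurable[OF \<mu>g] borel_measurable_hoelder_norm \<open>\<beta> > 0\<close>)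
  have set_eq: "(\<Inter>\<alpha>\<in>{0..<1/2}. {\<omega>. \<forall>k. \<omega> k \<in> hoelder_loops \<beta> \<alpha>}) =
      {\<omega> \<in> space \<mu>. \<forall>n k. hoelder_norm \<beta> (e n) (\<omega> k) < \<infinity>}"
  proof (intro equalityI subsetI)
    fix \<omega> :: "int ^ 'd \<Rightarrow> real \<Rightarrow>\<^sub>C real" assume \<omega>: "\<omega> \<in> (\<Inter>\<alpha>\<in>{0..<1/2}. {\<omega>. \<forall>k. \<omega> k \<in> hoelder_loops \<beta> \<alpha>})"
    then have "\<omega> k \<in> hoelder_loops \<beta> (e n)" for k n
      using e[of n] by (auto simp: less_imp_le)
    then show "\<omega> \<in> {\<omega> \<in> space \<mu>. \<forall>n k. hoelder_norm \<beta> (e n) (\<omega> k) < \<infinity>}"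
      unfolding sp configs_def hoelder_loops_def by blast
  next
    fix \<omega> :: "int ^ 'd \<Rightarrow> real \<Rightarrow>\<^sub>C real" assume \<omega>: "\<omega> \<in> {\<omega> \<in> space \<mu>. \<forall>n k. hoelder_norm \<beta> (e n) (\<omega> k) < \<infinity>}"
    have "\<omega> k \<in> hoelder_loops \<beta> \<alpha>" if \<alpha>: "\<alpha> \<in> {0..<1/2}" for \<alpha> k
    proof -
      obtain n where "1 / real (Suc n) < 1 / 2 - \<alpha>"
        using nat_approx_posE[of "1 / 2 - \<alpha>"] \<alpha> by auto
      moreover have "1 / (real n + 3) \<le> 1 / real (Suc n)" by (simp add: frac_le)
      ultimately have "\<alpha> \<le> e n" by (simp add: e_def)
      moreover have "hoelder_norm \<beta> (e n) (\<omega> k) < \<infinity>" using \<omega> by blast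
      ultimately have "hoelder_norm \<beta> \<alpha> (\<omega> k) < \<infinity>"
        using hoelder_norm_finite_antimono \<alpha> \<open>\<beta> > 0\<close> by fastforce
      then show ?thesis using \<omega> unfolding sp configs_def hoelder_loops_def by blast
    qed
    then show "\<omega> \<in> (\<Inter>\<alpha>\<in>{0..<1/2}. {\<omega>. \<forall>k. \<omega> k \<in> hoelder_loops \<beta> \<alpha>})" by blast
  qed
  \<comment> \<open>A finite first moment suffices, because \<open>epowr\<close> keeps the value
    \<infinity>.\<close>
  have fin: "AE \<omega> in \<mu>. hoelder_norm \<beta> (e n) (\<omega> k) < \<infinity>" for n k
  proof -
    obtain K where "(\<integral>\<^sup>+\<omega>. epowr (hoelder_norm \<beta> (e n) (\<omega> k)) 1 \<partial>\<mu>) \<le> ennreal K"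
      using gibbs_hoelder_moment[OF assms(1-6) e[of n], of 1] \<mu> by auto
    then have "(\<integral>\<^sup>+\<omega>. epowr (hoelder_norm \<beta> (e n) (\<omega> k)) 1 \<partial>\<mu>) \<noteq> \<infinity>"
      by (auto simp: top_unique)
    moreover have "(\<lambda>\<omega>. epowr (hoelder_norm \<beta> (e n) (\<omega> k)) 1) \<in> borel_measurable \<mu>"
      unfolding epowr_def by measurable
    ultimately have "AE \<omega> in \<mu>. epowr (hoelder_norm \<beta> (e n) (\<omega> k)) 1 \<noteq> \<infinity>"
      by (intro nn_integral_noteq_infinite)
    then show ?thesis by eventually_elim (auto simp: epowr_def less_top split: if_splits)
  qed
  have "{\<omega> \<in> space \<mu>. \<forall>n k. hoelder_norm \<beta> (e n) (\<omega> k) < \<infinity>} \<in> sets \<mu>" by measurable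
  moreover have "AE \<omega> in \<mu>. \<omega> \<in> {\<omega> \<in> space \<mu>. \<forall>n k. hoelder_norm \<beta> (e n) (\<omega> k) < \<infinity>}"
    using fin by (simp add: AE_all_countable)
  ultimately show ?thesis unfolding set_eq by (intro emeasure_eq_1_AE)
qed

theorem mainTheorem2:
  fixes \<beta> m a J :: real
    and V :: "real \<Rightarrow> real"
    and \<gamma> :: "(real \<Rightarrow>\<^sub>C real) measure"
    and \<G> :: "(int ^ 'd::finite \<Rightarrow> real \<Rightarrow>\<^sub>C real) measure set"
  assumes "\<beta> > 0" and "m > 0" and "a\<^sup>2 > 0" and "J > 0"
    and "self_interaction V"
    and "loop_gaussian \<beta> m (a\<^sup>2) \<gamma>"
    and "\<G> = tempered_gibbs_measures \<beta> V J \<gamma>"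
  shows "(\<forall>\<mu>\<in>\<G>. emeasure \<mu> (\<Inter>\<alpha>\<in>{0..<1/2}. {\<omega>. \<forall>k. \<omega> k \<in> hoelder_loops \<beta> \<alpha>}) = 1) \<and>
    (\<forall>Q\<ge>1. \<forall>\<alpha>\<in>{0..<1/2}.
       (SUP \<mu>\<in>\<G>. SUP k. \<integral>\<^sup>+\<omega>. epowr (hoelder_norm \<beta> \<alpha> (\<omega> k)) Q \<partial>\<mu>) < \<infinity>)"
proof (intro conjI ballI allI impI)
  show "emeasure \<mu> (\<Inter>\<alpha>\<in>{0..<1/2}. {\<omega>. \<forall>k. \<omega> k \<in> hoelder_loops \<beta> \<alpha>}) = 1" if "\<mu> \<in> \<G>" for \<mu>
    using gibbs_hoelder_support[OF assms(6,1-5)] that assms(7) by blast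
  fix Q \<alpha> :: real assume Q: "1 \<le> Q" and \<alpha>: "\<alpha> \<in> {0..<1/2}"
  \<comment> \<open>At exponent 0 the norm is the sup-norm, which is part of the norm at any
    positive exponent; 1/4 is one such exponent below 1/2.\<close>
  define \<alpha>' where "\<alpha>' = (if \<alpha> = 0 then 1/4 else \<alpha>)"
  have \<alpha>': "0 < \<alpha>'" "\<alpha>' < 1/2" using \<alpha> by (auto simp: \<alpha>'_def)
  have le: "hoelder_norm \<beta> \<alpha> \<upsilon> \<le> hoelder_norm \<beta> \<alpha>' \<upsilon>" for \<upsilon>
    by (simp add: \<alpha>'_def hoelder_norm_def)
  obtain K where K: "\<And>\<mu> k. \<mu> \<in> \<G> \<Longrightarrow> (\<integral>\<^sup>+\<omega>. epowr (hoelder_norm \<beta> \<alpha>' (\<omega> k)) Q \<partial>\<mu>) \<le> ennreal K"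
    using gibbs_hoelder_moment[OF assms(6,1-5) \<alpha>', of Q, where 'd = 'd] Q assms(7) by auto
  have "(SUP \<mu>\<in>\<G>. SUP k. \<integral>\<^sup>+\<omega>. epowr (hoelder_norm \<beta> \<alpha> (\<omega> k)) Q \<partial>\<mu>) \<le> ennreal K"
  proof (intro SUP_least)
    fix \<mu> k assume "\<mu> \<in> \<G>"
    have "(\<integral>\<^sup>+\<omega>. epowr (hoelder_norm \<beta> \<alpha> (\<omega> k)) Q \<partial>\<mu>) \<le> (\<integral>\<^sup>+\<omega>. epowr (hoelder_norm \<beta> \<alpha>' (\<omega> k)) Q \<partial>\<mu>)"
      using Q by (intro nn_integral_mono epowr_mono le) auto
    then show "(\<integral>\<^sup>+\<omega>. epowr (hoelder_norm \<beta> \<alpha> (\<omega> k)) Q \<partial>\<mu>) \<le> ennreal K"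
      using K[OF \<open>\<mu> \<in> \<G>\<close>] order_trans by blast
  qed
  then show "(SUP \<mu>\<in>\<G>. SUP k. \<integral>\<^sup>+\<omega>. epowr (hoelder_norm \<beta> \<alpha> (\<omega> k)) Q \<partial>\<mu>) < \<infinity>"
    by (rule le_less_trans) simp
qed

end
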